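(* Fix nonnegative rationals $\varepsilon,\delta$ with $\delta<2$, and nonnegative integers $M$, $N\ge1$, such that $\nu\varepsilon-(N-k)\delta+2\ne0$ for all $0\le\nu\le M$, $0\le k\le N-1$. For $b=(b',b'')=(b'_0,\dots,b'_M,b''_0,\dots,b''_N)\in\mathbb{C}^{M+N+2}$ with $b'\ne0$, let $P(b;Z)=\sum_\mu b'_\mu Z^\mu$, $Q(b;Z)=\sum_\nu b''_\nu Z^\nu$. Then there exist an ARP $T(B',B'')\in\mathbb{Z}|(B',B'')|$ and $s_1\in(0,1)$ such that for every such $b$ with $|||Q(b;Z)-Z^N|||<s_1$ and $Q(b;Z)$ having only simple roots, $b$ lies in the strict domain of $T$ and $$\int_B\frac{|P(b;z)|^\varepsilon}{|Q(b;z)|^\delta}\,dV\sim T(b),$$ with implied constants independent of $b$, where $B$ is the unit disk.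
   Context: An ARP in variables $X$ with integer coefficients is an expression $K(X)/L(X)$ with $K=(\sum_i|P_i(X)|^2)^{\varepsilon'/2}$, $L=(\sum_j|Q_j(X)|^2)^{\delta'/2}$, finitely many $P_i,Q_j\in\mathbb{Z}[X]$, not all $P_i$ zero, $\varepsilon',\delta'$ nonnegative rationals; its strict domain is where neither $K$ nor $L$ vanishes. For $Q(Z)=\sum_\mu b_\mu Z^\mu$, $|||Q|||=\sum_\mu|b_\mu|$. $dV$ is Lebesgue measure on $\mathbb{C}$; $\sim$ means two-sided bounds up to positive constants. *)

theory Defs
  imports "HOL-Analysis.Analysis" "HOL-Computational_Algebra.Polynomial"
begin

text \<open>Integer-coefficient polynomials in the complex variables x 0, ..., x (n-1),
  represented as a finite list of monomials (coefficient, exponent vector).\<close>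
type_synonym ipoly = "(int \<times> (nat \<Rightarrow> nat)) list"

definition ipoly_eval :: "nat \<Rightarrow> ipoly \<Rightarrow> (nat \<Rightarrow> complex) \<Rightarrow> complex" where
  "ipoly_eval n p x = (\<Sum>(c, e) \<leftarrow> p. of_int c * (\<Prod>i<n. x i ^ e i))"

text \<open>Real power with the convention t^0 = 1 (also for t = 0).\<close>
definition rpow :: "real \<Rightarrow> real \<Rightarrow> real" where
  "rpow t a = (if a = 0 then 1 else t powr a)"

text \<open>An ARP K(X)/L(X): K = (sum |P_i|^2)^(eps'/2), L = (sum |Q_j|^2)^(delta'/2).\<close>
record arp =
  arp_num :: "ipoly list"
  arp_den :: "ipoly list"
  arp_num_exp :: real
  arp_den_exp :: real

definition is_ARP :: "nat \<Rightarrow> arp \<Rightarrow> bool" where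
  "is_ARP n T \<longleftrightarrow> arp_num_exp T \<in> \<rat> \<and> arp_num_exp T \<ge> 0 \<and>
     arp_den_exp T \<in> \<rat> \<and> arp_den_exp T \<ge> 0 \<and>
     (\<exists>P\<in>set (arp_num T). \<exists>x. ipoly_eval n P x \<noteq> 0)"

definition arp_K :: "nat \<Rightarrow> arp \<Rightarrow> (nat \<Rightarrow> complex) \<Rightarrow> real" where
  "arp_K n T x = rpow (\<Sum>P \<leftarrow> arp_num T. (cmod (ipoly_eval n P x))^2) (arp_num_exp T / 2)"

definition arp_L :: "nat \<Rightarrow> arp \<Rightarrow> (nat \<Rightarrow> complex) \<Rightarrow> real" where
  "arp_L n T x = rpow (\<Sum>Q \<leftarrow> arp_den T. (cmod (ipoly_eval n Q x))^2) (arp_den_exp T / 2)"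

definition arp_val :: "nat \<Rightarrow> arp \<Rightarrow> (nat \<Rightarrow> complex) \<Rightarrow> real" where
  "arp_val n T x = arp_K n T x / arp_L n T x"

definition arp_strict_domain :: "nat \<Rightarrow> arp \<Rightarrow> (nat \<Rightarrow> complex) set" where
  "arp_strict_domain n T = {x. arp_K n T x \<noteq> 0 \<and> arp_L n T x \<noteq> 0}"

definition join_coeffs :: "nat \<Rightarrow> (nat \<Rightarrow> complex) \<Rightarrow> (nat \<Rightarrow> complex) \<Rightarrow> nat \<Rightarrow> complex" where
  "join_coeffs M b1 b2 i = (if i \<le> M then b1 i else b2 (i - (M + 1)))"

definition coeff_poly :: "nat \<Rightarrow> (nat \<Rightarrow> complex) \<Rightarrow> complex poly" where
  "coeff_poly D b = (\<Sum>\<nu>\<le>D. monom (b \<nu>) \<nu>)"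

end

theory Submission
  imports Defs "HOL-Computational_Algebra.Computational_Algebra"
begin

text \<open>
  Let \<open>Z\<close> be the set of roots of \<open>Q\<close>. On the part of the disk nearest to \<open>x \<in> Z\<close>, \<open>|Q(z)|\<close> is
  comparable to \<open>\<Phi>\<^sub>x(r) = \<Prod>\<^sub>w max(r, |x - w|)\<close> with \<open>r = |z - x|\<close>, so the integral is comparable to the
  sum over \<open>x\<close> and over the Taylor coefficients \<open>a\<^sub>k\<close> of \<open>P\<close> at \<open>x\<close> of \<open>|a\<^sub>k|\<^sup>\<epsilon>\<close> times the integral of
  \<open>g(r) = r\<^bsup>k\<epsilon>+2\<^esup> / \<Phi>\<^sub>x(r)\<^sup>\<delta>\<close> against \<open>dr/r\<close>. The function \<open>g\<close> is a power of \<open>r\<close> between consecutive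
  distances \<open>|x - w|\<close>; the non-resonance hypothesis says that no exponent vanishes, so that integral is
  comparable to \<open>1 + \<Sum>\<^sub>w g(|x - w|)\<close>.

  In terms of the Taylor coefficients \<open>q\<^sub>j\<close> of \<open>Q\<close> at \<open>x\<close>, \<open>\<Phi>\<^sub>x(r)\<close> is comparable to \<open>\<Sum>\<^sub>j |q\<^sub>j| r\<^sup>j\<close>.
  Hence the result is an ARP in the coefficients, a root \<open>x\<close> of \<open>Q\<close> and a root \<open>w - x\<close> of
  \<open>Q(x + t)/t\<close>, summed over these roots, and it remains to see that such a sum is again an ARP in the
  remaining variables. For a single numerator and denominator, the largest ratio \<open>|p\<^sub>i/l\<^sub>i|\<close> is comparable
  to \<open>max\<^sub>k |e\<^sub>k/e\<^sub>0|\<^bsup>1/k\<^esup>\<close>, where \<open>\<Prod>\<^sub>i (l\<^sub>i + p\<^sub>i u) = \<Sum>\<^sub>k e\<^sub>k u\<^sup>k\<close>; the \<open>e\<^sub>k\<close> are symmetric in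
  the roots and lie in the coefficient ring by Newton's identities. A denominator that is a sum of
  absolute values is replaced by finitely many integer combinations, one of which is, by the pigeonhole
  principle, uniformly large at all roots simultaneously.
\<close>

section \<open>Values and coefficients of split polynomials\<close>

text \<open>A single root, and hence a distance |x - w|, is not a function of the coefficients; only
  expressions symmetric in the roots are. So the roots are eliminated one at a time: t = w - x over
  the ring with x adjoined, then x over the coefficient ring. For this to iterate, the class
  \<open>arp_like\<close> must be closed under sums, products, quotients by positive functions and
  nonnegative rational powers; it asks only that some power be comparable to a quotient of sums of
  norms. The non-resonance condition enters through a count: if j roots, x included, lie within
  distance r of x, the exponent of r is k\<epsilon> + 2 - j\<delta> with j between 1 and N. For j =
  1 it is positive because \<delta> < 2, which is integrability at x. The radius (1/4)^N chosen for
  \<open>s1\<close> puts all roots in the disk of radius 1/4, so their mutual distances are below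
  1/2 and the disks of radius 1/2 around them stay in the unit disk. It also keeps the leading
  coefficient between 1/2 and 2 in modulus, so that clearing its powers costs only bounded
  factors.\<close>

lemma ex_maximizer:
  fixes f :: "'i \<Rightarrow> real"
  assumes "finite I" "I \<noteq> {}"
  shows "\<exists>j\<in>I. \<forall>i\<in>I. f i \<le> f j"
proof -
  have "Max (f ` I) \<in> f ` I" using assms by (intro Max_in) auto
  then obtain j where j: "j \<in> I" "Max (f ` I) = f j" by blast
  moreover have "f i \<le> f j" if "i \<in> I" for i
    unfolding j(2)[symmetric] using assms that by (intro Max_ge) auto
  ultimately show ?thesis by blast
qed

text \<open>Pigeonhole: if each of the \<open>card I + 1\<close> multipliers failed at some index,
  two of them would fail at the same one. The difference of the two small values is a nonzero
  integer multiple of \<open>v\<close>, so \<open>v\<close>, and then \<open>u\<close>, would be too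
  small.\<close>

lemma ex_uniform_multiplier:
  fixes u v :: "'i \<Rightarrow> complex"
  assumes I: "finite I"
  shows "\<exists>t\<le>card I. \<forall>i\<in>I. (cmod (u i) + cmod (v i)) / (2 * real (card I) + 3)
           \<le> cmod (u i + of_nat t * v i)"
proof (rule ccontr)
  define n where "n = card I"
  \<comment> \<open>The estimates below give |b| < 2cm and |a| < cm + 2ncm + (nothing else), that is
    m < (2n + 3)cm for m = |a| + |b|; this \<open>c\<close> turns it into m < m.\<close>
  define c where "c = 1 / (2 * real n + 3)"
  assume "\<not> ?thesis"
  hence "\<forall>t\<in>{..n}. \<exists>i\<in>I. cmod (u i + of_nat t * v i) < c * (cmod (u i) + cmod (v i))"
    unfolding n_def c_def by (simp add: not_le) (metis atMost_iff not_le)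
  then obtain f where f: "\<And>t. t \<le> n \<Longrightarrow> f t \<in> I"
    "\<And>t. t \<le> n \<Longrightarrow> cmod (u (f t) + of_nat t * v (f t)) < c * (cmod (u (f t)) + cmod (v (f t)))"
    by (metis atMost_iff)
  have "card (f ` {..n}) \<le> n"
    unfolding n_def using f(1) by (intro card_mono I) (auto simp: n_def)
  hence "\<not> inj_on f {..n}"
    by (intro pigeonhole) auto
  then obtain s t where st: "s \<le> n" "t \<le> n" "s < t" "f s = f t"
    unfolding inj_on_def by (metis atMost_iff nat_neq_iff)
  define a where "a = u (f t)"
  define b where "b = v (f t)"
  define m where "m = cmod a + cmod b"
  have 1: "cmod (a + of_nat t * b) < c * m" "cmod (a + of_nat s * b) < c * m"
    using f(2)[of t] f(2)[of s] st by (auto simp: a_def b_def m_def)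
  have "cmod b \<le> cmod (of_nat (t - s) * b)"
    using st(3) by (simp add: norm_mult mult_le_cancel_right1 Suc_le_eq del: of_nat_diff)
  also have "of_nat (t - s) * b = (a + of_nat t * b) - (a + of_nat s * b)"
    using st(3) by (simp add: of_nat_diff algebra_simps)
  also have "cmod \<dots> \<le> cmod (a + of_nat t * b) + cmod (a + of_nat s * b)"
    by (rule norm_triangle_ineq4)
  finally have 2: "cmod b < 2 * c * m" using 1 by simp
  have "cmod a \<le> cmod (a + of_nat t * b) + cmod (of_nat t * b)"
    by (metis add_diff_cancel_right' norm_triangle_ineq4)
  also have "cmod (of_nat t * b) \<le> real n * cmod b"
    using st by (simp add: norm_mult mult_right_mono)
  also have "\<dots> \<le> real n * (2 * c * m)"
    using 2 by (intro mult_left_mono) auto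
  finally have "m < (c * m + real n * (2 * c * m)) + 2 * c * m"
    using 1 2 by (simp add: m_def)
  also have "\<dots> = m * (c * (2 * real n + 3))"
    by (simp add: algebra_simps)
  also have "c * (2 * real n + 3) = 1"
    by (simp add: c_def)
  finally show False by simp
qed

lemma norm_poly_le_coeff_sum:
  fixes p :: "complex poly"
  assumes "degree p \<le> n"
  shows "cmod (poly p z) \<le> (\<Sum>k\<le>n. cmod (coeff p k) * cmod z ^ k)"
proof -
  have "poly p z = (\<Sum>k\<le>n. coeff p k * z ^ k)"
    unfolding poly_altdef using assms
    by (intro sum.mono_neutral_left) (auto simp: not_le coeff_eq_0)
  thus ?thesis
    by (auto simp: norm_mult norm_power intro!: order_trans[OF norm_sum] sum_mono)
qed

lemma degree_prod_linear_le:
  fixes u v :: "'i \<Rightarrow> 'a::comm_ring_1"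
  assumes "finite I"
  shows "degree (\<Prod>i\<in>I. [:u i, v i:]) \<le> card I"
proof -
  have "degree (\<Prod>i\<in>I. [:u i, v i:]) \<le> sum (degree \<circ> (\<lambda>i. [:u i, v i:])) I"
    using assms by (rule degree_prod_sum_le)
  also have "\<dots> \<le> (\<Sum>i\<in>I. 1)"
    by (intro sum_mono) (auto intro: order_trans[OF degree_pCons_le])
  finally show ?thesis by simp
qed

text \<open>The coefficient norm weighted by powers of r is submultiplicative, and on a linear
  factor it is |u| + |v| r.\<close>

lemma coeff_sum_prod_linear_le:
  fixes u v :: "'i \<Rightarrow> complex"
  assumes "finite I" "r \<ge> 0"
  shows "(\<Sum>k\<le>card I. cmod (coeff (\<Prod>i\<in>I. [:u i, v i:]) k) * r ^ k)
           \<le> (\<Prod>i\<in>I. cmod (u i) + cmod (v i) * r)"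
  using assms(1)
proof (induction I rule: finite_induct)
  case empty
  thus ?case by simp
next
  case (insert j I)
  define p where "p = (\<Prod>i\<in>I. [:u i, v i:])"
  define n where "n = card I"
  have [simp]: "coeff p (Suc n) = 0"
    using degree_prod_linear_le[OF insert(1), of u v]
    by (intro coeff_eq_0) (auto simp: p_def n_def)
  have "(\<Sum>k\<le>Suc n. cmod (coeff ([:u j, v j:] * p) k) * r ^ k)
      \<le> (\<Sum>k\<le>Suc n. cmod (u j) * (cmod (coeff p k) * r ^ k)) +
        (\<Sum>k\<le>Suc n. cmod (v j) * cmod (coeff (pCons 0 p) k) * r ^ k)"
    unfolding sum.distrib [symmetric]
  proof (rule sum_mono)
    fix k
    have "cmod (coeff ([:u j, v j:] * p) k)
        \<le> cmod (u j * coeff p k) + cmod (v j * coeff (pCons 0 p) k)"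
      by (cases k) (simp_all add: norm_triangle_ineq)
    hence "cmod (coeff ([:u j, v j:] * p) k) * r ^ k
        \<le> (cmod (u j * coeff p k) + cmod (v j * coeff (pCons 0 p) k)) * r ^ k"
      using assms by (intro mult_right_mono) auto
    thus "cmod (coeff ([:u j, v j:] * p) k) * r ^ k \<le> cmod (u j) * (cmod (coeff p k) * r ^ k) +
        cmod (v j) * cmod (coeff (pCons 0 p) k) * r ^ k"
      by (simp add: norm_mult algebra_simps)
  qed
  also have "(\<Sum>k\<le>Suc n. cmod (v j) * cmod (coeff (pCons 0 p) k) * r ^ k) =
      cmod (v j) * r * (\<Sum>k\<le>n. cmod (coeff p k) * r ^ k)"
    unfolding sum.atMost_Suc_shift by (simp add: sum_distrib_left mult_ac)
  also have "(\<Sum>k\<le>Suc n. cmod (u j) * (cmod (coeff p k) * r ^ k)) =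
      cmod (u j) * (\<Sum>k\<le>n. cmod (coeff p k) * r ^ k)"
    by (simp add: sum_distrib_left)
  finally have "(\<Sum>k\<le>Suc n. cmod (coeff ([:u j, v j:] * p) k) * r ^ k)
      \<le> (cmod (u j) + cmod (v j) * r) * (\<Sum>k\<le>n. cmod (coeff p k) * r ^ k)"
    by (simp add: algebra_simps)
  also have "\<dots> \<le> (cmod (u j) + cmod (v j) * r) * (\<Prod>i\<in>I. cmod (u i) + cmod (v i) * r)"
    using insert.IH assms(2) by (intro mult_left_mono) (auto simp: p_def n_def)
  finally show ?case
    using insert(1,2) unfolding p_def n_def
    by (simp only: prod.insert card_insert_disjoint not_False_eq_True)
qed

text \<open>At the point t r the factors are t r - w_i, so \<open>ex_uniform_multiplier\<close> with
  u = -w_i and v = r makes all of them large at once.\<close>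

lemma ex_large_value_prod_linear:
  fixes w :: "'i \<Rightarrow> complex"
  assumes I: "finite I" and r: "r \<ge> (0::real)"
  shows "\<exists>t\<le>card I. (\<Prod>i\<in>I. r + cmod (w i)) / (2 * real (card I) + 3) ^ card I
           \<le> cmod (poly (\<Prod>i\<in>I. [:- w i, 1:]) (of_nat t * of_real r))"
proof -
  obtain t where t: "t \<le> card I" "\<forall>i\<in>I. (cmod (- w i) + cmod (complex_of_real r)) / (2 * real (card I) + 3)
           \<le> cmod (- w i + of_nat t * of_real r)"
    using ex_uniform_multiplier[OF I, of "\<lambda>i. - w i" "\<lambda>_. of_real r"] by blast
  have "(\<Prod>i\<in>I. r + cmod (w i)) / (2 * real (card I) + 3) ^ card I =
        (\<Prod>i\<in>I. (cmod (- w i) + cmod (complex_of_real r)) / (2 * real (card I) + 3))"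
    using r by (simp add: prod_dividef add.commute)
  also have "\<dots> \<le> (\<Prod>i\<in>I. cmod (- w i + of_nat t * of_real r))"
    using t(2) by (intro prod_mono) auto
  also have "\<dots> = cmod (poly (\<Prod>i\<in>I. [:- w i, 1:]) (of_nat t * of_real r))"
    by (simp add: poly_prod prod_norm)
  finally show ?thesis using t(1) by blast
qed

text \<open>A converse of the triangle inequality: some point among 0, r, ..., n r avoids
  cancellation. After factoring, the coefficient sum is at most a product of terms r + |w_i|, which
  a good point attains up to a constant.\<close>

lemma ex_large_value_poly:
  fixes p :: "complex poly"
  assumes deg: "degree p \<le> n" and r: "r \<ge> (0::real)"
  shows "\<exists>t\<le>n. (\<Sum>k\<le>n. cmod (coeff p k) * r ^ k) / (2 * real n + 3) ^ n
           \<le> cmod (poly p (of_nat t * of_real r))"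
proof -
  define d where "d = degree p"
  obtain w where w: "smult (lead_coeff p) (\<Prod>i<d. [:- w i, 1:]) = p"
    using complex_poly_decompose' unfolding d_def by blast
  obtain t where t: "t \<le> d" "(\<Prod>i<d. r + cmod (w i)) / (2 * real d + 3) ^ d
           \<le> cmod (poly (\<Prod>i<d. [:- w i, 1:]) (of_nat t * of_real r))"
    using ex_large_value_prod_linear[of "{..<d}" r w] r by auto
  have d: "d \<le> n" using deg by (simp add: d_def)
  have "(\<Sum>k\<le>n. cmod (coeff p k) * r ^ k) = (\<Sum>k\<le>d. cmod (coeff p k) * r ^ k)"
    using d by (intro sum.mono_neutral_right) (auto simp: d_def coeff_eq_0)
  also have "\<dots> = cmod (lead_coeff p) * (\<Sum>k\<le>d. cmod (coeff (\<Prod>i<d. [:- w i, 1:]) k) * r ^ k)"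
    by (subst w [symmetric]) (simp add: norm_mult sum_distrib_left mult_ac)
  also have "\<dots> \<le> cmod (lead_coeff p) * (\<Prod>i<d. r + cmod (w i))"
    using coeff_sum_prod_linear_le[of "{..<d}" r "\<lambda>i. - w i" "\<lambda>_. 1"] r
    by (intro mult_left_mono) (auto simp: add.commute)
  finally have "(\<Sum>k\<le>n. cmod (coeff p k) * r ^ k) / (2 * real n + 3) ^ n
      \<le> cmod (lead_coeff p) * (\<Prod>i<d. r + cmod (w i)) / (2 * real n + 3) ^ n"
    by (intro divide_right_mono) auto
  also have "\<dots> \<le> cmod (lead_coeff p) * (\<Prod>i<d. r + cmod (w i)) / (2 * real d + 3) ^ d"
  proof (rule divide_left_mono)
    have "(2 * real d + 3) ^ d \<le> (2 * real n + 3) ^ d"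
      using d by (intro power_mono) auto
    also have "\<dots> \<le> (2 * real n + 3) ^ n"
      using d by (intro power_increasing) auto
    finally show "(2 * real d + 3) ^ d \<le> (2 * real n + 3) ^ n" .
    show "0 \<le> cmod (lead_coeff p) * (\<Prod>i<d. r + cmod (w i))"
      using r by (intro mult_nonneg_nonneg prod_nonneg) auto
  qed (simp add: add_nonneg_pos)
  also have "\<dots> \<le> cmod (lead_coeff p) * cmod (poly (\<Prod>i<d. [:- w i, 1:]) (of_nat t * of_real r))"
    using mult_left_mono[OF t(2), of "cmod (lead_coeff p)"] by simp
  also have "\<dots> = cmod (poly (smult (lead_coeff p) (\<Prod>i<d. [:- w i, 1:])) (of_nat t * of_real r))"
    by (simp add: norm_mult)
  finally show ?thesis using t(1) d unfolding w by (meson order_trans)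
qed

text \<open>The large value at t r is bounded by the coefficient sum at t r, and returning to r
  costs a factor t^k, at most (n + 1)^n. This later turns a product of distances into a sum of norms
  of Taylor coefficients.\<close>

lemma prod_linear_le_coeff_sum:
  fixes w :: "'i \<Rightarrow> complex"
  assumes I: "finite I" and r: "r \<ge> (0::real)"
  defines "n \<equiv> card I"
  shows "(\<Prod>i\<in>I. r + cmod (w i))
           \<le> (2 * real n + 3) ^ n * (real n + 1) ^ n *
               (\<Sum>k\<le>n. cmod (coeff (\<Prod>i\<in>I. [:- w i, 1:]) k) * r ^ k)"
proof -
  define p where "p = (\<Prod>i\<in>I. [:- w i, 1:])"
  obtain t where t: "t \<le> n" "(\<Prod>i\<in>I. r + cmod (w i)) / (2 * real n + 3) ^ n
           \<le> cmod (poly p (of_nat t * of_real r))"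
    using ex_large_value_prod_linear[OF I r, of w] unfolding n_def p_def by blast
  have "(\<Prod>i\<in>I. r + cmod (w i)) \<le> (2 * real n + 3) ^ n * cmod (poly p (of_nat t * of_real r))"
    using t(2) by (simp add: divide_simps add_nonneg_pos mult_ac)
  also have "cmod (poly p (of_nat t * of_real r))
      \<le> (\<Sum>k\<le>n. cmod (coeff p k) * cmod (of_nat t * of_real r) ^ k)"
    unfolding p_def n_def using I by (intro norm_poly_le_coeff_sum degree_prod_linear_le)
  also have "\<dots> \<le> (\<Sum>k\<le>n. (real n + 1) ^ n * (cmod (coeff p k) * r ^ k))"
  proof (rule sum_mono)
    fix k assume k: "k \<in> {..n}"
    have "real t ^ k \<le> (real n + 1) ^ k"
      using t(1) by (intro power_mono) auto
    also have "\<dots> \<le> (real n + 1) ^ n"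
      using k by (intro power_increasing) auto
    finally have "real t ^ k * (cmod (coeff p k) * r ^ k) \<le> (real n + 1) ^ n * (cmod (coeff p k) * r ^ k)"
      using r by (intro mult_right_mono) auto
    thus "cmod (coeff p k) * cmod (of_nat t * of_real r) ^ k
         \<le> (real n + 1) ^ n * (cmod (coeff p k) * r ^ k)"
      using r by (simp add: norm_mult power_mult_distrib mult_ac)
  qed
  finally show ?thesis
    by (simp add: p_def sum_distrib_left mult_left_mono mult_ac)
qed

section \<open>Symmetric functions of roots\<close>

text \<open>The generating function of the power sums is H = \<Sum> 1/(1 - x_i X), and the
  logarithmic derivative of \<open>E\<close> gives H = n - X E'/E. Multiplied by \<open>E\<close>,
  this is proved by induction on n from the product rule and the geometric series.\<close>

lemma newton_identity_fps:
  fixes x :: "nat \<Rightarrow> complex"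
  defines "E \<equiv> \<lambda>n. \<Prod>i<n. (1 - fps_const (x i) * fps_X)"
  shows "E n * Abs_fps (\<lambda>j. \<Sum>i<n. x i ^ j) = of_nat n * E n - fps_X * fps_deriv (E n)"
proof (induction n)
  case 0
  have "Abs_fps (\<lambda>j. \<Sum>i<0. x i ^ j) = 0"
    by (simp add: fps_eq_iff)
  thus ?case by (simp add: E_def)
next
  case (Suc n)
  define H where "H = (\<lambda>n. Abs_fps (\<lambda>j. \<Sum>i<n. x i ^ j))"
  define G where "G = Abs_fps (\<lambda>j. x n ^ j)"
  define L where "L = 1 - fps_const (x n) * fps_X"
  have ES: "E (Suc n) = E n * L" by (simp add: E_def L_def)
  have HS: "H (Suc n) = H n + G" by (simp add: H_def G_def fps_eq_iff)
  have LG: "L * G = 1"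
  proof (rule fps_ext)
    fix j show "fps_nth (L * G) j = fps_nth 1 j"
      by (cases j) (simp_all add: L_def G_def left_diff_distrib mult.assoc)
  qed
  have "fps_X * fps_deriv L = L - 1"
    by (simp add: L_def)
  moreover have "fps_X * fps_deriv (E n * L) = fps_X * fps_deriv (E n) * L + E n * (fps_X * fps_deriv L)"
    by (simp add: algebra_simps)
  ultimately have "fps_X * fps_deriv (E n * L) = fps_X * fps_deriv (E n) * L + E n * (L - 1)"
    by simp
  hence "of_nat (Suc n) * E (Suc n) - fps_X * fps_deriv (E (Suc n)) =
      (of_nat n * E n - fps_X * fps_deriv (E n)) * L + E n"
    unfolding ES by (simp only: of_nat_Suc) (simp add: algebra_simps)
  also have "of_nat n * E n - fps_X * fps_deriv (E n) = E n * H n"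
    using Suc.IH by (simp add: H_def)
  also have "E n * H n * L + E n = E n * H n * L + E n * (L * G)"
    by (simp add: LG)
  also have "\<dots> = E (Suc n) * H (Suc n)"
    unfolding ES HS by (simp add: algebra_simps)
  finally have "E (Suc n) * H (Suc n) = of_nat (Suc n) * E (Suc n) - fps_X * fps_deriv (E (Suc n))" ..
  thus ?case unfolding H_def .
qed

text \<open>Read in two directions below: solved for the power sum in the k = 0 term, where E_0 = 1,
  it needs no division; solved for E_j it needs division by j.\<close>

lemma newton_identity_nth:
  fixes x :: "nat \<Rightarrow> complex" and n j :: nat
  defines "E \<equiv> (\<Prod>i<n. (1 - fps_const (x i) * fps_X))"
  shows "(\<Sum>k\<le>j. fps_nth E k * (\<Sum>i<n. x i ^ (j - k))) = (of_nat n - of_nat j) * fps_nth E j"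
proof -
  have "fps_nth (E * Abs_fps (\<lambda>j. \<Sum>i<n. x i ^ j)) j =
        fps_nth (of_nat n * E - fps_X * fps_deriv E) j"
    unfolding E_def by (subst newton_identity_fps) simp
  also have "\<dots> = (of_nat n - of_nat j) * fps_nth E j"
    by (cases j) (simp_all add: algebra_simps flip: fps_of_nat)
  finally show ?thesis
    by (simp add: fps_mult_nth atLeast0AtMost)
qed

lemma fps_nth_prod_linear_0:
  fixes x :: "nat \<Rightarrow> complex"
  shows "fps_nth (\<Prod>i<n. (1 - fps_const (x i) * fps_X)) 0 = 1"
  by (induction n) simp_all

text \<open>The product is the reversal of the monic polynomial with roots x_i, so its coefficients
  are the same ones read from the top.\<close>

lemma fps_nth_prod_linear:
  fixes x :: "nat \<Rightarrow> complex"
  shows "fps_nth (\<Prod>i<n. (1 - fps_const (x i) * fps_X)) k =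
         (if k \<le> n then coeff (\<Prod>i<n. [:- x i, 1:]) (n - k) else 0)"
proof (induction n arbitrary: k)
  case 0
  thus ?case by simp
next
  case (Suc n)
  define p where "p = (\<Prod>i<n. [:- x i, 1:])"
  have p: "coeff p (Suc n) = 0"
    using degree_prod_linear_le[of "{..<n}" "\<lambda>i. - x i" "\<lambda>_. 1"]
    by (intro coeff_eq_0) (auto simp: p_def)
  have E: "fps_nth (\<Prod>i<n. (1 - fps_const (x i) * fps_X)) k =
         (if k \<le> n then coeff p (n - k) else 0)" for k
    unfolding p_def by (rule Suc.IH)
  have "fps_nth (\<Prod>i<Suc n. (1 - fps_const (x i) * fps_X)) k =
        fps_nth (\<Prod>i<n. (1 - fps_const (x i) * fps_X)) k -
        x n * (if k = 0 then 0 else fps_nth (\<Prod>i<n. (1 - fps_const (x i) * fps_X)) (k - 1))"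
    by (cases k) (simp_all add: right_diff_distrib mult.left_commute[of _ "fps_const _"])
  also have "\<dots> = (if k \<le> Suc n then coeff ([:- x n, 1:] * p) (Suc n - k) else 0)"
  proof -
    consider "k = 0" | "k = Suc n" | "k > Suc n" | "0 < k" "k \<le> n"
      by linarith
    thus ?thesis
    proof cases
      case 4
      then obtain j e where "k = Suc j" "n = Suc (j + e)"
        by (metis Suc_le_D add_Suc gr0_implies_Suc le_Suc_ex)
      thus ?thesis unfolding E by simp
    qed (use p in \<open>auto simp: E\<close>)
  qed
  also have "[:- x n, 1:] * p = (\<Prod>i<Suc n. [:- x i, 1:])"
    by (simp only: p_def prod.lessThan_Suc mult.commute)
  finally show ?case .
qed

text \<open>Functions matter only on \<open>Om\<close>. Integers and the leading coefficient \<open>al\<close> are inverted because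
  Newton's identities divide by both.\<close>
locale function_ring =
  fixes S :: "('a \<Rightarrow> complex) set" and Om :: "'a set" and al :: "'a \<Rightarrow> complex"
  assumes of_int_in: "(\<lambda>_. of_int m) \<in> S"
    and add_in: "f \<in> S \<Longrightarrow> g \<in> S \<Longrightarrow> (\<lambda>y. f y + g y) \<in> S"
    and mult_in: "f \<in> S \<Longrightarrow> g \<in> S \<Longrightarrow> (\<lambda>y. f y * g y) \<in> S"
    and cong_in: "f \<in> S \<Longrightarrow> (\<And>y. y \<in> Om \<Longrightarrow> g y = f y) \<Longrightarrow> g \<in> S"
    and div_nat_in: "(\<lambda>y. of_nat (Suc c) * f y) \<in> S \<Longrightarrow> f \<in> S"
    and al_in: "al \<in> S"
    and div_al_in: "(\<lambda>y. al y * f y) \<in> S \<Longrightarrow> f \<in> S"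
    and al_nonzero: "y \<in> Om \<Longrightarrow> al y \<noteq> 0"
begin

lemma of_nat_in: "(\<lambda>_. of_nat c) \<in> S"
  using of_int_in[of "int c"] by simp

lemma zero_in: "(\<lambda>_. 0) \<in> S" and one_in: "(\<lambda>_. 1) \<in> S"
  using of_int_in[of 0] of_int_in[of 1] by simp_all

lemma uminus_in: "f \<in> S \<Longrightarrow> (\<lambda>y. - f y) \<in> S"
  using mult_in[OF of_int_in[of "-1"], of f] by simp

lemma diff_in: "f \<in> S \<Longrightarrow> g \<in> S \<Longrightarrow> (\<lambda>y. f y - g y) \<in> S"
  using add_in[OF _ uminus_in, of f g] by simp

lemma sum_in: "(\<And>i. i \<in> I \<Longrightarrow> f i \<in> S) \<Longrightarrow> (\<lambda>y. \<Sum>i\<in>I. f i y) \<in> S"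
  by (induction I rule: infinite_finite_induct) (auto intro: add_in zero_in)

lemma power_in: "f \<in> S \<Longrightarrow> (\<lambda>y. f y ^ n) \<in> S"
  by (induction n) (auto intro: mult_in one_in)

end

text \<open>The polynomial ring S[x], realized as functions on pairs. The degree bound is uniform in
  y, so that expanding in powers of x gives one finite sum of coefficient functions.\<close>

definition poly_ext :: "'a set \<Rightarrow> ('a \<Rightarrow> complex) set \<Rightarrow> ('a \<times> complex \<Rightarrow> complex) set" where
  "poly_ext Om S = {f. \<exists>p d. (\<forall>k. (\<lambda>y. coeff (p y) k) \<in> S) \<and> (\<forall>y. degree (p y) \<le> d) \<and>
     (\<forall>y\<in>Om. \<forall>x. f (y, x) = poly (p y) x)}"

lemma poly_extI:
  assumes "\<And>k. (\<lambda>y. coeff (p y) k) \<in> S" "\<And>y. degree (p y) \<le> d"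
    "\<And>y x. y \<in> Om \<Longrightarrow> f (y, x) = poly (p y) x"
  shows "f \<in> poly_ext Om S"
  using assms unfolding poly_ext_def by blast

lemma poly_extE:
  assumes "f \<in> poly_ext Om S"
  obtains p d where "\<And>k. (\<lambda>y. coeff (p y) k) \<in> S" "\<And>y. degree (p y) \<le> d"
    "\<And>y x. y \<in> Om \<Longrightarrow> f (y, x) = poly (p y) x"
  using assms unfolding poly_ext_def by blast

context function_ring
begin

lemma base_in_poly_ext:
  assumes "f \<in> S"
  shows "(\<lambda>z. f (fst z)) \<in> poly_ext Om S"
proof (rule poly_extI[where p = "\<lambda>y. [:f y:]" and d = 0])
  fix k show "(\<lambda>y. coeff [:f y:] k) \<in> S"
    using assms zero_in by (cases k) simp_all
qed auto

lemma snd_in_poly_ext: "snd \<in> poly_ext Om S"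
proof (rule poly_extI[where p = "\<lambda>y. [:0, 1:]" and d = 1])
  fix k show "(\<lambda>y::'a. coeff [:0, 1::complex:] k) \<in> S"
    using one_in zero_in by (cases k; cases "k - 1") (simp_all add: coeff_pCons)
qed auto

text \<open>The extension is again a \<open>function_ring\<close>, so variables can be adjoined
  repeatedly; \<open>al\<close> is carried along as a function that ignores the new
  variable.\<close>

lemma function_ring_poly_ext: "function_ring (poly_ext Om S) (Om \<times> UNIV) (\<lambda>z. al (fst z))"
proof
  fix c :: int
  show "(\<lambda>_. of_int c) \<in> poly_ext Om S"
    using base_in_poly_ext[OF of_int_in[of c]] by simp
next
  fix f g :: "'a \<times> complex \<Rightarrow> complex"
  assume "f \<in> poly_ext Om S" "g \<in> poly_ext Om S"
  then obtain p d q e where p: "\<And>k. (\<lambda>y. coeff (p y) k) \<in> S" "\<And>y. degree (p y) \<le> d"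
      "\<And>y x. y \<in> Om \<Longrightarrow> f (y, x) = poly (p y) x"
    and q: "\<And>k. (\<lambda>y. coeff (q y) k) \<in> S" "\<And>y. degree (q y) \<le> e"
      "\<And>y x. y \<in> Om \<Longrightarrow> g (y, x) = poly (q y) x"
    by (elim poly_extE) blast
  show "(\<lambda>y. f y + g y) \<in> poly_ext Om S"
    by (rule poly_extI[where p = "\<lambda>y. p y + q y" and d = "max d e"])
       (use p q in \<open>auto intro!: add_in degree_add_le intro: max.coboundedI1 max.coboundedI2\<close>)
  show "(\<lambda>y. f y * g y) \<in> poly_ext Om S"
    by (rule poly_extI[where p = "\<lambda>y. p y * q y" and d = "d + e"])
       (use p q in \<open>auto intro!: sum_in mult_in order_trans[OF degree_mult_le] add_mono simp: coeff_mult\<close>)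
next
  fix f g :: "'a \<times> complex \<Rightarrow> complex"
  assume f: "f \<in> poly_ext Om S" and "\<And>y. y \<in> Om \<times> UNIV \<Longrightarrow> g y = f y"
  thus "g \<in> poly_ext Om S"
    unfolding poly_ext_def by simp
next
  fix c :: nat and f :: "'a \<times> complex \<Rightarrow> complex"
  assume "(\<lambda>y. of_nat (Suc c) * f y) \<in> poly_ext Om S"
  then obtain p d where p: "\<And>k. (\<lambda>y. coeff (p y) k) \<in> S" "\<And>y. degree (p y) \<le> d"
      "\<And>y x. y \<in> Om \<Longrightarrow> of_nat (Suc c) * f (y, x) = poly (p y) x"
    by (elim poly_extE) blast
  show "f \<in> poly_ext Om S"
  proof (rule poly_extI[where p = "\<lambda>y. smult (1 / of_nat (Suc c)) (p y)" and d = d])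
    fix k
    have "(\<lambda>y. of_nat (Suc c) * coeff (smult (1 / of_nat (Suc c)) (p y)) k) = (\<lambda>y. coeff (p y) k)"
      by (simp add: field_simps del: of_nat_Suc)
    thus "(\<lambda>y. coeff (smult (1 / of_nat (Suc c)) (p y)) k) \<in> S"
      using p(1) by (rule_tac div_nat_in[of c]) simp
    fix y x assume "y \<in> Om"
    thus "f (y, x) = poly (smult (1 / of_nat (Suc c)) (p y)) x"
      by (simp add: p(3)[symmetric] del: of_nat_Suc)
  qed (use p(2) order.trans[OF degree_smult_le] in blast)
next
  show "(\<lambda>z. al (fst z)) \<in> poly_ext Om S"
    by (intro base_in_poly_ext al_in)
next
  fix f :: "'a \<times> complex \<Rightarrow> complex"
  assume "(\<lambda>y. al (fst y) * f y) \<in> poly_ext Om S"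
  then obtain p d where p: "\<And>k. (\<lambda>y. coeff (p y) k) \<in> S" "\<And>y. degree (p y) \<le> d"
      "\<And>y x. y \<in> Om \<Longrightarrow> al (fst (y, x)) * f (y, x) = poly (p y) x"
    by (elim poly_extE) blast
  show "f \<in> poly_ext Om S"
  proof (rule poly_extI[where p = "\<lambda>y. smult (1 / al y) (p y)" and d = d])
    fix k
    show "(\<lambda>y. coeff (smult (1 / al y) (p y)) k) \<in> S"
      \<comment> \<open>Off \<open>Om\<close> the product of \<open>al\<close> and 1/al may be 0
        instead of 1, so membership is transferred by agreement on \<open>Om\<close>.\<close>
      by (rule div_al_in, rule cong_in[OF p(1)[of k]]) (simp add: al_nonzero)
    fix y x assume y: "y \<in> Om"
    thus "f (y, x) = poly (smult (1 / al y) (p y)) x"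
      using al_nonzero[OF y] by (simp add: p(3)[OF y, symmetric])
  qed (use p(2) order.trans[OF degree_smult_le] in blast)
next
  fix y :: "'a \<times> complex"
  assume "y \<in> Om \<times> UNIV"
  thus "al (fst y) \<noteq> 0"
    using al_nonzero by auto
qed

end

text \<open>The enumeration \<open>xi\<close> of the roots, with multiplicity, is an arbitrary
  choice and is not assumed to lie in \<open>S\<close>; membership will be derived only for
  expressions symmetric in the index.\<close>

locale split_polynomial = function_ring +
  fixes A :: "'a \<Rightarrow> complex poly" and xi :: "'a \<Rightarrow> nat \<Rightarrow> complex" and n :: nat
  assumes coeff_in: "(\<lambda>y. coeff (A y) k) \<in> S"
    and split: "y \<in> Om \<Longrightarrow> A y = smult (al y) (\<Prod>i<n. [:- xi y i, 1:])"
begin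

lemma power_sum_in: "(\<lambda>y. \<Sum>i<n. xi y i ^ j) \<in> S"
proof (induction j rule: less_induct)
  case (less j)
  define E where "E = (\<lambda>y k. fps_nth (\<Prod>i<n. (1 - fps_const (xi y i) * fps_X)) k)"
  \<comment> \<open>These are the coefficients of the monic polynomial A/al in reversed order, hence
    the division by \<open>al\<close>.\<close>
  have E: "(\<lambda>y. E y k) \<in> S" for k
  proof (cases "k \<le> n")
    case True
    show ?thesis
      by (rule div_al_in, rule cong_in[OF coeff_in[of "n - k"]])
         (use True in \<open>simp add: E_def fps_nth_prod_linear split\<close>)
  next
    case False
    thus ?thesis using zero_in by (simp add: E_def fps_nth_prod_linear)
  qed
  have E0: "E y 0 = 1" for y
    by (simp add: E_def fps_nth_prod_linear_0)
  have eq: "(\<Sum>i<n. xi y i ^ j) = (of_nat n - of_nat j) * E y j -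
              (\<Sum>k\<in>{0<..j}. E y k * (\<Sum>i<n. xi y i ^ (j - k)))" for y
  proof -
    have "{..j} = insert 0 {0<..j}" by auto
    thus ?thesis
      using newton_identity_nth[where x = "xi y" and n = n and j = j] E0[of y]
      by (simp add: E_def algebra_simps)
  qed
  show ?case
    unfolding eq by (intro diff_in mult_in sum_in E less of_nat_in) auto
qed

lemma sum_roots_in:
  assumes "F \<in> poly_ext Om S"
  shows "(\<lambda>y. \<Sum>i<n. F (y, xi y i)) \<in> S"
proof -
  obtain p d where p: "\<And>k. (\<lambda>y. coeff (p y) k) \<in> S" "\<And>y. degree (p y) \<le> d"
      "\<And>y x. y \<in> Om \<Longrightarrow> F (y, x) = poly (p y) x"
    using assms by (elim poly_extE) blast
  have "(\<lambda>y. \<Sum>k\<le>d. coeff (p y) k * (\<Sum>i<n. xi y i ^ k)) \<in> S"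
    by (intro sum_in mult_in p power_sum_in)
  thus ?thesis
  proof (rule cong_in)
    fix y assume y: "y \<in> Om"
    have "F (y, x) = (\<Sum>k\<le>d. coeff (p y) k * x ^ k)" for x
      unfolding p(3)[OF y] poly_altdef using p(2)[of y]
      by (intro sum.mono_neutral_left) (auto simp: not_le coeff_eq_0)
    thus "(\<Sum>i<n. F (y, xi y i)) = (\<Sum>k\<le>d. coeff (p y) k * (\<Sum>i<n. xi y i ^ k))"
      by (simp add: sum_distrib_left sum.swap[of _ "{..<n}"])
  qed
qed

text \<open>The values of \<open>F\<close> at the roots are treated as new roots. Their power sums
  are sums over the roots of powers of \<open>F\<close>, hence in \<open>S\<close>; Newton's
  identities, now solved for the elementary symmetric functions, give the product as the last one up
  to sign.\<close>

lemma prod_roots_in: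
  assumes F: "F \<in> poly_ext Om S"
  shows "(\<lambda>y. \<Prod>i<n. F (y, xi y i)) \<in> S"
proof -
  interpret P: function_ring "poly_ext Om S" "Om \<times> UNIV" "\<lambda>z. al (fst z)"
    by (rule function_ring_poly_ext)
  define f where "f = (\<lambda>y i. F (y, xi y i))"
  define E where "E = (\<lambda>y k. fps_nth (\<Prod>i<n. (1 - fps_const (f y i) * fps_X)) k)"
  have p: "(\<lambda>y. \<Sum>i<n. f y i ^ j) \<in> S" for j
    unfolding f_def using sum_roots_in[OF P.power_in[OF F]] by simp
  have E: "(\<lambda>y. E y j) \<in> S" for j
  proof (induction j rule: less_induct)
    case (less j)
    show ?case
    proof (cases j)
      case 0
      thus ?thesis using one_in by (simp add: E_def fps_nth_prod_linear_0)
    next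
      case (Suc c)
      \<comment> \<open>In the k = j term the power sum has exponent 0 and equals n. The two
        multiples n E_j cancel, which leaves j E_j in terms of smaller indices.\<close>
      have "{..j} = insert j {..<j}" by auto
      hence nj: "E y j * of_nat n + (\<Sum>k<j. E y k * (\<Sum>i<n. f y i ^ (j - k))) =
          (of_nat n - of_nat j) * E y j" for y
        using newton_identity_nth[where x = "f y" and n = n and j = j]
        unfolding E_def by simp
      have "of_nat j * E y j = - (\<Sum>k<j. E y k * (\<Sum>i<n. f y i ^ (j - k)))" for y
        using nj[of y] by algebra
      moreover have "(\<lambda>y. - (\<Sum>k<j. E y k * (\<Sum>i<n. f y i ^ (j - k)))) \<in> S"
        by (intro uminus_in sum_in mult_in less p) auto
      ultimately show ?thesis
        using Suc by (rule_tac div_nat_in[of c]) simp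
    qed
  qed
  have "(\<lambda>y. (-1) ^ n * E y n) \<in> S"
    by (intro mult_in power_in E) (use of_int_in[of "-1"] in simp)
  also have "(\<lambda>y. (-1) ^ n * E y n) = (\<lambda>y. \<Prod>i<n. F (y, xi y i))"
    by (simp add: E_def f_def fps_nth_prod_linear poly_prod prod_uminus flip: poly_0_coeff_0)
  finally show ?thesis .
qed

text \<open>Coefficients are read off from values: with a new variable u, the product of F + uG over
  the roots lies in S[u], and two polynomials in u with equal values at all complex u have equal
  coefficients.\<close>

lemma coeff_prod_roots_in:
  assumes F: "F \<in> poly_ext Om S" and G: "G \<in> poly_ext Om S"
  shows "(\<lambda>y. coeff (\<Prod>i<n. [:F (y, xi y i), G (y, xi y i):]) k) \<in> S"
proof -
  let ?S1 = "poly_ext Om S" and ?Om1 = "Om \<times> (UNIV :: complex set)"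
  let ?S2 = "poly_ext ?Om1 ?S1"
  interpret P: function_ring ?S1 ?Om1 "\<lambda>z. al (fst z)"
    by (rule function_ring_poly_ext)
  interpret PP: function_ring ?S2 "?Om1 \<times> UNIV" "\<lambda>z. al (fst (fst z))"
    by (rule P.function_ring_poly_ext)
  \<comment> \<open>The variable of \<open>?S1\<close> is u and the one of \<open>?S2\<close> stands
    for a root. The polynomial and its roots do not involve u, so they serve over the larger ring
    unchanged.\<close>
  interpret P: split_polynomial ?S1 ?Om1 "\<lambda>z. al (fst z)" "\<lambda>z. A (fst z)" "\<lambda>z. xi (fst z)" n
    by unfold_locales (use split in \<open>auto intro!: base_in_poly_ext coeff_in\<close>)
  have lift: "(\<lambda>z. H (fst (fst z), snd z)) \<in> ?S2" if H: "H \<in> ?S1" for H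
  proof -
    obtain p d where p: "\<And>k. (\<lambda>y. coeff (p y) k) \<in> S" "\<And>y. degree (p y) \<le> d"
      "\<And>y x. y \<in> Om \<Longrightarrow> H (y, x) = poly (p y) x"
      using H by (elim poly_extE) blast
    show ?thesis
      by (rule poly_extI[where p = "\<lambda>z. p (fst z)" and d = d])
         (use p in \<open>auto intro!: base_in_poly_ext[where f = "\<lambda>y. coeff (p y) _"]\<close>)
  qed
  have "(\<lambda>z. F (fst (fst z), snd z) + snd (fst z) * G (fst (fst z), snd z)) \<in> ?S2"
    by (intro PP.add_in PP.mult_in lift F G P.base_in_poly_ext snd_in_poly_ext)
  from P.prod_roots_in[OF this]
  have "(\<lambda>z. \<Prod>i<n. F (fst z, xi (fst z) i) + snd z * G (fst z, xi (fst z) i)) \<in> ?S1"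
    by simp
  then obtain p d where p: "\<And>k. (\<lambda>y. coeff (p y) k) \<in> S"
    "\<And>y x. y \<in> Om \<Longrightarrow> (\<Prod>i<n. F (fst (y, x), xi (fst (y, x)) i) +
        snd (y, x) * G (fst (y, x), xi (fst (y, x)) i)) = poly (p y) x"
    by (elim poly_extE) blast
  show ?thesis
  proof (rule cong_in[OF p(1)[of k]])
    fix y assume "y \<in> Om"
    hence "poly (\<Prod>i<n. [:F (y, xi y i), G (y, xi y i):]) = poly (p y)"
      using p(2) by (auto simp: fun_eq_iff poly_prod)
    thus "coeff (\<Prod>i<n. [:F (y, xi y i), G (y, xi y i):]) k = coeff (p y) k"
      by (simp add: poly_eq_poly_eq_iff)
  qed
qed

end

section \<open>Functions comparable to ARPs\<close>

definition comparable_on :: "'a set \<Rightarrow> ('a \<Rightarrow> real) \<Rightarrow> ('a \<Rightarrow> real) \<Rightarrow> bool" where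
  "comparable_on D f g \<longleftrightarrow> (\<exists>C>0. \<forall>y\<in>D. 0 \<le> f y \<and> f y \<le> C * g y \<and> g y \<le> C * f y)"

lemma comparable_onI2:
  assumes "C1 \<ge> 0" "C2 \<ge> 0" "\<And>y. y \<in> D \<Longrightarrow> 0 \<le> f y" "\<And>y. y \<in> D \<Longrightarrow> 0 \<le> g y"
    "\<And>y. y \<in> D \<Longrightarrow> f y \<le> C1 * g y" "\<And>y. y \<in> D \<Longrightarrow> g y \<le> C2 * f y"
  shows "comparable_on D f g"
  unfolding comparable_on_def
proof (intro exI[of _ "C1 + C2 + 1"] conjI ballI)
  fix y assume y: "y \<in> D"
  show "f y \<le> (C1 + C2 + 1) * g y" "g y \<le> (C1 + C2 + 1) * f y" "0 \<le> f y"
    using assms(3-6)[OF y] assms(1,2)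
    by (auto simp: algebra_simps add_increasing add_increasing2)
qed (use assms in auto)

lemma comparable_onE:
  assumes "comparable_on D f g"
  obtains C where "C > 0" "\<And>y. y \<in> D \<Longrightarrow> 0 \<le> f y" "\<And>y. y \<in> D \<Longrightarrow> 0 \<le> g y"
    "\<And>y. y \<in> D \<Longrightarrow> f y \<le> C * g y" "\<And>y. y \<in> D \<Longrightarrow> g y \<le> C * f y"
proof -
  obtain C where C: "C > 0" "\<forall>y\<in>D. 0 \<le> f y \<and> f y \<le> C * g y \<and> g y \<le> C * f y"
    using assms unfolding comparable_on_def by blast
  have "0 \<le> g y" if "y \<in> D" for y
  proof -
    have "0 \<le> C * g y" using C that by force
    thus ?thesis using \<open>C > 0\<close> by (simp add: zero_le_mult_iff)
  qed
  thus ?thesis using C that by blast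
qed

lemma comparable_on_refl: "(\<And>y. y \<in> D \<Longrightarrow> 0 \<le> f y) \<Longrightarrow> comparable_on D f f"
  by (rule comparable_onI2[of 1 1]) auto

lemma comparable_on_trans:
  assumes "comparable_on D f g" "comparable_on D g h"
  shows "comparable_on D f h"
proof -
  obtain C1 where C1: "C1 > 0" "\<And>y. y \<in> D \<Longrightarrow> 0 \<le> f y" "\<And>y. y \<in> D \<Longrightarrow> 0 \<le> g y"
    "\<And>y. y \<in> D \<Longrightarrow> f y \<le> C1 * g y" "\<And>y. y \<in> D \<Longrightarrow> g y \<le> C1 * f y"
    using assms(1) by (elim comparable_onE) blast
  obtain C2 where C2: "C2 > 0" "\<And>y. y \<in> D \<Longrightarrow> 0 \<le> h y"
    "\<And>y. y \<in> D \<Longrightarrow> g y \<le> C2 * h y" "\<And>y. y \<in> D \<Longrightarrow> h y \<le> C2 * g y"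
    using assms(2) by (elim comparable_onE) blast
  show ?thesis
  proof (rule comparable_onI2[of "C1 * C2" "C2 * C1"])
    fix y assume y: "y \<in> D"
    have "f y \<le> C1 * g y" using C1 y by blast
    also have "\<dots> \<le> C1 * (C2 * h y)" using C1 C2 y by (intro mult_left_mono) auto
    finally show "f y \<le> C1 * C2 * h y" by (simp add: mult_ac)
    have "h y \<le> C2 * g y" using C2 y by blast
    also have "\<dots> \<le> C2 * (C1 * f y)" using C1 C2 y by (intro mult_left_mono) auto
    finally show "h y \<le> C2 * C1 * f y" by (simp add: mult_ac)
  qed (use C1 C2 in auto)
qed

lemma comparable_on_add:
  assumes "comparable_on D f g" "comparable_on D f' g'"
  shows "comparable_on D (\<lambda>y. f y + f' y) (\<lambda>y. g y + g' y)"
proof -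
  obtain C1 where C1: "C1 > 0" "\<And>y. y \<in> D \<Longrightarrow> 0 \<le> f y" "\<And>y. y \<in> D \<Longrightarrow> 0 \<le> g y"
    "\<And>y. y \<in> D \<Longrightarrow> f y \<le> C1 * g y" "\<And>y. y \<in> D \<Longrightarrow> g y \<le> C1 * f y"
    using assms(1) by (elim comparable_onE) blast
  obtain C2 where C2: "C2 > 0" "\<And>y. y \<in> D \<Longrightarrow> 0 \<le> f' y" "\<And>y. y \<in> D \<Longrightarrow> 0 \<le> g' y"
    "\<And>y. y \<in> D \<Longrightarrow> f' y \<le> C2 * g' y" "\<And>y. y \<in> D \<Longrightarrow> g' y \<le> C2 * f' y"
    using assms(2) by (elim comparable_onE) blast
  have *: "a + a' \<le> (C1 + C2) * (b + b')"
    if "a \<le> C1 * b" "a' \<le> C2 * b'" "b \<ge> 0" "b' \<ge> 0" for a a' b b' :: real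
  proof -
    have "0 \<le> C1 * b'" "0 \<le> C2 * b"
      using that C1(1) C2(1) by simp_all
    thus ?thesis using that by (simp add: algebra_simps)
  qed
  show ?thesis
    by (rule comparable_onI2[of "C1 + C2" "C1 + C2"]) (use C1 C2 * in auto)
qed

lemma comparable_on_mult:
  assumes "comparable_on D f g" "comparable_on D f' g'"
  shows "comparable_on D (\<lambda>y. f y * f' y) (\<lambda>y. g y * g' y)"
proof -
  obtain C1 where C1: "C1 > 0" "\<And>y. y \<in> D \<Longrightarrow> 0 \<le> f y" "\<And>y. y \<in> D \<Longrightarrow> 0 \<le> g y"
    "\<And>y. y \<in> D \<Longrightarrow> f y \<le> C1 * g y" "\<And>y. y \<in> D \<Longrightarrow> g y \<le> C1 * f y"
    using assms(1) by (elim comparable_onE) blast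
  obtain C2 where C2: "C2 > 0" "\<And>y. y \<in> D \<Longrightarrow> 0 \<le> f' y" "\<And>y. y \<in> D \<Longrightarrow> 0 \<le> g' y"
    "\<And>y. y \<in> D \<Longrightarrow> f' y \<le> C2 * g' y" "\<And>y. y \<in> D \<Longrightarrow> g' y \<le> C2 * f' y"
    using assms(2) by (elim comparable_onE) blast
  have *: "a * a' \<le> (C1 * C2) * (b * b')"
    if "a \<le> C1 * b" "a' \<le> C2 * b'" "b \<ge> 0" "b' \<ge> 0" "a \<ge> 0" "a' \<ge> 0" for a a' b b' :: real
    using mult_mono[OF that(1,2)] that C1(1) C2(1) by (simp add: mult_ac)
  show ?thesis
    by (rule comparable_onI2[of "C1 * C2" "C1 * C2"]) (use C1 C2 * in auto)
qed

lemma comparable_on_power: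
  "comparable_on D f g \<Longrightarrow> comparable_on D (\<lambda>y. f y ^ n) (\<lambda>y. g y ^ n)"
  by (induction n) (auto intro: comparable_on_mult comparable_on_refl)

lemma comparable_on_inverse:
  assumes "comparable_on D f g" "\<And>y. y \<in> D \<Longrightarrow> 0 < f y"
  shows "comparable_on D (\<lambda>y. 1 / f y) (\<lambda>y. 1 / g y)"
proof -
  obtain C where C: "C > 0" "\<And>y. y \<in> D \<Longrightarrow> f y \<le> C * g y" "\<And>y. y \<in> D \<Longrightarrow> g y \<le> C * f y"
    using assms(1) by (elim comparable_onE) blast
  have g: "0 < g y" if "y \<in> D" for y
  proof -
    have "0 < C * g y" using C(2)[OF that] assms(2)[OF that] by linarith
    thus ?thesis using C(1) by (simp add: zero_less_mult_iff)
  qed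
  show ?thesis
    by (rule comparable_onI2[of C C])
       (use C assms(2) g in \<open>auto simp: divide_simps less_imp_le mult_ac\<close>)
qed

lemma comparable_on_divide:
  assumes "comparable_on D f g" "comparable_on D f' g'" "\<And>y. y \<in> D \<Longrightarrow> 0 < f' y"
  shows "comparable_on D (\<lambda>y. f y / f' y) (\<lambda>y. g y / g' y)"
  using comparable_on_mult[OF assms(1) comparable_on_inverse[OF assms(2,3)]] by simp

lemma comparable_on_pos:
  assumes "comparable_on D f g" "y \<in> D" "0 < f y"
  shows "0 < g y"
proof -
  obtain C where C: "C > 0" "f y \<le> C * g y"
    using assms by (elim comparable_onE) blast
  hence "0 < C * g y" using assms by linarith
  thus ?thesis using C by (simp add: zero_less_mult_iff)
qed

lemma comparable_on_cong:
  "comparable_on D f g \<Longrightarrow> (\<And>y. y \<in> D \<Longrightarrow> f y = f' y) \<Longrightarrow> (\<And>y. y \<in> D \<Longrightarrow> g y = g' y) \<Longrightarrow>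
     comparable_on D f' g'"
  unfolding comparable_on_def by simp

text \<open>Both sides lie between the m-th power of the largest summand and a constant multiple of
  it; m > 0 makes both 0 for an empty sum.\<close>

lemma comparable_on_power_sum:
  assumes I: "finite I" and m: "m > 0" and h: "\<And>i y. i \<in> I \<Longrightarrow> y \<in> D \<Longrightarrow> 0 \<le> h i y"
  shows "comparable_on D (\<lambda>y. (\<Sum>i\<in>I. h i y) ^ m) (\<lambda>y. \<Sum>i\<in>I. h i y ^ m)"
proof (rule comparable_onI2[of "real (card I) ^ m" "real (card I)"])
  fix y assume y: "y \<in> D"
  show "(\<Sum>i\<in>I. h i y ^ m) \<le> real (card I) * (\<Sum>i\<in>I. h i y) ^ m"
    using y h I by (intro sum_bounded_above power_mono member_le_sum) auto
  show "(\<Sum>i\<in>I. h i y) ^ m \<le> real (card I) ^ m * (\<Sum>i\<in>I. h i y ^ m)"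
  proof (cases "I = {}")
    case True
    thus ?thesis using m by (simp add: power_0_left)
  next
    case False
    then obtain j where j: "j \<in> I" "\<And>i. i \<in> I \<Longrightarrow> h i y \<le> h j y"
      using ex_maximizer[OF I, of "\<lambda>i. h i y"] by blast
    have "(\<Sum>i\<in>I. h i y) ^ m \<le> (real (card I) * h j y) ^ m"
      using j y h by (intro power_mono sum_bounded_above sum_nonneg) auto
    also have "\<dots> = real (card I) ^ m * h j y ^ m"
      by (simp add: power_mult_distrib)
    also have "h j y ^ m \<le> (\<Sum>i\<in>I. h i y ^ m)"
      using j y h I by (intro member_le_sum[of j I "\<lambda>i. h i y ^ m"]) auto
    finally show ?thesis by (simp add: mult_left_mono)
  qed
qed (use h in \<open>auto intro!: sum_nonneg zero_le_power\<close>)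

definition norm_sums :: "('a \<Rightarrow> complex) set \<Rightarrow> 'a set \<Rightarrow> ('a \<Rightarrow> real) set" where
  "norm_sums S D = {k. \<exists>ps. set ps \<subseteq> S \<and> comparable_on D k (\<lambda>y. \<Sum>p\<leftarrow>ps. cmod (p y))}"

text \<open>The root exponents of numerator and denominator are merged into one power
  \<open>m\<close> on the left, and sums of norms stand for the comparable square roots of sums of
  squared norms.\<close>

definition arp_like :: "('a \<Rightarrow> complex) set \<Rightarrow> 'a set \<Rightarrow> ('a \<Rightarrow> real) set" where
  "arp_like S D = {h. (\<forall>y\<in>D. 0 \<le> h y) \<and> (\<exists>m>0. \<exists>k\<in>norm_sums S D. \<exists>l\<in>norm_sums S D.
     (\<forall>y\<in>D. 0 < l y) \<and> comparable_on D (\<lambda>y. h y ^ m) (\<lambda>y. k y / l y))}"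

lemma arp_likeI:
  assumes "\<And>y. y \<in> D \<Longrightarrow> 0 \<le> h y" "m > 0" "k \<in> norm_sums S D" "l \<in> norm_sums S D"
    "\<And>y. y \<in> D \<Longrightarrow> 0 < l y" "comparable_on D (\<lambda>y. h y ^ m) (\<lambda>y. k y / l y)"
  shows "h \<in> arp_like S D"
  using assms unfolding arp_like_def by blast

lemma arp_likeE:
  assumes "h \<in> arp_like S D"
  obtains m k l where "m > 0" "k \<in> norm_sums S D" "l \<in> norm_sums S D"
    "\<And>y. y \<in> D \<Longrightarrow> 0 < l y" "comparable_on D (\<lambda>y. h y ^ m) (\<lambda>y. k y / l y)"
    "\<And>y. y \<in> D \<Longrightarrow> 0 \<le> h y"
  using assms unfolding arp_like_def by blast

lemma norm_sums_comparable:
  "k \<in> norm_sums S D \<Longrightarrow> comparable_on D k' k \<Longrightarrow> k' \<in> norm_sums S D"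
  unfolding norm_sums_def by (blast intro: comparable_on_trans)

lemma norm_sums_nonneg: "k \<in> norm_sums S D \<Longrightarrow> y \<in> D \<Longrightarrow> 0 \<le> k y"
  unfolding norm_sums_def by (auto elim: comparable_onE)

lemma norm_sums_norm: "p \<in> S \<Longrightarrow> (\<lambda>y. cmod (p y)) \<in> norm_sums S D"
  unfolding norm_sums_def
  by (rule CollectI, rule exI[of _ "[p]"]) (auto intro: comparable_on_refl)

lemma norm_sums_zero: "(\<lambda>y. 0) \<in> norm_sums S D"
  unfolding norm_sums_def
  by (rule CollectI, rule exI[of _ "[]"]) (auto intro: comparable_on_refl)

lemma norm_sums_add:
  assumes "k \<in> norm_sums S D" "l \<in> norm_sums S D"
  shows "(\<lambda>y. k y + l y) \<in> norm_sums S D"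
proof -
  obtain ps qs where "set ps \<subseteq> S" "set qs \<subseteq> S" "comparable_on D k (\<lambda>y. \<Sum>p\<leftarrow>ps. cmod (p y))"
     "comparable_on D l (\<lambda>y. \<Sum>p\<leftarrow>qs. cmod (p y))"
    using assms unfolding norm_sums_def by blast
  thus ?thesis
    unfolding norm_sums_def
    by (intro CollectI exI[of _ "ps @ qs"]) (auto dest: comparable_on_add)
qed

lemma norm_sums_sum_list:
  "(\<And>x. x \<in> set xs \<Longrightarrow> f x \<in> norm_sums S D) \<Longrightarrow> (\<lambda>y. \<Sum>x\<leftarrow>xs. f x y) \<in> norm_sums S D"
  by (induction xs) (auto intro: norm_sums_zero norm_sums_add)

section \<open>Closure properties of sums of norms and of \<open>arp_like\<close> functions\<close>

context function_ring
begin

lemma norm_sums_one: "(\<lambda>y. 1) \<in> norm_sums S D"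
  using norm_sums_norm[OF one_in, of D] by simp

lemma norm_sums_mult:
  assumes "k \<in> norm_sums S D" "l \<in> norm_sums S D"
  shows "(\<lambda>y. k y * l y) \<in> norm_sums S D"
proof -
  obtain ps qs where *: "set ps \<subseteq> S" "set qs \<subseteq> S" "comparable_on D k (\<lambda>y. \<Sum>p\<leftarrow>ps. cmod (p y))"
     "comparable_on D l (\<lambda>y. \<Sum>p\<leftarrow>qs. cmod (p y))"
    using assms unfolding norm_sums_def by blast
  have "(\<Sum>p\<leftarrow>ps. cmod (p y)) * (\<Sum>q\<leftarrow>qs. cmod (q y)) = (\<Sum>p\<leftarrow>ps. \<Sum>q\<leftarrow>qs. cmod (p y * q y))" for y
    by (simp add: norm_mult sum_list_mult_const sum_list_const_mult)
  moreover have "(\<lambda>y. \<Sum>p\<leftarrow>ps. \<Sum>q\<leftarrow>qs. cmod (p y * q y)) \<in> norm_sums S D"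
    using * by (intro norm_sums_sum_list norm_sums_norm mult_in) auto
  ultimately show ?thesis
    using norm_sums_comparable[OF _ comparable_on_mult[OF *(3,4)]] by simp
qed

lemma norm_sums_power: "k \<in> norm_sums S D \<Longrightarrow> (\<lambda>y. k y ^ n) \<in> norm_sums S D"
  by (induction n) (auto intro: norm_sums_mult norm_sums_one)

lemma arp_like_comparable:
  assumes "h \<in> arp_like S D" "comparable_on D g h"
  shows "g \<in> arp_like S D"
  using assms(1)
proof (elim arp_likeE)
  fix m k l
  assume *: "m > 0" "k \<in> norm_sums S D" "l \<in> norm_sums S D"
    "\<And>y. y \<in> D \<Longrightarrow> 0 < l y" "comparable_on D (\<lambda>y. h y ^ m) (\<lambda>y. k y / l y)"
  show ?thesis
    by (rule arp_likeI[OF _ *(1-4)])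
       (use assms(2) in \<open>auto elim: comparable_onE intro: comparable_on_trans[OF comparable_on_power *(5)]\<close>)
qed

lemma arp_like_norm_sums:
  assumes "k \<in> norm_sums S D"
  shows "k \<in> arp_like S D"
  by (rule arp_likeI[of D k 1 k S "\<lambda>_. 1"])
     (use assms in \<open>auto intro: norm_sums_nonneg norm_sums_one comparable_on_refl\<close>)

lemma arp_like_norm: "p \<in> S \<Longrightarrow> (\<lambda>y. cmod (p y)) \<in> arp_like S D"
  by (intro arp_like_norm_sums norm_sums_norm)

lemma arp_like_one: "(\<lambda>y. 1) \<in> arp_like S D"
  by (intro arp_like_norm_sums norm_sums_one)

lemma arp_like_zero: "(\<lambda>y. 0) \<in> arp_like S D"
  by (intro arp_like_norm_sums norm_sums_zero)

lemma arp_like_root: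
  assumes "(\<lambda>y. g y ^ p) \<in> arp_like S D" "p > 0" "\<And>y. y \<in> D \<Longrightarrow> 0 \<le> g y"
  shows "g \<in> arp_like S D"
  using assms(1)
proof (elim arp_likeE)
  fix m k l
  assume *: "m > 0" "k \<in> norm_sums S D" "l \<in> norm_sums S D"
    "\<And>y. y \<in> D \<Longrightarrow> 0 < l y" "comparable_on D (\<lambda>y. (g y ^ p) ^ m) (\<lambda>y. k y / l y)"
  show ?thesis
    by (rule arp_likeI[where m = "p * m", OF assms(3) _ *(2-4)])
       (use * assms(2) in \<open>auto simp: power_mult\<close>)
qed

lemma arp_like_mult:
  assumes "g \<in> arp_like S D" "h \<in> arp_like S D"
  shows "(\<lambda>y. g y * h y) \<in> arp_like S D"
  using assms
proof (elim arp_likeE)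
  fix m k l m' k' l'
  assume *: "m > 0" "k \<in> norm_sums S D" "l \<in> norm_sums S D"
    "\<And>y. y \<in> D \<Longrightarrow> 0 < l y" "comparable_on D (\<lambda>y. g y ^ m) (\<lambda>y. k y / l y)"
    "\<And>y. y \<in> D \<Longrightarrow> 0 \<le> g y"
    and **: "m' > 0" "k' \<in> norm_sums S D" "l' \<in> norm_sums S D"
    "\<And>y. y \<in> D \<Longrightarrow> 0 < l' y" "comparable_on D (\<lambda>y. h y ^ m') (\<lambda>y. k' y / l' y)"
    "\<And>y. y \<in> D \<Longrightarrow> 0 \<le> h y"
  have "comparable_on D (\<lambda>y. (g y ^ m) ^ m' * (h y ^ m') ^ m)
         (\<lambda>y. (k y / l y) ^ m' * (k' y / l' y) ^ m)"
    by (intro comparable_on_mult comparable_on_power * **)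
  also have "(\<lambda>y. (g y ^ m) ^ m' * (h y ^ m') ^ m) = (\<lambda>y. (g y * h y) ^ (m * m'))"
    by (simp add: power_mult_distrib power_mult[symmetric] mult.commute)
  also have "(\<lambda>y. (k y / l y) ^ m' * (k' y / l' y) ^ m) =
      (\<lambda>y. (k y ^ m' * k' y ^ m) / (l y ^ m' * l' y ^ m))"
    by (simp add: power_divide)
  finally show ?thesis
    by (rule arp_likeI[rotated 5])
       (use * ** in \<open>auto intro!: norm_sums_mult norm_sums_power\<close>)
qed

lemma arp_like_power: "h \<in> arp_like S D \<Longrightarrow> (\<lambda>y. h y ^ n) \<in> arp_like S D"
  by (induction n) (auto intro: arp_like_mult arp_like_one)

text \<open>At the common exponent m m' the power of a sum is comparable to the sum of the powers,
  and the two quotients are brought over a common denominator.\<close>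

lemma arp_like_add:
  assumes "g \<in> arp_like S D" "h \<in> arp_like S D"
  shows "(\<lambda>y. g y + h y) \<in> arp_like S D"
  using assms
proof (elim arp_likeE)
  fix m k l m' k' l'
  assume *: "m > 0" "k \<in> norm_sums S D" "l \<in> norm_sums S D"
    "\<And>y. y \<in> D \<Longrightarrow> 0 < l y" "comparable_on D (\<lambda>y. g y ^ m) (\<lambda>y. k y / l y)"
    "\<And>y. y \<in> D \<Longrightarrow> 0 \<le> g y"
    and **: "m' > 0" "k' \<in> norm_sums S D" "l' \<in> norm_sums S D"
    "\<And>y. y \<in> D \<Longrightarrow> 0 < l' y" "comparable_on D (\<lambda>y. h y ^ m') (\<lambda>y. k' y / l' y)"
    "\<And>y. y \<in> D \<Longrightarrow> 0 \<le> h y"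
  \<comment> \<open>The two summands are indexed by booleans so that
    \<open>comparable_on_power_sum\<close> applies.\<close>
  have "comparable_on D (\<lambda>y. (\<Sum>b\<in>UNIV. if b then g y else h y) ^ (m * m'))
        (\<lambda>y. \<Sum>b\<in>UNIV. (if b then g y else h y) ^ (m * m'))"
    by (rule comparable_on_power_sum) (use * ** in auto)
  hence 1: "comparable_on D (\<lambda>y. (g y + h y) ^ (m * m')) (\<lambda>y. g y ^ (m * m') + h y ^ (m * m'))"
    by (simp add: UNIV_bool add.commute)
  have "comparable_on D (\<lambda>y. (g y ^ m) ^ m' + (h y ^ m') ^ m)
         (\<lambda>y. (k y / l y) ^ m' + (k' y / l' y) ^ m)"
    by (intro comparable_on_add comparable_on_power * **)
  also have "(\<lambda>y. (g y ^ m) ^ m' + (h y ^ m') ^ m) = (\<lambda>y. g y ^ (m * m') + h y ^ (m * m'))"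
    by (simp add: power_mult[symmetric] mult.commute)
  finally have 2: "comparable_on D (\<lambda>y. g y ^ (m * m') + h y ^ (m * m'))
      (\<lambda>y. (k y ^ m' * l' y ^ m + k' y ^ m * l y ^ m') / (l y ^ m' * l' y ^ m))"
  proof (rule comparable_on_cong)
    fix y assume y: "y \<in> D"
    show "(k y / l y) ^ m' + (k' y / l' y) ^ m =
          (k y ^ m' * l' y ^ m + k' y ^ m * l y ^ m') / (l y ^ m' * l' y ^ m)"
      using *(4)[OF y] **(4)[OF y] by (simp add: power_divide field_simps)
  qed simp
  show ?thesis
    by (rule arp_likeI[OF _ _ _ _ _ comparable_on_trans[OF 1 2]])
       (use * ** in \<open>auto intro!: norm_sums_mult norm_sums_power norm_sums_add\<close>)
qed

lemma arp_like_sum: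
  "(\<And>i. i \<in> I \<Longrightarrow> h i \<in> arp_like S D) \<Longrightarrow> (\<lambda>y. \<Sum>i\<in>I. h i y) \<in> arp_like S D"
  by (induction I rule: infinite_finite_induct) (auto intro: arp_like_zero arp_like_add)

lemma arp_like_sum_list:
  "(\<And>i. i \<in> set is \<Longrightarrow> h i \<in> arp_like S D) \<Longrightarrow> (\<lambda>y. \<Sum>i\<leftarrow>is. h i y) \<in> arp_like S D"
  by (induction "is") (auto intro: arp_like_zero arp_like_add)

lemma arp_like_inverse:
  assumes "h \<in> arp_like S D" "\<And>y. y \<in> D \<Longrightarrow> 0 < h y"
  shows "(\<lambda>y. 1 / h y) \<in> arp_like S D"
  using assms(1)
proof (elim arp_likeE)
  fix m k l
  assume *: "m > 0" "k \<in> norm_sums S D" "l \<in> norm_sums S D"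
    "\<And>y. y \<in> D \<Longrightarrow> 0 < l y" "comparable_on D (\<lambda>y. h y ^ m) (\<lambda>y. k y / l y)"
  have k: "0 < k y" if "y \<in> D" for y
    using comparable_on_pos[OF *(5) that] assms(2)[OF that] *(4)[OF that]
    by (simp add: zero_less_divide_iff)
  have "comparable_on D (\<lambda>y. 1 / h y ^ m) (\<lambda>y. 1 / (k y / l y))"
    using assms(2) by (intro comparable_on_inverse[OF *(5)]) auto
  hence "comparable_on D (\<lambda>y. (1 / h y) ^ m) (\<lambda>y. l y / k y)"
    by (simp add: power_divide)
  thus ?thesis
    using k *(1-3) assms(2) by (intro arp_likeI[of D _ m l S k]) (auto intro: less_imp_le)
qed

lemma arp_like_divide:
  assumes "g \<in> arp_like S D" "h \<in> arp_like S D" "\<And>y. y \<in> D \<Longrightarrow> 0 < h y"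
  shows "(\<lambda>y. g y / h y) \<in> arp_like S D"
  using arp_like_mult[OF assms(1) arp_like_inverse[OF assms(2,3)]] by simp

text \<open>With a = p/q, the q-th power of \<open>rpow (h y) a\<close> is the p-th power of
  \<open>h y\<close>, so closure under powers and roots suffices. For a = 0 both are 1 by the
  convention of \<open>rpow\<close>.\<close>

lemma arp_like_rpow:
  assumes "h \<in> arp_like S D" "a \<in> \<rat>" "a \<ge> 0"
  shows "(\<lambda>y. rpow (h y) a) \<in> arp_like S D"
proof -
  obtain p q :: nat where pq: "q \<noteq> 0" "\<bar>a\<bar> = real p / real q"
    using assms(2) by (elim Rats_abs_nat_div_natE) blast
  have nonneg: "0 \<le> h y" if "y \<in> D" for y
    using assms(1) that by (auto elim: arp_likeE)
  have eq: "rpow (h y) a ^ q = h y ^ p" if "y \<in> D" for y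
  proof (cases "a = 0")
    case True
    thus ?thesis using pq by (simp add: rpow_def)
  next
    case False
    hence "p > 0" using pq by (cases p) auto
    have "a * real q = real p"
      using pq assms(3) by simp
    moreover have "(h y powr a) ^ q = h y powr (a * real q)"
      using pq by (cases "h y = 0") (simp_all add: powr_realpow flip: powr_powr)
    moreover have "h y powr real p = h y ^ p"
      using nonneg[OF that] \<open>p > 0\<close> by (cases "h y = 0") (auto simp: powr_realpow)
    ultimately show ?thesis using False by (simp add: rpow_def)
  qed
  have "(\<lambda>y. rpow (h y) a ^ q) \<in> arp_like S D"
    by (rule arp_like_comparable[OF arp_like_power[OF assms(1), of p]],
        rule comparable_on_cong[OF comparable_on_refl[of D "\<lambda>y. h y ^ p"]])
       (use eq nonneg in auto)
  thus ?thesis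
    by (rule arp_like_root) (use pq in \<open>auto simp: rpow_def\<close>)
qed

end

section \<open>Elimination of a root\<close>

fun multiplier_combinations :: "nat \<Rightarrow> ('a \<Rightarrow> complex) list \<Rightarrow> ('a \<Rightarrow> complex) list" where
  "multiplier_combinations n [] = [\<lambda>_. 0]"
| "multiplier_combinations n (q # qs) =
     concat (map (\<lambda>g. map (\<lambda>t y. g y + of_nat t * q y) [0..<Suc n]) (multiplier_combinations n qs))"

lemma (in function_ring) multiplier_combinations_in:
  "set qs \<subseteq> S \<Longrightarrow> set (multiplier_combinations n qs) \<subseteq> S"
  by (induction qs) (auto intro!: zero_in add_in mult_in of_nat_in)

lemma multiplier_combinations_le:
  "g \<in> set (multiplier_combinations n qs) \<Longrightarrow> cmod (g y) \<le> real n * (\<Sum>q\<leftarrow>qs. cmod (q y))"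
proof (induction qs arbitrary: g)
  case (Cons q qs)
  obtain g' t where g': "g' \<in> set (multiplier_combinations n qs)" "t \<le> n"
    "g = (\<lambda>y. g' y + of_nat t * q y)"
    using Cons.prems by (auto simp: less_Suc_eq_le simp del: upt_Suc)
  have "cmod (g y) \<le> cmod (g' y) + real t * cmod (q y)"
    unfolding g'(3) by (rule order_trans[OF norm_triangle_ineq]) (simp add: norm_mult)
  also have "\<dots> \<le> real n * (\<Sum>q\<leftarrow>qs. cmod (q y)) + real n * cmod (q y)"
    using Cons.IH[OF g'(1)] g'(2) by (intro add_mono mult_right_mono) auto
  finally show ?case by (simp add: algebra_simps)
qed simp

text \<open>Each further \<open>q\<close> takes one application of
  \<open>ex_uniform_multiplier\<close> to the n points, at the cost of a factor 2n + 3. The good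
  combination depends on the points, which is why the whole list of candidates is kept.\<close>

lemma ex_multiplier_combination_ge:
  fixes x :: "nat \<Rightarrow> 'a"
  shows "\<exists>g\<in>set (multiplier_combinations n qs). \<forall>i<n.
           (\<Sum>q\<leftarrow>qs. cmod (q (x i))) / (2 * real n + 3) ^ length qs \<le> cmod (g (x i))"
proof (induction qs)
  case (Cons q qs)
  define B where "B = 2 * real n + 3"
  have B: "B \<ge> 1" by (simp add: B_def)
  obtain g where g: "g \<in> set (multiplier_combinations n qs)"
    "\<And>i. i < n \<Longrightarrow> (\<Sum>q\<leftarrow>qs. cmod (q (x i))) / B ^ length qs \<le> cmod (g (x i))"
    using Cons.IH unfolding B_def by blast
  obtain t where t: "t \<le> n"
    "\<And>i. i < n \<Longrightarrow> (cmod (g (x i)) + cmod (q (x i))) / B \<le> cmod (g (x i) + of_nat t * q (x i))"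
    using ex_uniform_multiplier[of "{..<n}" "\<lambda>i. g (x i)" "\<lambda>i. q (x i)"] by (auto simp: B_def)
  have "(\<Sum>q\<leftarrow>q # qs. cmod (q (x i))) / B ^ length (q # qs) \<le> cmod (g (x i) + of_nat t * q (x i))"
    if i: "i < n" for i
  proof -
    have "(\<Sum>q\<leftarrow>q # qs. cmod (q (x i))) / B ^ length (q # qs) =
        ((\<Sum>q\<leftarrow>qs. cmod (q (x i))) / B ^ length qs + cmod (q (x i)) / B ^ length qs) / B"
      using B by (simp add: field_simps)
    also have "\<dots> \<le> (cmod (g (x i)) + cmod (q (x i))) / B"
    proof (intro divide_right_mono add_mono g i)
      have "cmod (q (x i)) / B ^ length qs \<le> cmod (q (x i)) / 1"
        using B by (intro divide_left_mono) auto
      thus "cmod (q (x i)) / B ^ length qs \<le> cmod (q (x i))" by simp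
    qed (use B in auto)
    also note t(2)[OF i]
    finally show ?thesis .
  qed
  moreover have "(\<lambda>y. g y + of_nat t * q y) \<in> set (multiplier_combinations n (q # qs))"
    using g(1) t(1) by (auto simp: less_Suc_eq_le simp del: upt_Suc intro!: bexI[of _ g] image_eqI[of _ _ t])
  ultimately show ?case
    unfolding B_def by (intro bexI[of _ "\<lambda>y. g y + of_nat t * q y"]) auto
qed simp

section \<open>The largest ratio and the coefficients of a product of linear factors\<close>

lemma coeff_prod_linear_0:
  fixes u v :: "'i \<Rightarrow> complex"
  shows "coeff (\<Prod>i\<in>I. [:u i, v i:]) 0 = (\<Prod>i\<in>I. u i)"
  by (simp add: poly_prod flip: poly_0_coeff_0)

text \<open>The weighted coefficient sum is evaluated at r = 1/m, where each factor is at most (b +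
  1) l_i. For m = 0 all \<open>v i\<close> vanish and the product is constant.\<close>

lemma coeff_prod_linear_le:
  fixes u v :: "nat \<Rightarrow> complex"
  assumes b: "b \<ge> 0" and l: "\<And>i. i < n \<Longrightarrow> 0 \<le> l i"
    and u: "\<And>i. i < n \<Longrightarrow> cmod (u i) \<le> b * l i"
    and v: "\<And>i. i < n \<Longrightarrow> cmod (v i) \<le> m * l i" and m: "m \<ge> 0" and k: "k \<le> n"
  shows "cmod (coeff (\<Prod>i<n. [:u i, v i:]) k) \<le> (b + 1) ^ n * m ^ k * (\<Prod>i<n. l i)"
proof (cases "m = 0")
  case True
  hence "v i = 0" if "i < n" for i using v[OF that] by simp
  hence "(\<Prod>i<n. [:u i, v i:]) = (\<Prod>i<n. [:u i:])" by simp
  also have "\<dots> = [:\<Prod>i<n. u i:]" by (induction n) simp_all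
  finally have *: "(\<Prod>i<n. [:u i, v i:]) = [:\<Prod>i<n. u i:]" .
  show ?thesis
  proof (cases k)
    case 0
    have "cmod (\<Prod>i<n. u i) \<le> (\<Prod>i<n. (b + 1) * l i)"
      unfolding prod_norm[symmetric]
    proof (intro prod_mono conjI)
      fix i assume i: "i \<in> {..<n}"
      thus "cmod (u i) \<le> (b + 1) * l i"
        using u[of i] l[of i] by (simp add: distrib_right)
    qed simp
    thus ?thesis unfolding * using 0 by (simp add: prod.distrib)
  next
    case (Suc j)
    thus ?thesis unfolding * using True by simp
  qed
next
  case False
  hence m': "m > 0" using m by simp
  have "cmod (coeff (\<Prod>i<n. [:u i, v i:]) k) * (1 / m) ^ k
      \<le> (\<Sum>k\<le>n. cmod (coeff (\<Prod>i<n. [:u i, v i:]) k) * (1 / m) ^ k)"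
    using k m by (intro member_le_sum) auto
  also have "\<dots> \<le> (\<Prod>i<n. cmod (u i) + cmod (v i) * (1 / m))"
    using coeff_sum_prod_linear_le[of "{..<n}" "1 / m" u v] m by simp
  also have "\<dots> \<le> (\<Prod>i<n. (b + 1) * l i)"
  proof (intro prod_mono conjI)
    fix i assume i: "i \<in> {..<n}"
    have "cmod (v i) * (1 / m) \<le> l i"
      using v[of i] m' i by (simp add: field_simps)
    thus "cmod (u i) + cmod (v i) * (1 / m) \<le> (b + 1) * l i"
      using u[of i] i by (simp add: distrib_right)
  qed (use m in auto)
  also have "\<dots> = (b + 1) ^ n * (\<Prod>i<n. l i)"
    by (simp add: prod.distrib)
  finally show ?thesis
    using m' by (simp add: field_simps power_one_over)
qed

text \<open>The reciprocal of the largest ratio is the modulus of a root of the product.\<close>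
lemma ex_coeff_prod_linear_ge:
  fixes u v :: "nat \<Rightarrow> complex"
  assumes u: "\<And>i. i < n \<Longrightarrow> u i \<noteq> 0" and j: "j < n" "v j \<noteq> 0"
  shows "\<exists>k\<in>{1..n}. (cmod (v j) / cmod (u j)) ^ k * (\<Prod>i<n. cmod (u i))
           \<le> real n * cmod (coeff (\<Prod>i<n. [:u i, v i:]) k)"
proof (rule ccontr)
  assume contra: "\<not> ?thesis"
  define p where "p = (\<Prod>i<n. [:u i, v i:])"
  define mu where "mu = cmod (v j) / cmod (u j)"
  have mu: "mu > 0" using assms by (simp add: mu_def)
  define z where "z = - u j / v j"
  have z: "cmod z = 1 / mu" by (simp add: z_def mu_def norm_divide)
  have "poly p z = 0"
    unfolding p_def poly_prod using j by (intro prod_zero) (auto simp: z_def intro!: bexI[of _ j])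
  moreover have "degree p \<le> n"
    using degree_prod_linear_le[of "{..<n}" u v] by (simp add: p_def)
  hence "poly p z = (\<Sum>k\<le>n. coeff p k * z ^ k)"
    unfolding poly_altdef by (intro sum.mono_neutral_left) (auto simp: not_le coeff_eq_0)
  moreover have "{..n} = insert 0 {1..n}" by auto
  \<comment> \<open>At the root z the n higher terms cancel the constant one, so they cannot all be
    smaller than its n-th part; |z| = 1/mu turns this into the power of \<open>mu\<close>.\<close>
  ultimately have "coeff p 0 = - (\<Sum>k=1..n. coeff p k * z ^ k)"
    by (simp add: add_eq_0_iff2)
  hence "cmod (coeff p 0) \<le> (\<Sum>k=1..n. cmod (coeff p k * z ^ k))"
    by (simp add: norm_sum)
  also have "\<dots> < (\<Sum>k=1..n. (\<Prod>i<n. cmod (u i)) / real n)"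
  proof (rule sum_strict_mono)
    fix k assume k: "k \<in> {1..n}"
    hence "real n * cmod (coeff p k) < mu ^ k * (\<Prod>i<n. cmod (u i))"
      using contra by (force simp: p_def mu_def not_le)
    moreover have "0 < real n" using j by simp
    ultimately show "cmod (coeff p k * z ^ k) < (\<Prod>i<n. cmod (u i)) / real n"
      using mu by (simp add: norm_mult norm_power z field_simps)
  qed (use j in auto)
  also have "\<dots> = (\<Prod>i<n. cmod (u i))"
    using j by simp
  also have "\<dots> = cmod (coeff p 0)"
    by (simp add: p_def coeff_prod_linear_0 prod_norm)
  finally show False by simp
qed

context split_polynomial
begin

text \<open>For a combination g comparable to the denominators at all roots, the k-th coefficient of
  the product of the g_i + P_i X is at most of order m^k W, and at least of that order for some k >=
  1. Such a g varies with y, so \<open>K k\<close> sums over all combinations: upper bounds hold for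
  each of them, lower bounds come from the one that is good at y. Then a power of m is comparable to
  a sum of powers of the K_k / K_0.\<close>

lemma arp_like_sum_ratio:
  assumes P: "P \<in> poly_ext Om S" and Qs: "set Qs \<subseteq> poly_ext Om S"
    and pos: "\<And>y i. y \<in> D \<Longrightarrow> i < n \<Longrightarrow> 0 < (\<Sum>q\<leftarrow>Qs. cmod (q (y, xi y i)))"
  shows "(\<lambda>y. \<Sum>i<n. cmod (P (y, xi y i)) / (\<Sum>q\<leftarrow>Qs. cmod (q (y, xi y i)))) \<in> arp_like S D"
    (is "?m \<in> _")
proof -
  interpret P: function_ring "poly_ext Om S" "Om \<times> UNIV" "\<lambda>z. al (fst z)"
    by (rule function_ring_poly_ext)
  define X where "X = multiplier_combinations n Qs"
  define e where "e = (\<lambda>g k y. coeff (\<Prod>i<n. [:g (y, xi y i), P (y, xi y i):]) k)"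
  define K where "K = (\<lambda>k y. \<Sum>g\<leftarrow>X. cmod (e g k y))"
  define L where "L = (\<lambda>y i. \<Sum>q\<leftarrow>Qs. cmod (q (y, xi y i)))"
  define W where "W = (\<lambda>y. \<Prod>i<n. L y i)"
  define m where "m = ?m"
  define B where "B = (2 * real n + 3) ^ length Qs"
  have B1: "B \<ge> 1" unfolding B_def by (rule one_le_power) simp
  hence B: "B > 0" by simp
  have m_nonneg: "0 \<le> m y" if "y \<in> D" for y
    using pos[OF that] by (auto simp: m_def intro!: sum_nonneg divide_nonneg_pos)
  have L: "0 < L y i" if "y \<in> D" "i < n" for y i
    using pos that by (simp add: L_def)
  have W: "0 < W y" if "y \<in> D" for y
    using L that by (auto simp: W_def intro!: prod_pos)
  have e_in: "e g k \<in> S" if "g \<in> set X" for g k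
    unfolding e_def using P.multiplier_combinations_in[OF Qs, of n] that P
    by (intro coeff_prod_roots_in) (auto simp: X_def)
  hence K_in: "K k \<in> norm_sums S D" for k
    unfolding K_def by (intro norm_sums_sum_list norm_sums_norm)
  \<comment> \<open>This covers every combination, good or not, since |g| is at most n times the
    denominator.\<close>
  have e_le: "cmod (e g k y) \<le> (real n + 1) ^ n * m y ^ k * W y"
    if "g \<in> set X" "k \<le> n" "y \<in> D" for g k y
    unfolding e_def W_def
  proof (rule coeff_prod_linear_le)
    fix i assume i: "i < n"
    show "cmod (g (y, xi y i)) \<le> real n * L y i"
      unfolding L_def using that by (intro multiplier_combinations_le) (simp add: X_def)
    have "cmod (P (y, xi y i)) / L y i \<le> m y"
      unfolding m_def L_def using pos[OF that(3)] i
      by (intro member_le_sum) (auto intro!: divide_nonneg_pos)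
    thus "cmod (P (y, xi y i)) \<le> m y * L y i"
      using L[OF that(3) i] by (simp add: field_simps)
    show "0 \<le> L y i" using L[OF that(3) i] by simp
  qed (use that m_nonneg in auto)
  define C1 where "C1 = real (length X) * (real n + 1) ^ n"
  have C1_nonneg: "C1 \<ge> 0" by (simp add: C1_def)
  have K_le: "K k y \<le> C1 * (m y ^ k * W y)" if "k \<le> n" "y \<in> D" for k y
  proof -
    have "K k y \<le> (\<Sum>g\<leftarrow>X. (real n + 1) ^ n * m y ^ k * W y)"
      unfolding K_def using e_le that by (intro sum_list_mono) auto
    thus ?thesis by (simp add: sum_list_triv C1_def mult_ac)
  qed
  define good where "good = (\<lambda>g y. g \<in> set X \<and> (\<forall>i<n. L y i / B \<le> cmod (g (y, xi y i))))"
  have ex_good: "\<exists>g. good g y" for y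
    using ex_multiplier_combination_ge[of n Qs "\<lambda>i. (y, xi y i)"]
    unfolding good_def X_def L_def B_def by blast
  have e_le_K: "cmod (e g k y) \<le> K k y" if "g \<in> set X" for g k y
    unfolding K_def using that by (intro member_le_sum_list) auto
  have W_le: "W y \<le> B ^ n * (\<Prod>i<n. cmod (g (y, xi y i)))" if "good g y" "y \<in> D" for g y
  proof -
    have "W y \<le> (\<Prod>i<n. B * cmod (g (y, xi y i)))"
      unfolding W_def
    proof (intro prod_mono conjI)
      fix i assume "i \<in> {..<n}"
      thus "0 \<le> L y i" "L y i \<le> B * cmod (g (y, xi y i))"
        using L[of y i] that B by (auto simp: good_def field_simps)
    qed
    thus ?thesis by (simp add: prod.distrib)
  qed
  have W_le_K0: "W y \<le> B ^ n * K 0 y" if y: "y \<in> D" for y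
  proof -
    obtain g where g: "good g y" using ex_good by blast
    have "(\<Prod>i<n. cmod (g (y, xi y i))) = cmod (e g 0 y)"
      by (simp add: e_def coeff_prod_linear_0 prod_norm)
    also have "\<dots> \<le> K 0 y" using g by (intro e_le_K) (simp add: good_def)
    finally show ?thesis
      using W_le[OF g y] B by (meson mult_left_mono order_trans zero_le_power less_imp_le)
  qed
  have K0_pos: "K 0 y > 0" if y: "y \<in> D" for y
  proof -
    have "0 < B ^ n * K 0 y" using W[OF y] W_le_K0[OF y] by linarith
    thus ?thesis using B by (simp add: zero_less_mult_iff)
  qed
  \<comment> \<open>Origin of the factors: (n + 1)^(2n) from m <= (n + 1)^2 mu with k <= n, one more
    n + 1 from the factor n in \<open>ex_coeff_prod_linear_ge\<close>, and B^n from
    \<open>W_le\<close>.\<close>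
  define C2 where "C2 = (real n + 1) ^ (2 * n + 1) * B ^ n"
  have C2_nonneg: "C2 \<ge> 0" using B by (simp add: C2_def)
  have K_ge: "\<exists>k\<in>{1..n}. m y ^ k * W y \<le> C2 * K k y" if y: "y \<in> D" and m: "m y > 0" for y
  proof -
    obtain g where g: "good g y" using ex_good by blast
    define u where "u = (\<lambda>i. g (y, xi y i))"
    define v where "v = (\<lambda>i. P (y, xi y i))"
    have u: "u i \<noteq> 0" if "i < n" for i
    proof -
      have "0 < L y i / B" using L[OF y that] B by simp
      also have "\<dots> \<le> cmod (u i)" using g that by (simp add: good_def u_def)
      finally show ?thesis by simp
    qed
    have "n > 0" using m unfolding m_def by (cases n) auto
    then obtain j where j: "j < n" "\<And>i. i < n \<Longrightarrow> cmod (v i) / cmod (u i) \<le> cmod (v j) / cmod (u j)"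
      using ex_maximizer[of "{..<n}" "\<lambda>i. cmod (v i) / cmod (u i)"] by auto
    define mu where "mu = cmod (v j) / cmod (u j)"
    have m_le: "m y \<le> (real n + 1) ^ 2 * mu"
    proof -
      have "m y = (\<Sum>i<n. cmod (v i) / L y i)"
        by (simp add: m_def v_def L_def)
      also have "\<dots> \<le> (\<Sum>i<n. (real n + 1) * mu)"
      proof (rule sum_mono)
        fix i assume i: "i \<in> {..<n}"
        have "cmod (u i) \<le> real n * L y i"
          unfolding L_def u_def using g
          by (intro multiplier_combinations_le) (simp add: good_def X_def)
        also have "\<dots> \<le> (real n + 1) * L y i"
          using L[OF y, of i] i by (intro mult_right_mono) auto
        finally have u_le: "cmod (u i) \<le> (real n + 1) * L y i" .
        have "cmod (v i) / L y i = ((real n + 1) * cmod (v i)) / ((real n + 1) * L y i)"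
          by simp
        also have "\<dots> \<le> ((real n + 1) * cmod (v i)) / cmod (u i)"
          using L[OF y, of i] u[of i] i by (intro divide_left_mono[OF u_le]) (auto intro!: mult_pos_pos)
        finally have "cmod (v i) / L y i \<le> (real n + 1) * (cmod (v i) / cmod (u i))"
          by simp
        also have "\<dots> \<le> (real n + 1) * mu"
          using j(2)[of i] i by (intro mult_left_mono) (auto simp: mu_def)
        finally show "cmod (v i) / L y i \<le> (real n + 1) * mu" .
      qed
      also have "\<dots> = real n * ((real n + 1) * mu)" by simp
      also have "\<dots> \<le> (real n + 1) * ((real n + 1) * mu)"
        by (intro mult_right_mono) (auto simp: mu_def)
      finally show ?thesis by (simp add: power2_eq_square mult_ac)
    qed
    have "v j \<noteq> 0"
    proof
      assume "v j = 0"
      hence "mu = 0" by (simp add: mu_def)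
      thus False using m_le m by simp
    qed
    then obtain k where k: "k \<in> {1..n}"
      "mu ^ k * (\<Prod>i<n. cmod (u i)) \<le> real n * cmod (coeff (\<Prod>i<n. [:u i, v i:]) k)"
      using ex_coeff_prod_linear_ge[of n u j v] u j(1) unfolding mu_def by blast
    have "m y ^ k * W y \<le> ((real n + 1) ^ 2 * mu) ^ k * (B ^ n * (\<Prod>i<n. cmod (u i)))"
      using m_le m W_le[OF g y] W[OF y] unfolding u_def
      by (intro mult_mono power_mono) (auto simp: mu_def)
    also have "\<dots> = (real n + 1) ^ (2 * k) * B ^ n * (mu ^ k * (\<Prod>i<n. cmod (u i)))"
      by (simp add: power_mult_distrib mult_ac flip: power_mult)
    also have "\<dots> \<le> (real n + 1) ^ (2 * k) * B ^ n * (real n * cmod (e g k y))"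
      using k(2) B by (intro mult_left_mono) (auto simp: e_def u_def v_def)
    also have "\<dots> \<le> (real n + 1) ^ (2 * n) * B ^ n * ((real n + 1) * K k y)"
      using k(1) B1 g by (intro mult_mono power_increasing e_le_K) (auto simp: good_def)
    finally have "m y ^ k * W y \<le> C2 * K k y" by (simp add: C2_def mult_ac)
    thus ?thesis using k(1) by blast
  qed
  \<comment> \<open>Every k from 1 to n divides n!, so the comparisons with m^k can all be raised to
    the common power m^R.\<close>
  define R :: nat where "R = fact n"
  have R: "k * (R div k) = R" "R div k > 0" if "k \<in> {1..n}" for k
  proof -
    have "k dvd R" using that by (auto simp: R_def intro: dvd_fact)
    thus "k * (R div k) = R" by simp
    thus "R div k > 0" by (cases "R div k = 0") (auto simp: R_def)
  qed
  define Y where "Y = (\<lambda>y. \<Sum>k=1..n. (K k y / K 0 y) ^ (R div k))"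
  have Y_in: "Y \<in> arp_like S D"
    unfolding Y_def using K0_pos
    by (intro arp_like_sum arp_like_power arp_like_divide arp_like_norm_sums K_in)
  have "comparable_on D (\<lambda>y. m y ^ R) Y"
  proof (rule comparable_onI2[of "\<Sum>k=1..n. (C2 * C1) ^ (R div k)" "\<Sum>k=1..n. (C1 * B ^ n) ^ (R div k)"])
    have KK: "0 \<le> K k y / K 0 y" if "y \<in> D" for k y
      using norm_sums_nonneg[OF K_in that] by (intro divide_nonneg_nonneg) auto
    show "0 \<le> Y y" if "y \<in> D" for y
      unfolding Y_def using KK[OF that] by (intro sum_nonneg) auto
    show "0 \<le> (\<Sum>k=1..n. (C2 * C1) ^ (R div k))" "0 \<le> (\<Sum>k=1..n. (C1 * B ^ n) ^ (R div k))"
      using C1_nonneg C2_nonneg B by (auto intro!: sum_nonneg zero_le_power mult_nonneg_nonneg)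
    fix y assume y: "y \<in> D"
    show "0 \<le> m y ^ R" using m_nonneg[OF y] by simp
    show "Y y \<le> (\<Sum>k=1..n. (C1 * B ^ n) ^ (R div k)) * m y ^ R"
      unfolding Y_def sum_distrib_right
    proof (rule sum_mono)
      fix k assume k: "k \<in> {1..n}"
      have "K k y \<le> C1 * (m y ^ k * W y)" using K_le k y by auto
      also have "\<dots> \<le> C1 * (m y ^ k * (B ^ n * K 0 y))"
        using W_le_K0[OF y] m_nonneg[OF y] C1_nonneg by (intro mult_left_mono) auto
      finally have "K k y / K 0 y \<le> C1 * B ^ n * m y ^ k"
        using K0_pos[OF y] by (simp add: field_simps)
      hence "(K k y / K 0 y) ^ (R div k) \<le> (C1 * B ^ n * m y ^ k) ^ (R div k)"
        using KK[OF y] by (intro power_mono) auto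
      also have "\<dots> = (C1 * B ^ n) ^ (R div k) * m y ^ R"
        using R(1)[OF k] by (simp add: power_mult_distrib flip: power_mult)
      finally show "(K k y / K 0 y) ^ (R div k) \<le> (C1 * B ^ n) ^ (R div k) * m y ^ R" .
    qed
    show "m y ^ R \<le> (\<Sum>k=1..n. (C2 * C1) ^ (R div k)) * Y y"
    proof (cases "m y = 0")
      case True
      thus ?thesis
        using \<open>0 \<le> (\<Sum>k=1..n. (C2 * C1) ^ (R div k))\<close> \<open>\<And>y. y \<in> D \<Longrightarrow> 0 \<le> Y y\<close>[OF y]
        by (simp add: R_def power_0_left)
    next
      case False
      then obtain k where k: "k \<in> {1..n}" "m y ^ k * W y \<le> C2 * K k y"
        using K_ge[OF y] m_nonneg[OF y] by force
      have "m y ^ k * K 0 y \<le> m y ^ k * (C1 * W y)"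
        using K_le[of 0 y] y m_nonneg[OF y] by (intro mult_left_mono) auto
      also have "\<dots> \<le> C1 * (C2 * K k y)"
        using mult_left_mono[OF k(2) C1_nonneg] by (simp add: mult_ac)
      finally have "m y ^ k \<le> (C2 * C1) * (K k y / K 0 y)"
        using K0_pos[OF y] by (simp add: field_simps)
      hence "(m y ^ k) ^ (R div k) \<le> ((C2 * C1) * (K k y / K 0 y)) ^ (R div k)"
        using m_nonneg[OF y] by (intro power_mono) auto
      hence "m y ^ R \<le> (C2 * C1) ^ (R div k) * (K k y / K 0 y) ^ (R div k)"
        using R(1)[OF k(1)] by (simp only: power_mult_distrib flip: power_mult)
      also have "\<dots> \<le> (\<Sum>k=1..n. (C2 * C1) ^ (R div k)) * Y y"
        unfolding Y_def using k(1) KK[OF y] C1_nonneg C2_nonneg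
        by (intro mult_mono member_le_sum[of k "{1..n}" "\<lambda>k. (C2 * C1) ^ (R div k)"]
              member_le_sum[of k "{1..n}" "\<lambda>k. (K k y / K 0 y) ^ (R div k)"] sum_nonneg zero_le_power) auto
      finally show ?thesis .
    qed
  qed
  hence "(\<lambda>y. m y ^ R) \<in> arp_like S D"
    by (rule arp_like_comparable[OF Y_in])
  hence "m \<in> arp_like S D"
    by (rule arp_like_root) (auto simp: R_def m_nonneg)
  thus ?thesis by (simp add: m_def)
qed

text \<open>Some power of h is comparable to a quotient of sums of norms. The sum over roots is
  exchanged with the sum over numerator terms, so \<open>arp_like_sum_ratio\<close> treats each
  term; the power is then moved outside the sum over roots.\<close>

theorem arp_like_sum_roots:
  assumes h: "h \<in> arp_like (poly_ext Om S) D'"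
    and D: "\<And>y i. y \<in> D \<Longrightarrow> i < n \<Longrightarrow> (y, xi y i) \<in> D'"
  shows "(\<lambda>y. \<Sum>i<n. h (y, xi y i)) \<in> arp_like S D"
  using h
proof (elim arp_likeE)
  fix m k l
  assume *: "m > 0" "k \<in> norm_sums (poly_ext Om S) D'" "l \<in> norm_sums (poly_ext Om S) D'"
    "\<And>z. z \<in> D' \<Longrightarrow> 0 < l z" "comparable_on D' (\<lambda>z. h z ^ m) (\<lambda>z. k z / l z)"
    "\<And>z. z \<in> D' \<Longrightarrow> 0 \<le> h z"
  obtain Ps Qs where Ps: "set Ps \<subseteq> poly_ext Om S" "comparable_on D' k (\<lambda>z. \<Sum>p\<leftarrow>Ps. cmod (p z))"
    and Qs: "set Qs \<subseteq> poly_ext Om S" "comparable_on D' l (\<lambda>z. \<Sum>q\<leftarrow>Qs. cmod (q z))"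
    using *(2,3) unfolding norm_sums_def by blast
  define f where "f = (\<lambda>z. (\<Sum>p\<leftarrow>Ps. cmod (p z)) / (\<Sum>q\<leftarrow>Qs. cmod (q z)))"
  have "comparable_on D' (\<lambda>z. h z ^ m) f"
    unfolding f_def
    using comparable_on_trans[OF *(5) comparable_on_divide[OF Ps(2) Qs(2) *(4)]] by simp
  then obtain C where C: "C > 0" "\<And>z. z \<in> D' \<Longrightarrow> 0 \<le> f z"
    "\<And>z. z \<in> D' \<Longrightarrow> h z ^ m \<le> C * f z" "\<And>z. z \<in> D' \<Longrightarrow> f z \<le> C * h z ^ m"
    by (elim comparable_onE) blast
  have 1: "comparable_on D (\<lambda>y. \<Sum>i<n. h (y, xi y i) ^ m) (\<lambda>y. \<Sum>i<n. f (y, xi y i))"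
    by (rule comparable_onI2[of C C])
       (use C D *(6) in \<open>auto simp: sum_distrib_left intro!: sum_nonneg sum_mono\<close>)
  have 2: "comparable_on D (\<lambda>y. (\<Sum>i<n. h (y, xi y i)) ^ m) (\<lambda>y. \<Sum>i<n. h (y, xi y i) ^ m)"
    by (rule comparable_on_power_sum) (use * D in auto)
  have pos: "0 < (\<Sum>q\<leftarrow>Qs. cmod (q (y, xi y i)))" if "y \<in> D" "i < n" for y i
    using comparable_on_pos[OF Qs(2) D[OF that]] *(4) D[OF that] by blast
  have "(\<lambda>y. \<Sum>p\<leftarrow>Ps. \<Sum>i<n. cmod (p (y, xi y i)) / (\<Sum>q\<leftarrow>Qs. cmod (q (y, xi y i)))) \<in> arp_like S D"
    using Ps(1) Qs(1) pos by (intro arp_like_sum_list arp_like_sum_ratio) auto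
  also have "(\<lambda>y. \<Sum>p\<leftarrow>Ps. \<Sum>i<n. cmod (p (y, xi y i)) / (\<Sum>q\<leftarrow>Qs. cmod (q (y, xi y i)))) =
      (\<lambda>y. \<Sum>i<n. f (y, xi y i))"
  proof
    fix y
    show "(\<Sum>p\<leftarrow>Ps. \<Sum>i<n. cmod (p (y, xi y i)) / (\<Sum>q\<leftarrow>Qs. cmod (q (y, xi y i)))) =
        (\<Sum>i<n. f (y, xi y i))"
      unfolding f_def by (induction Ps) (simp_all add: add_divide_distrib sum.distrib)
  qed
  finally have "(\<lambda>y. (\<Sum>i<n. h (y, xi y i)) ^ m) \<in> arp_like S D"
    by (rule arp_like_comparable[OF _ comparable_on_trans[OF 2 1]])
  thus ?thesis
    by (rule arp_like_root) (use * D in \<open>auto intro!: sum_nonneg\<close>)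
qed

end

section \<open>Radial weights around a root\<close>

lemma rpow_nonneg [simp]: "0 \<le> rpow t a"
  by (simp add: rpow_def)

lemma rpow_eq_powr: "t > 0 \<Longrightarrow> rpow t a = t powr a"
  by (simp add: rpow_def)

lemma rpow_pos: "t > 0 \<Longrightarrow> 0 < rpow t a"
  by (simp add: rpow_def)

lemma rpow_mono: "0 \<le> s \<Longrightarrow> s \<le> t \<Longrightarrow> 0 \<le> a \<Longrightarrow> rpow s a \<le> rpow t a"
  by (simp add: rpow_def powr_mono2)

lemma rpow_mult: "0 \<le> s \<Longrightarrow> 0 \<le> t \<Longrightarrow> rpow (s * t) a = rpow s a * rpow t a"
  by (simp add: rpow_def powr_mult)

lemma rpow_sum_le:
  assumes "\<And>i. i \<in> I \<Longrightarrow> 0 \<le> c i" "finite I" "I \<noteq> {}" "0 \<le> a"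
  shows "rpow (\<Sum>i\<in>I. c i) a \<le> rpow (real (card I)) a * (\<Sum>i\<in>I. rpow (c i) a)"
proof -
  obtain j where j: "j \<in> I" "\<And>i. i \<in> I \<Longrightarrow> c i \<le> c j"
    using ex_maximizer[of I c] assms by blast
  have "rpow (\<Sum>i\<in>I. c i) a \<le> rpow (real (card I) * c j) a"
    using assms j by (intro rpow_mono sum_bounded_above sum_nonneg) auto
  also have "\<dots> = rpow (real (card I)) a * rpow (c j) a"
    using assms j by (intro rpow_mult) auto
  also have "rpow (c j) a \<le> (\<Sum>i\<in>I. rpow (c i) a)"
    using assms j by (intro member_le_sum) auto
  finally show ?thesis by (simp add: mult_left_mono)
qed

definition taylor_coeff :: "complex poly \<Rightarrow> complex \<Rightarrow> nat \<Rightarrow> complex" where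
  "taylor_coeff p x k = coeff (pcompose p [:x, 1:]) k"

text \<open>\<open>root_gauge Z x\<close> is the function \<open>\<Phi>\<^sub>x\<close> of the
  overview, and \<open>scale_weight\<close> with \<alpha> = k\<epsilon> + 2 is its
  \<open>g\<close>.\<close>

definition root_gauge :: "complex set \<Rightarrow> complex \<Rightarrow> real \<Rightarrow> real" where
  "root_gauge Z x r = (\<Prod>z\<in>Z. max r (cmod (x - z)))"

definition scale_weight :: "real \<Rightarrow> real \<Rightarrow> complex set \<Rightarrow> complex \<Rightarrow> real \<Rightarrow> real" where
  "scale_weight \<alpha> \<delta> Z x r = r powr \<alpha> / root_gauge Z x r powr \<delta>"

lemma root_gauge_pos: "r > 0 \<Longrightarrow> 0 < root_gauge Z x r"
  unfolding root_gauge_def by (intro prod_pos) auto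

lemma scale_weight_nonneg: "0 \<le> scale_weight \<alpha> \<delta> Z x r"
  by (simp add: scale_weight_def)

lemma norm_prod_le_root_gauge:
  assumes "cmod (z - x) \<le> r"
  shows "cmod (\<Prod>w\<in>Z. z - w) \<le> 2 ^ card Z * root_gauge Z x r"
proof -
  have "cmod (\<Prod>w\<in>Z. z - w) \<le> (\<Prod>w\<in>Z. 2 * max r (cmod (x - w)))"
    unfolding prod_norm[symmetric]
  proof (intro prod_mono conjI)
    fix w
    have "cmod (z - w) \<le> cmod (z - x) + cmod (x - w)"
      using norm_triangle_ineq[of "z - x" "x - w"] by simp
    thus "cmod (z - w) \<le> 2 * max r (cmod (x - w))"
      using assms by simp
  qed simp
  thus ?thesis by (simp add: prod.distrib root_gauge_def)
qed

text \<open>For x nearest to z, |x - w| <= |x - z| + |z - w| <= 2 |z - w|, so each factor of the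
  gauge is at most twice the corresponding factor of the product.\<close>

lemma root_gauge_le_norm_prod:
  assumes "\<And>w. w \<in> Z \<Longrightarrow> cmod (z - x) \<le> cmod (z - w)"
  shows "root_gauge Z x (cmod (z - x)) \<le> 2 ^ card Z * cmod (\<Prod>w\<in>Z. z - w)"
proof -
  have "root_gauge Z x (cmod (z - x)) \<le> (\<Prod>w\<in>Z. 2 * cmod (z - w))"
    unfolding root_gauge_def
  proof (intro prod_mono conjI)
    fix w assume w: "w \<in> Z"
    have "cmod (x - w) \<le> cmod (x - z) + cmod (z - w)"
      using norm_triangle_ineq[of "x - z" "z - w"] by simp
    also have "cmod (x - z) = cmod (z - x)" by (rule norm_minus_commute)
    finally show "max (cmod (z - x)) (cmod (x - w)) \<le> 2 * cmod (z - w)"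
      using assms[OF w] norm_ge_zero[of "z - w"] by (intro max.boundedI) linarith+
  qed (auto simp: le_max_iff_disj)
  thus ?thesis by (simp add: prod.distrib prod_norm)
qed

text \<open>Between consecutive distances \<open>scale_weight\<close> is a pure power of the radius, with an
  exponent that non-resonance keeps away from zero.\<close>
lemma scale_weight_le:
  assumes Z: "finite Z" "x \<in> Z" "\<And>z. z \<in> Z \<Longrightarrow> cmod (x - z) < R"
    and r: "0 < r" "r \<le> R"
    and eta: "\<eta> > 0" "\<And>k. k \<in> {1..card Z} \<Longrightarrow> \<eta> \<le> \<bar>\<alpha> - real k * \<delta>\<bar>" and pos: "\<alpha> - \<delta> > 0"
  shows "\<exists>d\<in>insert R ((\<lambda>z. cmod (x - z)) ` (Z - {x})).
           scale_weight \<alpha> \<delta> Z x r \<le> scale_weight \<alpha> \<delta> Z x d * min (r / d) (d / r) powr \<eta>"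
proof -
  \<comment> \<open>The roots in \<open>A\<close> lie within r of x, those in \<open>B\<close>
    beyond. For s in the gap between the two groups the gauge is s^k W, so the weight is a constant
    times s^\<kappa>.\<close>
  define A where "A = {z\<in>Z. cmod (x - z) \<le> r}"
  define B where "B = Z - A"
  define k where "k = card A"
  define \<kappa> where "\<kappa> = \<alpha> - real k * \<delta>"
  define W where "W = (\<Prod>z\<in>B. cmod (x - z))"
  have fin: "finite A" "finite B" using Z by (auto simp: A_def B_def)
  have xA: "x \<in> A" using Z r by (simp add: A_def)
  have "k \<ge> 1" using xA fin unfolding k_def by (simp add: Suc_le_eq card_gt_0_iff) blast
  moreover have "k \<le> card Z" unfolding k_def using Z by (intro card_mono) (auto simp: A_def)
  ultimately have \<kappa>: "\<eta> \<le> \<bar>\<kappa>\<bar>" using eta(2)[of k] by (simp add: \<kappa>_def)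
  have W: "W > 0" unfolding W_def using xA by (intro prod_pos) (auto simp: B_def)
  have weight: "scale_weight \<alpha> \<delta> Z x s = s powr \<kappa> / W powr \<delta>"
    if "s > 0" "\<And>z. z \<in> A \<Longrightarrow> cmod (x - z) \<le> s" "\<And>z. z \<in> B \<Longrightarrow> s \<le> cmod (x - z)" for s
  proof -
    have "root_gauge Z x s = (\<Prod>z\<in>A. max s (cmod (x - z))) * (\<Prod>z\<in>B. max s (cmod (x - z)))"
      unfolding root_gauge_def using fin
      by (subst prod.union_disjoint[symmetric]) (auto simp: B_def A_def intro!: prod.cong)
    also have "(\<Prod>z\<in>A. max s (cmod (x - z))) = (\<Prod>z\<in>A. s)"
      using that by (intro prod.cong) auto
    also have "(\<Prod>z\<in>B. max s (cmod (x - z))) = W"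
      unfolding W_def using that by (intro prod.cong) auto
    finally have "root_gauge Z x s = s powr real k * W"
      using that by (simp add: k_def powr_realpow)
    thus ?thesis
      using that W by (simp add: scale_weight_def \<kappa>_def powr_mult powr_powr powr_diff)
  qed
  have ratio: "scale_weight \<alpha> \<delta> Z x r = scale_weight \<alpha> \<delta> Z x d * (r / d) powr \<kappa>"
    if "d > 0" "\<And>z. z \<in> A \<Longrightarrow> cmod (x - z) \<le> d" "\<And>z. z \<in> B \<Longrightarrow> d \<le> cmod (x - z)" for d
  proof -
    have "scale_weight \<alpha> \<delta> Z x r = r powr \<kappa> / W powr \<delta>"
      using r by (intro weight) (auto simp: A_def B_def)
    thus ?thesis using r that by (subst weight) (auto simp: powr_divide)
  qed
  show ?thesis
  proof (cases "\<kappa> > 0")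
    case True
    \<comment> \<open>A positive exponent makes the weight increase on the gap, so it is compared
      with the outer end, which is \<open>R\<close> when no root lies farther out.\<close>
    define d where "d = Min (insert R ((\<lambda>z. cmod (x - z)) ` B))"
    have d_in: "d \<in> insert R ((\<lambda>z. cmod (x - z)) ` B)"
      unfolding d_def using fin by (intro Min_in) auto
    have d_le: "d \<le> cmod (x - z)" if "z \<in> B" for z
      unfolding d_def using fin that by (intro Min_le) auto
    have rd: "r \<le> d" using d_in r by (auto simp: B_def A_def)
    hence d0: "d > 0" using r by linarith
    have "scale_weight \<alpha> \<delta> Z x r = scale_weight \<alpha> \<delta> Z x d * (r / d) powr \<kappa>"
      using rd d0 d_le by (intro ratio) (auto simp: A_def)
    also have "\<dots> \<le> scale_weight \<alpha> \<delta> Z x d * (r / d) powr \<eta>"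
      using \<kappa> True rd d0 r by (intro mult_left_mono scale_weight_nonneg powr_mono') auto
    also have "r / d = min (r / d) (d / r)"
    proof -
      have "r / d \<le> 1" "1 \<le> d / r" using rd d0 r by simp_all
      thus ?thesis by simp
    qed
    finally show ?thesis
      using d_in xA by (intro bexI[of _ d]) (auto simp: B_def)
  next
    case False
    hence \<kappa>': "\<kappa> < 0" using \<kappa> eta(1) by (cases "\<kappa> = 0") auto
    \<comment> \<open>A negative exponent calls for the inner end of the gap, which must be a
      positive distance. If x were the only root inside, the exponent would be \<alpha> - \<delta>,
      which is positive.\<close>
    have "A - {x} \<noteq> {}"
    proof
      assume "A - {x} = {}"
      hence "A = {x}" using xA by blast
      hence "k = 1" by (simp add: k_def)
      thus False using \<kappa>' pos by (simp add: \<kappa>_def)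
    qed
    define d where "d = Max ((\<lambda>z. cmod (x - z)) ` (A - {x}))"
    have d_in: "d \<in> (\<lambda>z. cmod (x - z)) ` (A - {x})"
      unfolding d_def using fin \<open>A - {x} \<noteq> {}\<close> by (intro Max_in) auto
    have d0: "d > 0" and dr: "d \<le> r" using d_in by (auto simp: A_def)
    have d_ge: "cmod (x - z) \<le> d" if "z \<in> A" for z
    proof (cases "z = x")
      case True
      thus ?thesis using d0 by simp
    next
      case False
      thus ?thesis unfolding d_def using fin that by (intro Max_ge) auto
    qed
    have "scale_weight \<alpha> \<delta> Z x r = scale_weight \<alpha> \<delta> Z x d * (r / d) powr \<kappa>"
      using dr d0 d_ge by (intro ratio) (auto simp: A_def B_def)
    also have "(r / d) powr \<kappa> = (d / r) powr (- \<kappa>)"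
      using d0 r by (simp add: powr_divide powr_minus field_simps)
    also have "scale_weight \<alpha> \<delta> Z x d * (d / r) powr (- \<kappa>) \<le> scale_weight \<alpha> \<delta> Z x d * (d / r) powr \<eta>"
      using \<kappa> \<kappa>' dr d0 r by (intro mult_left_mono scale_weight_nonneg powr_mono') auto
    also have "d / r = min (r / d) (d / r)"
    proof -
      have "d / r \<le> 1" "1 \<le> r / d" using dr d0 r by simp_all
      thus ?thesis by simp
    qed
    finally show ?thesis
      using d_in by (intro bexI[of _ d]) (auto simp: A_def)
  qed
qed

text \<open>A bump at scale d that decays like a power \<eta> of the ratio of scales in both
  directions. In polar coordinates the factor 1/|z|^2 turns area into a multiple of dr/r, so the
  total mass does not depend on d. The value at 0 is 0.\<close>

definition scale_kernel :: "real \<Rightarrow> real \<Rightarrow> complex \<Rightarrow> real" where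
  "scale_kernel \<eta> d z = min (cmod z / d) (d / cmod z) powr \<eta> / cmod z ^ 2"

lemma scale_kernel_nonneg: "0 \<le> scale_kernel \<eta> d z"
  by (simp add: scale_kernel_def)

lemma ex_dyadic_scale:
  fixes y :: real
  assumes "y \<ge> 1"
  shows "\<exists>k. 2 ^ k \<le> y \<and> y < 2 ^ Suc k"
proof -
  define n where "n = (LEAST n. y < 2 ^ n)"
  have ex: "\<exists>n. y < 2 ^ n" using real_arch_pow[of 2 y] by simp
  have n: "y < 2 ^ n" unfolding n_def using ex by (rule LeastI_ex)
  with assms obtain k where k: "n = Suc k" by (cases n) auto
  have "\<not> y < 2 ^ k" using not_less_Least[of k "\<lambda>n. y < 2 ^ n"] k by (simp add: n_def)
  thus ?thesis using n k by (intro exI[of _ k]) auto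
qed

lemma nn_integral_indicator_cball:
  assumes "c \<ge> 0" "r \<ge> 0"
  shows "(\<integral>\<^sup>+z. ennreal c * indicator (cball (x::complex) r) z \<partial>lborel) = ennreal (c * (pi * r ^ 2))"
  using assms by (simp add: nn_integral_cmult_indicator emeasure_cball unit_ball_vol_2 ennreal_mult)

text \<open>Dyadic shells on both sides of radius d: on the k-th one the kernel is at most q^k, with
  q = 2^(-\<eta>), times a multiple of the reciprocal area. Enlarging shells to disks, each
  contributes 4 pi q^k; two geometric series give the constant.\<close>

lemma nn_integral_scale_kernel_le:
  assumes eta: "\<eta> > 0" and d: "d > 0"
  shows "(\<integral>\<^sup>+z. ennreal (scale_kernel \<eta> d (z - x)) \<partial>lborel) \<le> ennreal (8 * pi / (1 - 2 powr (- \<eta>)))"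
proof -
  define q where "q = 2 powr (- \<eta>)"
  have q: "0 < q" "q < 1" using eta by (auto simp: q_def powr_less_one)
  \<comment> \<open>\<open>f k\<close> majorizes the kernel where d/2^(k+1) < |z - x| <= d/2^k, and
    \<open>g k\<close> where 2^k d <= |z - x| < 2^(k+1) d.\<close>
  define f where "f = (\<lambda>k z. ennreal (q ^ k * 4 ^ Suc k / d ^ 2) * indicator (cball x (d / 2 ^ k)) z)"
  define g where "g = (\<lambda>k z. ennreal (q ^ k / (4 ^ k * d ^ 2)) * indicator (cball x (2 ^ Suc k * d)) z)"
  have [measurable]: "f k \<in> borel_measurable borel" "g k \<in> borel_measurable borel" for k
    unfolding f_def g_def
    by (intro borel_measurable_times_ennreal borel_measurable_indicator; simp)+
  have four: "(2 ^ k)\<^sup>2 = (4::real) ^ k" for k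
    by (simp add: power2_eq_square flip: power_mult_distrib)
  have q_pow: "y powr \<eta> \<le> q ^ k" if "0 < y" "y \<le> 1 / 2 ^ k" for y k
  proof -
    have "y powr \<eta> \<le> (1 / 2 ^ k) powr \<eta>"
      using that eta by (intro powr_mono2) auto
    also have "\<dots> = q ^ k"
      by (simp add: q_def powr_divide powr_minus powr_powr mult.commute divide_simps
            flip: powr_realpow)
    finally show ?thesis .
  qed
  have "(\<integral>\<^sup>+z. ennreal (scale_kernel \<eta> d (z - x)) \<partial>lborel) \<le> (\<integral>\<^sup>+z. (\<Sum>k. f k z + g k z) \<partial>lborel)"
  proof (rule nn_integral_mono)
    fix z :: complex
    define s where "s = cmod (z - x)"
    have mem: "f k z + g k z \<le> (\<Sum>k. f k z + g k z)" for k
      using sum_le_suminf[of "\<lambda>k. f k z + g k z" "{k}"] by simp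
    consider "s = 0" | "0 < s" "s < d" | "d \<le> s" "0 < s" using d by (force simp: s_def)
    thus "ennreal (scale_kernel \<eta> d (z - x)) \<le> (\<Sum>k. f k z + g k z)"
    proof cases
      case 1
      thus ?thesis by (simp add: scale_kernel_def s_def)
    next
      case 2
      then obtain k where k: "2 ^ k \<le> d / s" "d / s < 2 ^ Suc k"
        using ex_dyadic_scale[of "d / s"] by auto
      have sd: "s / d \<le> d / s"
      proof -
        have "s / d \<le> 1" "1 \<le> d / s" using 2 d by simp_all
        thus ?thesis by linarith
      qed
      have "1 / s \<le> 2 ^ Suc k / d" using k(2) 2 d by (simp add: field_simps)
      hence "(1 / s) ^ 2 \<le> (2 ^ Suc k / d) ^ 2" using 2 by (intro power_mono) auto
      also have "\<dots> = 4 ^ Suc k / d ^ 2"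
        by (simp add: power_divide power_mult_distrib four)
      finally have s2: "1 / s ^ 2 \<le> 4 ^ Suc k / d ^ 2" by (simp add: power_divide)
      have "scale_kernel \<eta> d (z - x) = (s / d) powr \<eta> * (1 / s ^ 2)"
        using sd by (simp add: scale_kernel_def s_def)
      also have "\<dots> \<le> q ^ k * (4 ^ Suc k / d ^ 2)"
        using 2 d k(1) q by (intro mult_mono s2 q_pow) (auto simp: field_simps)
      finally have "ennreal (scale_kernel \<eta> d (z - x)) \<le> ennreal (q ^ k * 4 ^ Suc k / d ^ 2)"
        by (intro ennreal_leI) simp
      also have "\<dots> = f k z"
      proof -
        have "z \<in> cball x (d / 2 ^ k)"
          using k(1) 2 by (simp add: dist_norm norm_minus_commute s_def field_simps)
        thus ?thesis by (simp add: f_def)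
      qed
      also have "\<dots> \<le> f k z + g k z" by simp
      also note mem
      finally show ?thesis .
    next
      case 3
      then obtain k where k: "2 ^ k \<le> s / d" "s / d < 2 ^ Suc k"
        using ex_dyadic_scale[of "s / d"] d by auto
      have sd: "d / s \<le> s / d"
      proof -
        have "d / s \<le> 1" "1 \<le> s / d" using 3 d by simp_all
        thus ?thesis by linarith
      qed
      have "1 / s \<le> 1 / (2 ^ k * d)" using k(1) 3 d by (simp add: field_simps)
      hence "(1 / s) ^ 2 \<le> (1 / (2 ^ k * d)) ^ 2" using 3 by (intro power_mono) auto
      also have "\<dots> = 1 / (4 ^ k * d ^ 2)"
        by (simp add: power_divide power_mult_distrib four)
      finally have s2: "1 / s ^ 2 \<le> 1 / (4 ^ k * d ^ 2)" by (simp add: power_divide)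
      have "scale_kernel \<eta> d (z - x) = (d / s) powr \<eta> * (1 / s ^ 2)"
        using sd by (simp add: scale_kernel_def s_def)
      also have "\<dots> \<le> q ^ k * (1 / (4 ^ k * d ^ 2))"
        using 3 d k(1) q by (intro mult_mono s2 q_pow) (auto simp: field_simps)
      finally have "ennreal (scale_kernel \<eta> d (z - x)) \<le> ennreal (q ^ k / (4 ^ k * d ^ 2))"
        by (intro ennreal_leI) simp
      also have "\<dots> = g k z"
      proof -
        have "z \<in> cball x (2 ^ Suc k * d)"
          using k(2) d by (simp add: dist_norm norm_minus_commute s_def field_simps)
        thus ?thesis by (simp add: g_def)
      qed
      also have "\<dots> \<le> f k z + g k z" by simp
      also note mem
      finally show ?thesis .
    qed
  qed
  also have "\<dots> = (\<Sum>k. \<integral>\<^sup>+z. f k z + g k z \<partial>lborel)"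
    by (rule nn_integral_suminf) measurable
  also have "(\<lambda>k. \<integral>\<^sup>+z. f k z + g k z \<partial>lborel) = (\<lambda>k. ennreal (8 * pi * q ^ k))"
  proof
    fix k
    have "(\<integral>\<^sup>+z. f k z + g k z \<partial>lborel) = (\<integral>\<^sup>+z. f k z \<partial>lborel) + (\<integral>\<^sup>+z. g k z \<partial>lborel)"
      by (rule nn_integral_add) measurable
    also have "(\<integral>\<^sup>+z. f k z \<partial>lborel) = ennreal (4 * pi * q ^ k)"
      unfolding f_def using q d
      by (subst nn_integral_indicator_cball) (auto simp: field_simps four)
    also have "(\<integral>\<^sup>+z. g k z \<partial>lborel) = ennreal (4 * pi * q ^ k)"
      unfolding g_def using q d
      by (subst nn_integral_indicator_cball) (auto simp: field_simps four)
    finally show "(\<integral>\<^sup>+z. f k z + g k z \<partial>lborel) = ennreal (8 * pi * q ^ k)" using q by (simp flip: ennreal_plus)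
  qed
  also have "(\<Sum>k. ennreal (8 * pi * q ^ k)) = ennreal (\<Sum>k. 8 * pi * q ^ k)"
    using q by (intro suminf_ennreal2) (auto intro!: summable_mult summable_geometric)
  also have "(\<Sum>k. 8 * pi * q ^ k) = 8 * pi / (1 - q)"
    using q by (subst suminf_mult) (auto simp: suminf_geometric summable_geometric)
  finally show ?thesis by (simp add: q_def)
qed

lemma nn_integral_sum_scale_kernel_le:
  assumes eta: "\<eta> > 0" and J: "finite J"
    and c: "\<And>j. j \<in> J \<Longrightarrow> 0 \<le> c j" and d: "\<And>j. j \<in> J \<Longrightarrow> 0 < d j"
  shows "(\<integral>\<^sup>+z. ennreal (\<Sum>j\<in>J. c j * scale_kernel \<eta> (d j) (z - x j)) \<partial>lborel)
           \<le> ennreal (8 * pi / (1 - 2 powr (- \<eta>)) * (\<Sum>j\<in>J. c j))"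
proof -
  have q: "2 powr (- \<eta>) < 1" using eta by (simp add: powr_less_one)
  define C where "C = 8 * pi / (1 - 2 powr (- \<eta>))"
  have C: "C \<ge> 0" unfolding C_def using q by (intro divide_nonneg_nonneg) auto
  have [measurable]: "(\<lambda>z. ennreal (scale_kernel \<eta> D (z - y))) \<in> borel_measurable borel" for D y
    unfolding scale_kernel_def by measurable
  have "(\<integral>\<^sup>+z. ennreal (\<Sum>j\<in>J. c j * scale_kernel \<eta> (d j) (z - x j)) \<partial>lborel) =
      (\<integral>\<^sup>+z. (\<Sum>j\<in>J. ennreal (c j) * ennreal (scale_kernel \<eta> (d j) (z - x j))) \<partial>lborel)"
    using c scale_kernel_nonneg by (intro nn_integral_cong) (simp add: ennreal_mult flip: sum_ennreal)
  also have "\<dots> = (\<Sum>j\<in>J. \<integral>\<^sup>+z. ennreal (c j) * ennreal (scale_kernel \<eta> (d j) (z - x j)) \<partial>lborel)"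
    by (rule nn_integral_sum) measurable
  also have "\<dots> = (\<Sum>j\<in>J. ennreal (c j) * (\<integral>\<^sup>+z. ennreal (scale_kernel \<eta> (d j) (z - x j)) \<partial>lborel))"
    by (intro sum.cong refl nn_integral_cmult) measurable
  also have "\<dots> \<le> (\<Sum>j\<in>J. ennreal (c j) * ennreal C)"
    unfolding C_def using d by (intro sum_mono mult_left_mono nn_integral_scale_kernel_le eta) auto
  also have "\<dots> = (\<Sum>j\<in>J. ennreal (C * c j))"
    using c C by (intro sum.cong refl) (simp add: ennreal_mult mult.commute)
  also have "\<dots> = ennreal (\<Sum>j\<in>J. C * c j)"
    using c C by (intro sum_ennreal) auto
  finally show ?thesis by (simp add: C_def sum_distrib_left)
qed

section \<open>The integral as a sum over the roots\<close>

lemma degree_pcompose_shift: "degree (pcompose P [:x, 1:]) = degree (P :: complex poly)"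
  by (simp add: degree_pcompose)

lemma poly_taylor:
  assumes "degree P \<le> M"
  shows "poly P (x + w) = (\<Sum>k\<le>M. taylor_coeff P x k * w ^ k)"
proof -
  have "poly P (x + w) = poly (pcompose P [:x, 1:]) w"
    by (simp add: poly_pcompose add.commute)
  also have "\<dots> = (\<Sum>k\<le>M. taylor_coeff P x k * w ^ k)"
    unfolding poly_altdef taylor_coeff_def using assms
    by (intro sum.mono_neutral_left) (auto simp: not_le coeff_eq_0 degree_pcompose_shift)
  finally show ?thesis .
qed

text \<open>\<open>P\<close> may have zeros near x, so a lower bound is sought on a smaller disk of
  proportional radius. \<open>ex_large_value_poly\<close> gives a point where |P| is at least c A;
  within radius r the increments of \<open>P\<close> are controlled by A as well, so half of the
  bound persists nearby.\<close>

lemma ex_ball_poly_large: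
  fixes P :: "complex poly" and x :: complex
  assumes deg: "degree P \<le> M" and r: "r > 0"
  defines "c \<equiv> 1 / ((2 * real M + 3) ^ M * (2 * (real M + 1)) ^ M)"
  defines "A \<equiv> \<Sum>k\<le>M. cmod (taylor_coeff P x k) * r ^ k"
  shows "\<exists>z0. ball z0 (c / (2 * (real M + 1)) * r) \<subseteq> cball x r \<and>
           (\<forall>z\<in>ball z0 (c / (2 * (real M + 1)) * r). c / 2 * A \<le> cmod (poly P z))"
proof -
  define p where "p = pcompose P [:x, 1:]"
  \<comment> \<open>Scaled so that the point t r' with t <= M has modulus at most r/2; undoing the
    scaling is the factor (2(M + 1))^M in \<open>c\<close>.\<close>
  define r' where "r' = r / (2 * (real M + 1))"
  have r': "r' > 0" using r by (simp add: r'_def)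
  have c: "c > 0" by (simp add: c_def add_nonneg_pos)
  have c1: "c \<le> 1"
  proof -
    have "1 \<le> (2 * real M + 3) ^ M" "1 \<le> (2 * (real M + 1)) ^ M"
      by (intro one_le_power; simp)+
    hence "1 \<le> (2 * real M + 3) ^ M * (2 * (real M + 1)) ^ M"
      using mult_mono[of 1 "(2 * real M + 3) ^ M" 1 "(2 * (real M + 1)) ^ M"] by simp
    thus ?thesis by (simp add: c_def)
  qed
  have p: "poly P z = poly p (z - x)" for z
    by (simp add: p_def poly_pcompose)
  have degp: "degree p \<le> M" using deg by (simp add: p_def degree_pcompose_shift)
  obtain t where t: "t \<le> M"
    "(\<Sum>k\<le>M. cmod (coeff p k) * r' ^ k) / (2 * real M + 3) ^ M \<le> cmod (poly p (of_nat t * of_real r'))"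
    using ex_large_value_poly[OF degp, of r'] r' by auto
  define w0 where "w0 = of_nat t * complex_of_real r'"
  have w0: "cmod w0 \<le> r / 2"
  proof -
    have "cmod w0 = real t * r'" using r' by (simp add: w0_def norm_mult)
    also have "\<dots> \<le> (real M + 1) * r'" using t r' by (intro mult_right_mono) auto
    also have "\<dots> = r / 2" by (simp add: r'_def field_simps)
    finally show ?thesis .
  qed
  have A0: "A \<ge> 0" unfolding A_def using r by (intro sum_nonneg) auto
  have "A / (2 * (real M + 1)) ^ M \<le> (\<Sum>k\<le>M. cmod (coeff p k) * r' ^ k)"
    unfolding A_def sum_divide_distrib
  proof (rule sum_mono)
    fix k assume k: "k \<in> {..M}"
    have "(2 * (real M + 1)) ^ k \<le> (2 * (real M + 1)) ^ M"
      using k by (intro power_increasing) auto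
    hence "r ^ k / (2 * (real M + 1)) ^ M \<le> r ^ k / (2 * (real M + 1)) ^ k"
      using r by (intro divide_left_mono) (auto simp: add_nonneg_pos)
    also have "\<dots> = r' ^ k" by (simp add: r'_def power_divide)
    finally have "cmod (coeff p k) * (r ^ k / (2 * (real M + 1)) ^ M) \<le> cmod (coeff p k) * r' ^ k"
      by (intro mult_left_mono) auto
    thus "cmod (taylor_coeff P x k) * r ^ k / (2 * (real M + 1)) ^ M \<le> cmod (coeff p k) * r' ^ k"
      by (simp add: taylor_coeff_def p_def)
  qed
  hence "A / (2 * (real M + 1)) ^ M / (2 * real M + 3) ^ M \<le>
      (\<Sum>k\<le>M. cmod (coeff p k) * r' ^ k) / (2 * real M + 3) ^ M"
    by (intro divide_right_mono) auto
  also note t(2)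
  finally have large: "c * A \<le> cmod (poly p w0)"
    by (simp add: c_def w0_def mult_ac)
  \<comment> \<open>Chosen so that the increment bound (M + 1)\<kappa>A below is c A/2, half of the
    value at \<open>w0\<close>; \<kappa> <= 1/2 keeps the small disk within radius r.\<close>
  define \<kappa> where "\<kappa> = c / (2 * (real M + 1))"
  have \<kappa>: "\<kappa> > 0" "\<kappa> \<le> 1 / 2" using c c1 by (auto simp: \<kappa>_def field_simps)
  have wr: "cmod w \<le> r" if "cmod (w - w0) < \<kappa> * r" for w
  proof -
    have "cmod w \<le> cmod (w - w0) + cmod w0"
      using norm_triangle_ineq[of "w - w0" w0] by simp
    moreover have "\<kappa> * r \<le> 1 / 2 * r" using \<kappa> r by (intro mult_right_mono) auto
    ultimately show ?thesis using that w0 by simp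
  qed
  have near: "c / 2 * A \<le> cmod (poly p w)" if w: "cmod (w - w0) < \<kappa> * r" for w
  proof -
    have "poly p v = (\<Sum>k\<le>M. taylor_coeff P x k * v ^ k)" for v
      using poly_taylor[OF deg, of x v] by (simp add: p add.commute)
    hence "poly p w - poly p w0 = (\<Sum>k\<le>M. taylor_coeff P x k * (w ^ k - w0 ^ k))"
      by (simp add: sum_subtractf right_diff_distrib)
    hence "cmod (poly p w - poly p w0) \<le> (\<Sum>k\<le>M. cmod (taylor_coeff P x k * (w ^ k - w0 ^ k)))"
      by (simp add: norm_sum)
    also have "\<dots> \<le> (\<Sum>k\<le>M. (real M + 1) * \<kappa> * (cmod (taylor_coeff P x k) * r ^ k))"
    proof (rule sum_mono)
      fix k assume k: "k \<in> {..M}"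
      have "w ^ k - w0 ^ k = of_real (r ^ k) * ((w / of_real r) ^ k - (w0 / of_real r) ^ k)"
        using r by (simp add: power_divide right_diff_distrib)
      hence "cmod (w ^ k - w0 ^ k) = r ^ k * cmod ((w / of_real r) ^ k - (w0 / of_real r) ^ k)"
        using r by (simp add: norm_mult norm_power)
      also have "\<dots> \<le> r ^ k * (real k * cmod (w / of_real r - w0 / of_real r))"
        using r wr[OF w] w0 by (intro mult_left_mono norm_power_diff) (auto simp: norm_divide)
      also have "cmod (w / of_real r - w0 / of_real r) \<le> \<kappa>"
        using w r by (simp add: norm_divide field_simps flip: diff_divide_distrib)
      also have "real k * \<kappa> \<le> (real M + 1) * \<kappa>"
        using k \<kappa> by (intro mult_right_mono) auto
      finally have "cmod (w ^ k - w0 ^ k) \<le> r ^ k * ((real M + 1) * \<kappa>)"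
        using r by (simp add: mult_left_mono)
      hence "cmod (taylor_coeff P x k) * cmod (w ^ k - w0 ^ k)
          \<le> cmod (taylor_coeff P x k) * (r ^ k * ((real M + 1) * \<kappa>))"
        by (intro mult_left_mono) auto
      thus "cmod (taylor_coeff P x k * (w ^ k - w0 ^ k))
          \<le> (real M + 1) * \<kappa> * (cmod (taylor_coeff P x k) * r ^ k)"
        by (simp add: norm_mult mult_ac)
    qed
    also have "\<dots> = (real M + 1) * \<kappa> * A" by (simp add: A_def sum_distrib_left)
    also have "(real M + 1) * \<kappa> = c / 2" by (simp add: \<kappa>_def field_simps)
    finally have "cmod (poly p w - poly p w0) \<le> c / 2 * A" .
    moreover have "cmod (poly p w0) \<le> cmod (poly p w) + cmod (poly p w - poly p w0)"
      using norm_triangle_ineq4[of "poly p w" "poly p w - poly p w0"] by simp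
    ultimately show ?thesis using large by simp
  qed
  show ?thesis
  proof (intro exI[of _ "x + w0"] conjI ballI subsetI)
    fix z assume "z \<in> ball (x + w0) (c / (2 * (real M + 1)) * r)"
    hence z: "cmod ((z - x) - w0) < \<kappa> * r"
      by (simp add: \<kappa>_def dist_norm norm_minus_commute algebra_simps)
    show "c / 2 * A \<le> cmod (poly P z)" unfolding p by (rule near[OF z])
    show "z \<in> cball x r" using wr[OF z] by (simp add: dist_norm norm_minus_commute)
  qed
qed

definition weighted_integral :: "real \<Rightarrow> real \<Rightarrow> complex poly \<Rightarrow> complex poly \<Rightarrow> ennreal" where
  "weighted_integral \<epsilon> \<delta> P Q = (\<integral>\<^sup>+ z. indicator (ball 0 1) z *
     ennreal (rpow (cmod (poly P z)) \<epsilon> / rpow (cmod (poly Q z)) \<delta>) \<partial>lborel)"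

text \<open>The summand 1 stands for an outer scale beyond all distances between roots, where the
  weight is comparable to a constant.\<close>

definition root_sum :: "real \<Rightarrow> real \<Rightarrow> nat \<Rightarrow> complex poly \<Rightarrow> complex set \<Rightarrow> real" where
  "root_sum \<epsilon> \<delta> M P Z = (\<Sum>x\<in>Z. \<Sum>k\<le>M. rpow (cmod (taylor_coeff P x k)) \<epsilon> *
     (1 + (\<Sum>w\<in>Z - {x}. scale_weight (real k * \<epsilon> + 2) \<delta> Z x (cmod (x - w)))))"

locale small_roots =
  fixes \<epsilon> \<delta> :: real and M :: nat and P Q :: "complex poly" and Z :: "complex set" and a :: complex
  assumes eps: "\<epsilon> \<ge> 0" and del: "\<delta> \<ge> 0" "\<delta> < 2"
    and Z: "finite Z" "Z \<noteq> {}" "\<And>z. z \<in> Z \<Longrightarrow> cmod z < 1 / 4"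
    and Q: "Q = smult a (\<Prod>z\<in>Z. [:- z, 1:])" and a: "1 / 2 \<le> cmod a" "cmod a \<le> 2"
    and P: "degree P \<le> M"
begin

lemma Z_close: "x \<in> Z \<Longrightarrow> z \<in> Z \<Longrightarrow> cmod (x - z) < 1 / 2"
  using Z(3)[of x] Z(3)[of z] norm_triangle_ineq4[of x z] by simp

lemma norm_poly_Q: "cmod (poly Q z) = cmod a * cmod (\<Prod>w\<in>Z. z - w)"
  by (simp add: Q poly_prod norm_mult)

lemma AE_not_root: "AE z in lborel. z \<notin> Z"
  using finite_imp_null_set_lborel[OF Z(1)] by (rule AE_not_in)

lemma root_gauge_large:
  assumes "x \<in> Z" "r \<ge> 1 / 2"
  shows "root_gauge Z x r = r ^ card Z"
proof -
  have "root_gauge Z x r = (\<Prod>z\<in>Z. r)"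
    unfolding root_gauge_def
  proof (rule prod.cong)
    fix z assume "z \<in> Z"
    thus "max r (cmod (x - z)) = r"
      using Z_close[OF assms(1), of z] assms(2) by linarith
  qed simp
  thus ?thesis by simp
qed

text \<open>The integral is restricted to the small disk of \<open>ex_ball_poly_large\<close>: there
  |P| is bounded below and |Q| above by the gauge, and the area, a multiple of r^2, supplies the 2
  in the exponent k\<epsilon> + 2.\<close>

lemma weight_le_integral:
  assumes x: "x \<in> Z" and r: "0 < r" "r \<le> 1 / 2" and k: "k \<le> M"
  defines "c \<equiv> 1 / ((2 * real M + 3) ^ M * (2 * (real M + 1)) ^ M)"
  defines "\<kappa> \<equiv> c / (2 * (real M + 1))"
  shows "ennreal (rpow (c / 2) \<epsilon> * pi * \<kappa> ^ 2 / rpow (2 * 2 ^ card Z) \<delta> *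
           (rpow (cmod (taylor_coeff P x k)) \<epsilon> * scale_weight (real k * \<epsilon> + 2) \<delta> Z x r))
         \<le> weighted_integral \<epsilon> \<delta> P Q"
proof -
  define A where "A = (\<Sum>k\<le>M. cmod (taylor_coeff P x k) * r ^ k)"
  have c: "c > 0" by (simp add: c_def add_nonneg_pos)
  have \<kappa>: "\<kappa> > 0" using c by (simp add: \<kappa>_def add_nonneg_pos)
  obtain z0 where z0: "ball z0 (\<kappa> * r) \<subseteq> cball x r"
    "\<And>z. z \<in> ball z0 (\<kappa> * r) \<Longrightarrow> c / 2 * A \<le> cmod (poly P z)"
    using ex_ball_poly_large[OF P r(1), of x] unfolding \<kappa>_def c_def A_def by blast
  define g where "g = root_gauge Z x r"
  have g: "g > 0" using r by (simp add: g_def root_gauge_pos)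
  define m where "m = rpow (c / 2 * A) \<epsilon> / rpow (2 * 2 ^ card Z * g) \<delta>"
  have A_ge: "cmod (taylor_coeff P x k) * r ^ k \<le> A"
    unfolding A_def using k r
    by (intro member_le_sum[of k _ "\<lambda>k. cmod (taylor_coeff P x k) * r ^ k"]) auto
  have "0 \<le> cmod (taylor_coeff P x k) * r ^ k" using r by simp
  hence A0: "0 \<le> A" using A_ge by linarith
  have m0: "m \<ge> 0" by (simp add: m_def)
  have "ennreal (m * (pi * (\<kappa> * r) ^ 2)) = (\<integral>\<^sup>+z. ennreal m * indicator (ball z0 (\<kappa> * r)) z \<partial>lborel)"
    using m0 \<kappa> r by (simp add: nn_integral_cmult_indicator emeasure_ball unit_ball_vol_2 ennreal_mult)
  also have "\<dots> \<le> weighted_integral \<epsilon> \<delta> P Q"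
    unfolding weighted_integral_def
  \<comment> \<open>At a root of \<open>Q\<close> division by zero makes the integrand 0 when
    \<delta> is not 0, so the pointwise bound can fail there; the finitely many roots form a null
    set.\<close>
  proof (rule nn_integral_mono_AE, use AE_not_root in eventually_elim)
    fix z assume z: "z \<notin> Z"
    show "ennreal m * indicator (ball z0 (\<kappa> * r)) z \<le> indicator (ball 0 1) z *
        ennreal (rpow (cmod (poly P z)) \<epsilon> / rpow (cmod (poly Q z)) \<delta>)"
    proof (cases "z \<in> ball z0 (\<kappa> * r)")
      case True
      hence zx: "cmod (z - x) \<le> r" using z0(1) by (force simp: dist_norm norm_minus_commute)
      have "cmod z \<le> cmod (z - x) + cmod x" using norm_triangle_ineq[of "z - x" x] by simp
      hence z1: "z \<in> ball 0 1" using zx r Z(3)[OF x] by simp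
      have "0 < cmod (\<Prod>w\<in>Z. z - w)" using z Z(1) by auto
      hence Q0: "0 < cmod (poly Q z)" using a by (auto simp: norm_poly_Q zero_less_mult_iff)
      have "cmod (poly Q z) \<le> 2 * (2 ^ card Z * g)"
        unfolding norm_poly_Q g_def using norm_prod_le_root_gauge[OF zx, of Z] a
        by (intro mult_mono) auto
      hence "rpow (cmod (poly Q z)) \<delta> \<le> rpow (2 * 2 ^ card Z * g) \<delta>"
        using del by (intro rpow_mono) auto
      moreover have "rpow (c / 2 * A) \<epsilon> \<le> rpow (cmod (poly P z)) \<epsilon>"
        using z0(2)[OF True] eps c A0 by (intro rpow_mono) auto
      ultimately have "m \<le> rpow (cmod (poly P z)) \<epsilon> / rpow (cmod (poly Q z)) \<delta>"
        unfolding m_def using Q0 by (intro frac_le rpow_pos) auto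
      thus ?thesis using True z1 by (simp add: ennreal_leI)
    qed simp
  qed
  finally have *: "ennreal (m * (pi * (\<kappa> * r) ^ 2)) \<le> weighted_integral \<epsilon> \<delta> P Q" .
  have "rpow (c / 2) \<epsilon> * (rpow (cmod (taylor_coeff P x k)) \<epsilon> * r powr (real k * \<epsilon>)) =
      rpow (c / 2) \<epsilon> * rpow (cmod (taylor_coeff P x k) * r ^ k) \<epsilon>"
    using r by (simp add: rpow_mult rpow_eq_powr powr_powr flip: powr_realpow)
  also have "\<dots> \<le> rpow (c / 2) \<epsilon> * rpow A \<epsilon>"
    using A_ge eps r by (intro mult_left_mono rpow_mono) auto
  also have "\<dots> = rpow (c / 2 * A) \<epsilon>"
    using c A0 by (subst rpow_mult) auto
  finally have num: "rpow (c / 2) \<epsilon> * (rpow (cmod (taylor_coeff P x k)) \<epsilon> * r powr (real k * \<epsilon>))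
      \<le> rpow (c / 2 * A) \<epsilon>" .
  have "rpow (c / 2) \<epsilon> * pi * \<kappa> ^ 2 / rpow (2 * 2 ^ card Z) \<delta> *
      (rpow (cmod (taylor_coeff P x k)) \<epsilon> * scale_weight (real k * \<epsilon> + 2) \<delta> Z x r) =
      (rpow (c / 2) \<epsilon> * (rpow (cmod (taylor_coeff P x k)) \<epsilon> * r powr (real k * \<epsilon>)))
        / rpow (2 * 2 ^ card Z * g) \<delta> * (pi * (\<kappa> * r) ^ 2)"
    using r g by (simp add: scale_weight_def powr_add power_mult_distrib rpow_mult rpow_eq_powr[OF g]
        mult_ac flip: g_def)
  also have "\<dots> \<le> m * (pi * (\<kappa> * r) ^ 2)"
    unfolding m_def using num by (intro mult_right_mono divide_right_mono) auto
  finally show ?thesis using * by (meson ennreal_leI order_trans)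
qed

text \<open>At the root x nearest to z, |Q| is bounded below by the gauge and |P| above by its
  Taylor sum; \<open>scale_weight_le\<close> with outer scale 2 passes from |z - x| to a breakpoint.
  The entry w = x of \<open>d\<close> is the slot for the outer scale, so the breakpoints are
  indexed by \<open>Z\<close> itself. Summing over all x makes the bound independent of which root
  is nearest.\<close>

lemma integrand_le:
  assumes eta: "\<eta> > 0" "\<And>k j. k \<le> M \<Longrightarrow> j \<in> {1..card Z} \<Longrightarrow> \<eta> \<le> \<bar>real k * \<epsilon> + 2 - real j * \<delta>\<bar>"
    and z: "z \<notin> Z" "cmod z < 1"
  defines "d \<equiv> \<lambda>x w. if w = x then 2 else cmod (x - w)"
  shows "rpow (cmod (poly P z)) \<epsilon> / rpow (cmod (poly Q z)) \<delta> \<le>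
    rpow (2 * 2 ^ card Z) \<delta> * rpow (real M + 1) \<epsilon> *
    (\<Sum>(x, k, w)\<in>Z \<times> {..M} \<times> Z. rpow (cmod (taylor_coeff P x k)) \<epsilon> *
       scale_weight (real k * \<epsilon> + 2) \<delta> Z x (d x w) * scale_kernel \<eta> (d x w) (z - x))"
proof -
  obtain x where x: "x \<in> Z" "\<And>w. w \<in> Z \<Longrightarrow> cmod (z - x) \<le> cmod (z - w)"
  proof -
    have "Min ((\<lambda>w. cmod (z - w)) ` Z) \<in> (\<lambda>w. cmod (z - w)) ` Z" using Z by (intro Min_in) auto
    then obtain x where x: "x \<in> Z" "Min ((\<lambda>w. cmod (z - w)) ` Z) = cmod (z - x)" by blast
    moreover have "cmod (z - x) \<le> cmod (z - w)" if "w \<in> Z" for w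
      unfolding x(2)[symmetric] using Z that by (intro Min_le) auto
    ultimately show ?thesis using that by blast
  qed
  define r where "r = cmod (z - x)"
  have r: "r > 0" using x(1) z(1) by (auto simp: r_def)
  have r2: "r \<le> 2" using norm_triangle_ineq4[of z x] z(2) Z(3)[OF x(1)] by (simp add: r_def)
  define g where "g = root_gauge Z x r"
  have g: "g > 0" using r by (simp add: g_def root_gauge_pos)
  define b where "b = (\<lambda>k. rpow (cmod (taylor_coeff P x k)) \<epsilon>)"
  define G where "G = (\<lambda>k. scale_weight (real k * \<epsilon> + 2) \<delta> Z x)"
  have "g \<le> 2 ^ card Z * cmod (\<Prod>w\<in>Z. z - w)"
    unfolding g_def r_def using x(2) by (rule root_gauge_le_norm_prod)
  also have "\<dots> \<le> 2 ^ card Z * (2 * cmod (poly Q z))"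
  proof (rule mult_left_mono)
    have "1 * cmod (\<Prod>w\<in>Z. z - w) \<le> (2 * cmod a) * cmod (\<Prod>w\<in>Z. z - w)"
      using a by (intro mult_right_mono) auto
    thus "cmod (\<Prod>w\<in>Z. z - w) \<le> 2 * cmod (poly Q z)"
      by (simp add: norm_poly_Q)
  qed simp
  finally have gQ: "g \<le> 2 * 2 ^ card Z * cmod (poly Q z)" by simp
  hence "rpow g \<delta> \<le> rpow (2 * 2 ^ card Z * cmod (poly Q z)) \<delta>"
    using g del by (intro rpow_mono) auto
  hence gQ': "rpow g \<delta> \<le> rpow (2 * 2 ^ card Z) \<delta> * rpow (cmod (poly Q z)) \<delta>"
    by (simp add: rpow_mult)
  have Q0: "cmod (poly Q z) > 0"
  proof -
    have "0 < 2 * 2 ^ card Z * cmod (poly Q z)" using g gQ by linarith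
    thus ?thesis by (simp add: zero_less_mult_iff)
  qed
  have Qinv: "1 / rpow (cmod (poly Q z)) \<delta> \<le> rpow (2 * 2 ^ card Z) \<delta> / g powr \<delta>"
    using gQ' rpow_pos[OF Q0, of \<delta>] rpow_pos[OF g, of \<delta>] by (simp add: rpow_eq_powr[OF g] field_simps)
  have "cmod (poly P z) \<le> (\<Sum>k\<le>M. cmod (taylor_coeff P x k) * r ^ k)"
    using poly_taylor[OF P, of x "z - x"]
    by (auto simp: r_def norm_mult norm_power intro!: order_trans[OF norm_sum] sum_mono)
  hence "rpow (cmod (poly P z)) \<epsilon> \<le> rpow (\<Sum>k\<le>M. cmod (taylor_coeff P x k) * r ^ k) \<epsilon>"
    using eps by (intro rpow_mono) auto
  also have "\<dots> \<le> rpow (real (card {..M})) \<epsilon> * (\<Sum>k\<le>M. rpow (cmod (taylor_coeff P x k) * r ^ k) \<epsilon>)"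
    using eps r by (intro rpow_sum_le) auto
  also have "(\<Sum>k\<le>M. rpow (cmod (taylor_coeff P x k) * r ^ k) \<epsilon>) = (\<Sum>k\<le>M. b k * r powr (real k * \<epsilon>))"
    using r by (simp add: b_def rpow_mult rpow_eq_powr powr_powr flip: powr_realpow)
  finally have Pz: "rpow (cmod (poly P z)) \<epsilon> \<le> rpow (real M + 1) \<epsilon> * (\<Sum>k\<le>M. b k * r powr (real k * \<epsilon>))"
    by (simp add: add.commute)
  have key: "r powr (real k * \<epsilon>) / g powr \<delta> \<le> (\<Sum>w\<in>Z. G k (d x w) * scale_kernel \<eta> (d x w) (z - x))"
    if k: "k \<le> M" for k
  proof -
    have "\<exists>D\<in>insert 2 ((\<lambda>z. cmod (x - z)) ` (Z - {x})). G k r \<le> G k D * min (r / D) (D / r) powr \<eta>"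
      unfolding G_def
    proof (rule scale_weight_le)
      show "cmod (x - z) < 2" if "z \<in> Z" for z using Z_close[OF x(1) that] by simp
      show "real k * \<epsilon> + 2 - \<delta> > 0" using eps del mult_nonneg_nonneg[of "real k" \<epsilon>] by linarith
    qed (use Z x r r2 eta k in auto)
    moreover have "insert 2 ((\<lambda>z. cmod (x - z)) ` (Z - {x})) = d x ` Z"
      using x(1) by (auto simp: d_def)
    ultimately obtain w where w: "w \<in> Z" "G k r \<le> G k (d x w) * min (r / d x w) (d x w / r) powr \<eta>"
      by auto
    have "r powr (real k * \<epsilon>) / g powr \<delta> = G k r / r ^ 2"
      using r g by (simp add: G_def scale_weight_def powr_add flip: g_def)
    also have "\<dots> \<le> (G k (d x w) * min (r / d x w) (d x w / r) powr \<eta>) / r ^ 2"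
      using w(2) by (intro divide_right_mono) auto
    also have "\<dots> = G k (d x w) * scale_kernel \<eta> (d x w) (z - x)"
      by (simp add: scale_kernel_def r_def)
    also have "\<dots> \<le> (\<Sum>w\<in>Z. G k (d x w) * scale_kernel \<eta> (d x w) (z - x))"
      using w(1) Z(1)
      by (intro member_le_sum[of w Z "\<lambda>w. G k (d x w) * scale_kernel \<eta> (d x w) (z - x)"])
         (auto simp: G_def scale_kernel_nonneg scale_weight_nonneg)
    finally show ?thesis .
  qed
  have "rpow (cmod (poly P z)) \<epsilon> / rpow (cmod (poly Q z)) \<delta> \<le>
      (rpow (real M + 1) \<epsilon> * (\<Sum>k\<le>M. b k * r powr (real k * \<epsilon>))) * (rpow (2 * 2 ^ card Z) \<delta> / g powr \<delta>)"
    using mult_mono[OF Pz Qinv] order_trans[OF _ Pz] by simp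
  also have "\<dots> = rpow (2 * 2 ^ card Z) \<delta> * rpow (real M + 1) \<epsilon> *
      (\<Sum>k\<le>M. b k * (r powr (real k * \<epsilon>) / g powr \<delta>))"
    by (simp add: sum_distrib_left sum_distrib_right sum_divide_distrib mult_ac)
  also have "\<dots> \<le> rpow (2 * 2 ^ card Z) \<delta> * rpow (real M + 1) \<epsilon> *
      (\<Sum>k\<le>M. b k * (\<Sum>w\<in>Z. G k (d x w) * scale_kernel \<eta> (d x w) (z - x)))"
    using key by (intro mult_left_mono sum_mono mult_nonneg_nonneg) (auto simp: b_def)
  also have "(\<Sum>k\<le>M. b k * (\<Sum>w\<in>Z. G k (d x w) * scale_kernel \<eta> (d x w) (z - x)))
     \<le> (\<Sum>x\<in>Z. \<Sum>k\<le>M. rpow (cmod (taylor_coeff P x k)) \<epsilon> * (\<Sum>w\<in>Z.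
       scale_weight (real k * \<epsilon> + 2) \<delta> Z x (d x w) * scale_kernel \<eta> (d x w) (z - x)))"
    unfolding b_def G_def using x(1) Z(1)
    by (intro member_le_sum[of x Z "\<lambda>x. \<Sum>k\<le>M. rpow (cmod (taylor_coeff P x k)) \<epsilon> * (\<Sum>w\<in>Z.
       scale_weight (real k * \<epsilon> + 2) \<delta> Z x (d x w) * scale_kernel \<eta> (d x w) (z - x))"])
       (auto intro!: sum_nonneg mult_nonneg_nonneg scale_weight_nonneg scale_kernel_nonneg)
  also have "\<dots> = (\<Sum>(x, k, w)\<in>Z \<times> {..M} \<times> Z. rpow (cmod (taylor_coeff P x k)) \<epsilon> *
       scale_weight (real k * \<epsilon> + 2) \<delta> Z x (d x w) * scale_kernel \<eta> (d x w) (z - x))"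
    by (simp add: sum.cartesian_product[symmetric] sum_distrib_left mult.assoc)
  finally show ?thesis by (simp add: mult_left_mono)
qed

text \<open>The kernels have uniformly bounded mass, so only the sum of the weights remains. At the
  outer scale 2 the gauge is 2^card Z >= 1, so the weight there is at most 2^(M\<epsilon> +
  2).\<close>

lemma weighted_integral_le:
  assumes eta: "\<eta> > 0" "\<And>k j. k \<le> M \<Longrightarrow> j \<in> {1..card Z} \<Longrightarrow> \<eta> \<le> \<bar>real k * \<epsilon> + 2 - real j * \<delta>\<bar>"
  shows "weighted_integral \<epsilon> \<delta> P Q \<le> ennreal (8 * pi / (1 - 2 powr (- \<eta>)) *
    (rpow (2 * 2 ^ card Z) \<delta> * rpow (real M + 1) \<epsilon>) * 2 powr (real M * \<epsilon> + 2) * root_sum \<epsilon> \<delta> M P Z)"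
proof -
  define d where "d = (\<lambda>x w. if w = x then 2 else cmod (x - w))"
  define C where "C = rpow (2 * 2 ^ card Z) \<delta> * rpow (real M + 1) \<epsilon>"
  define C' where "C' = 8 * pi / (1 - 2 powr (- \<eta>))"
  define E where "E = 2 powr (real M * \<epsilon> + 2)"
  define b where "b = (\<lambda>x k. rpow (cmod (taylor_coeff P x k)) \<epsilon>)"
  define G where "G = (\<lambda>x k. scale_weight (real k * \<epsilon> + 2) \<delta> Z x)"
  define J where "J = Z \<times> {..M} \<times> Z"
  define c where "c = (\<lambda>(x, k, w). C * (b x k * G x k (d x w)))"
  have C: "C \<ge> 0" by (simp add: C_def)
  have "2 powr (- \<eta>) < 1" using eta by (simp add: powr_less_one)
  hence C': "C' \<ge> 0" by (simp add: C'_def)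
  have E: "E \<ge> 1" unfolding E_def using eps by (intro ge_one_powr_ge_zero) auto
  have "weighted_integral \<epsilon> \<delta> P Q \<le>
      (\<integral>\<^sup>+z. ennreal (\<Sum>j\<in>J. c j * scale_kernel \<eta> (d (fst j) (snd (snd j))) (z - fst j)) \<partial>lborel)"
    unfolding weighted_integral_def
  proof (rule nn_integral_mono_AE, use AE_not_root in eventually_elim)
    fix z assume z: "z \<notin> Z"
    show "indicator (ball 0 1) z * ennreal (rpow (cmod (poly P z)) \<epsilon> / rpow (cmod (poly Q z)) \<delta>)
      \<le> ennreal (\<Sum>j\<in>J. c j * scale_kernel \<eta> (d (fst j) (snd (snd j))) (z - fst j))"
    proof (cases "z \<in> ball 0 1")
      case True
      hence "rpow (cmod (poly P z)) \<epsilon> / rpow (cmod (poly Q z)) \<delta> \<le>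
          C * (\<Sum>(x, k, w)\<in>J. b x k * G x k (d x w) * scale_kernel \<eta> (d x w) (z - x))"
        using integrand_le[OF eta z] unfolding C_def J_def b_def G_def d_def by simp
      also have "\<dots> = (\<Sum>j\<in>J. c j * scale_kernel \<eta> (d (fst j) (snd (snd j))) (z - fst j))"
        by (simp add: c_def sum_distrib_left case_prod_beta mult_ac)
      finally show ?thesis using True by (simp add: ennreal_leI)
    qed simp
  qed
  also have "\<dots> \<le> ennreal (C' * (\<Sum>j\<in>J. c j))"
    unfolding C'_def
  proof (rule nn_integral_sum_scale_kernel_le[OF eta(1)])
    show "finite J" using Z by (simp add: J_def)
    show "0 \<le> c j" for j
      using C by (auto simp: c_def b_def G_def case_prod_beta intro!: mult_nonneg_nonneg scale_weight_nonneg)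
    show "0 < d (fst j) (snd (snd j))" for j by (simp add: d_def)
  qed
  also have "\<dots> \<le> ennreal (C' * (C * (E * root_sum \<epsilon> \<delta> M P Z)))"
  proof (intro ennreal_leI mult_left_mono C')
    have "(\<Sum>j\<in>J. c j) = C * (\<Sum>x\<in>Z. \<Sum>k\<le>M. b x k * (\<Sum>w\<in>Z. G x k (d x w)))"
      by (simp add: J_def c_def sum.cartesian_product[symmetric] sum_distrib_left)
    also have "\<dots> \<le> C * (\<Sum>x\<in>Z. \<Sum>k\<le>M. b x k * (E * (1 + (\<Sum>w\<in>Z - {x}. G x k (cmod (x - w))))))"
    proof (intro mult_left_mono sum_mono C)
      fix x k assume x: "x \<in> Z" and k: "k \<in> {..M}"
      have "G x k 2 \<le> E"
      proof -
        have "G x k 2 = 2 powr (real k * \<epsilon> + 2) / (2 ^ card Z) powr \<delta>"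
          using root_gauge_large[OF x, of 2] by (simp add: G_def scale_weight_def)
        also have "\<dots> \<le> 2 powr (real k * \<epsilon> + 2) / 1"
          using del by (intro divide_left_mono ge_one_powr_ge_zero) auto
        also have "\<dots> \<le> E"
          unfolding E_def using k eps by (simp add: mult_right_mono)
        finally show ?thesis .
      qed
      moreover have "(\<Sum>w\<in>Z - {x}. G x k (cmod (x - w))) \<le> E * (\<Sum>w\<in>Z - {x}. G x k (cmod (x - w)))"
        using mult_right_mono[OF E, of "\<Sum>w\<in>Z - {x}. G x k (cmod (x - w))"]
        by (simp add: G_def sum_nonneg scale_weight_nonneg)
      moreover have "(\<Sum>w\<in>Z. G x k (d x w)) = G x k 2 + (\<Sum>w\<in>Z - {x}. G x k (cmod (x - w)))"
        using Z(1) x by (subst sum.remove[of _ x]) (auto simp: d_def intro!: sum.cong)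
      ultimately show "(\<Sum>w\<in>Z. G x k (d x w)) \<le> E * (1 + (\<Sum>w\<in>Z - {x}. G x k (cmod (x - w))))"
        by (simp add: distrib_left)
    qed (simp add: b_def)
    also have "\<dots> = C * (E * root_sum \<epsilon> \<delta> M P Z)"
      by (simp add: root_sum_def b_def G_def sum_distrib_left mult_ac)
    finally show "(\<Sum>j\<in>J. c j) \<le> C * (E * root_sum \<epsilon> \<delta> M P Z)" .
  qed
  finally show ?thesis by (simp add: C_def C'_def E_def mult_ac)
qed

text \<open>Each term is tested by \<open>weight_le_integral\<close>: with r = |x - w| for the
  weights and with r = 1/2 for the summand 1. The divisor counts the terms.\<close>

lemma root_sum_le_weighted_integral:
  assumes fin: "weighted_integral \<epsilon> \<delta> P Q < \<infinity>"
  defines "c \<equiv> 1 / ((2 * real M + 3) ^ M * (2 * (real M + 1)) ^ M)"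
  defines "K \<equiv> rpow (c / 2) \<epsilon> * pi * (c / (2 * (real M + 1))) ^ 2 / rpow (2 * 2 ^ card Z) \<delta>"
  shows "ennreal (root_sum \<epsilon> \<delta> M P Z /
      (real (card Z) * (real M + 1) * (2 powr (real M * \<epsilon> + 2) + real (card Z)) / K)) \<le> weighted_integral \<epsilon> \<delta> P Q"
proof -
  define i where "i = enn2real (weighted_integral \<epsilon> \<delta> P Q)"
  have i: "weighted_integral \<epsilon> \<delta> P Q = ennreal i" "i \<ge> 0"
    using fin by (simp_all add: i_def)
  have c: "c > 0" by (simp add: c_def add_nonneg_pos)
  have K: "K > 0"
    unfolding K_def using c by (intro divide_pos_pos mult_pos_pos rpow_pos) (auto simp: add_nonneg_pos)
  define b where "b = (\<lambda>x k. rpow (cmod (taylor_coeff P x k)) \<epsilon>)"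
  define G where "G = (\<lambda>x k. scale_weight (real k * \<epsilon> + 2) \<delta> Z x)"
  define E where "E = 2 powr (real M * \<epsilon> + 2)"
  define n where "n = card Z"
  have b: "b x k \<ge> 0" for x k by (simp add: b_def)
  have bG: "b x k * G x k r \<le> i / K" if "x \<in> Z" "k \<le> M" "0 < r" "r \<le> 1 / 2" for x k r
  proof -
    have "ennreal (K * (b x k * G x k r)) \<le> ennreal i"
      using weight_le_integral[OF that(1,3,4,2)] unfolding i(1) K_def c_def b_def G_def .
    hence "K * (b x k * G x k r) \<le> i" using i(2) by (simp add: ennreal_le_iff)
    thus ?thesis using K by (simp add: field_simps)
  qed
  \<comment> \<open>At r = 1/2 the gauge is (1/2)^n <= 1, so the weight there is at least
    1/E.\<close>
  have b_le: "b x k \<le> E * (i / K)" if x: "x \<in> Z" and k: "k \<le> M" for x k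
  proof -
    have "1 / E = (1 / 2) powr (real M * \<epsilon> + 2)"
      by (simp add: E_def powr_divide)
    also have "\<dots> \<le> (1 / 2) powr (real k * \<epsilon> + 2)"
      using k eps by (intro powr_mono') (auto simp: mult_right_mono)
    also have "\<dots> = (1 / 2) powr (real k * \<epsilon> + 2) / 1" by simp
    also have "\<dots> \<le> (1 / 2) powr (real k * \<epsilon> + 2) / ((1 / 2) ^ n) powr \<delta>"
      using del by (intro divide_left_mono powr_le1) (auto simp: power_le_one)
    also have "\<dots> = G x k (1 / 2)"
      using root_gauge_large[OF x, of "1 / 2"] by (simp add: G_def scale_weight_def n_def)
    finally have "1 \<le> E * G x k (1 / 2)" by (simp add: E_def field_simps)
    hence "b x k * 1 \<le> b x k * (E * G x k (1 / 2))" using b by (rule mult_left_mono)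
    also have "\<dots> = E * (b x k * G x k (1 / 2))" by simp
    also have "\<dots> \<le> E * (i / K)" using bG[OF x k] by (intro mult_left_mono) (auto simp: E_def)
    finally show ?thesis by simp
  qed
  have "root_sum \<epsilon> \<delta> M P Z = (\<Sum>x\<in>Z. \<Sum>k\<le>M. b x k + (\<Sum>w\<in>Z - {x}. b x k * G x k (cmod (x - w))))"
    by (simp add: root_sum_def b_def G_def distrib_left sum_distrib_left)
  also have "\<dots> \<le> (\<Sum>x\<in>Z. \<Sum>k\<le>M. E * (i / K) + real n * (i / K))"
  proof (intro sum_mono add_mono b_le)
    fix x k assume x: "x \<in> Z" and k: "k \<in> {..M}"
    have "(\<Sum>w\<in>Z - {x}. b x k * G x k (cmod (x - w))) \<le> (\<Sum>w\<in>Z - {x}. i / K)"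
      using x k Z_close[OF x] by (intro sum_mono bG) (auto intro: less_imp_le)
    also have "\<dots> \<le> (\<Sum>w\<in>Z. i / K)"
      using Z(1) i K by (intro sum_mono2) auto
    finally show "(\<Sum>w\<in>Z - {x}. b x k * G x k (cmod (x - w))) \<le> real n * (i / K)"
      by (simp add: n_def)
  qed auto
  also have "\<dots> = (real n * (real M + 1) * (E + real n) / K) * i"
    by (simp add: n_def algebra_simps add_divide_distrib)
  finally have "root_sum \<epsilon> \<delta> M P Z \<le> (real n * (real M + 1) * (E + real n) / K) * i" .
  moreover have "0 < real n * (real M + 1) * (E + real n) / K"
    using Z K
    by (intro divide_pos_pos mult_pos_pos add_pos_nonneg[of E] add_nonneg_pos[of "real M"])
       (auto simp: n_def E_def card_gt_0_iff)
  ultimately have "root_sum \<epsilon> \<delta> M P Z / (real n * (real M + 1) * (E + real n) / K) \<le> i"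
    by (simp only: pos_divide_le_eq mult.commute)
  thus ?thesis unfolding i(1) n_def E_def by (rule ennreal_leI)
qed

end

text \<open>The constants are built from M, N, \<epsilon>, \<delta>, \<eta> before any polynomial is
  chosen. The upper bound comes first because it supplies the finiteness assumed by the lower
  one.\<close>

theorem weighted_integral_comparable:
  fixes \<epsilon> \<delta> \<eta> :: real and M N :: nat
  assumes eta: "\<eta> > 0" "\<And>k j. k \<le> M \<Longrightarrow> j \<in> {1..N} \<Longrightarrow> \<eta> \<le> \<bar>real k * \<epsilon> + 2 - real j * \<delta>\<bar>"
    and N: "N > 0"
  shows "\<exists>C>0. \<forall>P Q Z a. small_roots \<epsilon> \<delta> M P Q Z a \<and> card Z = N \<longrightarrow>
    weighted_integral \<epsilon> \<delta> P Q \<le> ennreal (C * root_sum \<epsilon> \<delta> M P Z) \<and>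
    ennreal (root_sum \<epsilon> \<delta> M P Z / C) \<le> weighted_integral \<epsilon> \<delta> P Q"
proof -
  define C1 where "C1 = 8 * pi / (1 - 2 powr (- \<eta>)) *
    (rpow (2 * 2 ^ N) \<delta> * rpow (real M + 1) \<epsilon>) * 2 powr (real M * \<epsilon> + 2)"
  define c where "c = 1 / ((2 * real M + 3) ^ M * (2 * (real M + 1)) ^ M)"
  define K where "K = rpow (c / 2) \<epsilon> * pi * (c / (2 * (real M + 1))) ^ 2 / rpow (2 * 2 ^ N) \<delta>"
  define C2 where "C2 = real N * (real M + 1) * (2 powr (real M * \<epsilon> + 2) + real N) / K"
  have c: "c > 0" by (simp add: c_def add_nonneg_pos)
  have "K > 0"
    unfolding K_def using c by (intro divide_pos_pos mult_pos_pos rpow_pos) (auto simp: add_nonneg_pos)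
  hence C2: "C2 > 0"
    unfolding C2_def using N
    by (intro divide_pos_pos mult_pos_pos add_pos_nonneg[of "2 powr _"] add_nonneg_pos[of "real M"]) auto
  have "2 powr (- \<eta>) < 1" using eta by (simp add: powr_less_one)
  hence C1: "C1 \<ge> 0" by (simp add: C1_def)
  show ?thesis
  proof (intro exI[of _ "C1 + C2"] conjI allI impI)
    fix P Q Z a assume *: "small_roots \<epsilon> \<delta> M P Q Z a \<and> card Z = N"
    then interpret small_roots \<epsilon> \<delta> M P Q Z a by simp
    have N': "card Z = N" using * by simp
    have H: "root_sum \<epsilon> \<delta> M P Z \<ge> 0"
      by (auto simp: root_sum_def intro!: sum_nonneg mult_nonneg_nonneg add_nonneg_nonneg scale_weight_nonneg)
    have "weighted_integral \<epsilon> \<delta> P Q \<le> ennreal (C1 * root_sum \<epsilon> \<delta> M P Z)"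
      using weighted_integral_le[of \<eta>] eta unfolding C1_def N' by blast
    also have "\<dots> \<le> ennreal ((C1 + C2) * root_sum \<epsilon> \<delta> M P Z)"
      using C2 H by (intro ennreal_leI mult_right_mono) auto
    finally show 1: "weighted_integral \<epsilon> \<delta> P Q \<le> ennreal ((C1 + C2) * root_sum \<epsilon> \<delta> M P Z)" .
    have "ennreal (root_sum \<epsilon> \<delta> M P Z / (C1 + C2)) \<le> ennreal (root_sum \<epsilon> \<delta> M P Z / C2)"
      using C1 C2 H by (intro ennreal_leI divide_left_mono) auto
    also have "\<dots> \<le> weighted_integral \<epsilon> \<delta> P Q"
      using root_sum_le_weighted_integral 1 unfolding C2_def K_def c_def N'
      by (simp add: le_less_trans)
    finally show "ennreal (root_sum \<epsilon> \<delta> M P Z / (C1 + C2)) \<le> weighted_integral \<epsilon> \<delta> P Q" .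
  qed (use C1 C2 in auto)
qed

section \<open>Integer polynomials\<close>

definition ipoly_functions :: "nat \<Rightarrow> ((nat \<Rightarrow> complex) \<Rightarrow> complex) set" where
  "ipoly_functions n = range (ipoly_eval n)"

lemma ipoly_functionsI: "(\<And>x. f x = ipoly_eval n p x) \<Longrightarrow> f \<in> ipoly_functions n"
  unfolding ipoly_functions_def by (metis ext rangeI)

lemma ipoly_functions_of_int: "(\<lambda>_. of_int c) \<in> ipoly_functions n"
  by (rule ipoly_functionsI[of _ _ "[(c, \<lambda>_. 0)]"]) (simp add: ipoly_eval_def)

lemma ipoly_functions_var:
  assumes "i < n"
  shows "(\<lambda>x. x i) \<in> ipoly_functions n"
proof (rule ipoly_functionsI[of _ _ "[(1, \<lambda>j. if j = i then 1 else 0)]"])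
  fix x :: "nat \<Rightarrow> complex"
  have "(\<Prod>j<n. x j ^ (if j = i then 1 else 0)) = (\<Prod>j<n. if j = i then x j else 1)"
    by (intro prod.cong) auto
  also have "\<dots> = x i" using assms by (simp add: prod.delta)
  finally show "x i = ipoly_eval n [(1, \<lambda>j. if j = i then 1 else 0)] x"
    by (simp add: ipoly_eval_def)
qed

lemma ipoly_eval_append: "ipoly_eval n (p @ q) x = ipoly_eval n p x + ipoly_eval n q x"
  by (simp add: ipoly_eval_def)

lemma ipoly_functions_add:
  assumes "f \<in> ipoly_functions n" "g \<in> ipoly_functions n"
  shows "(\<lambda>x. f x + g x) \<in> ipoly_functions n"
proof -
  obtain p q where "f = ipoly_eval n p" "g = ipoly_eval n q"
    using assms by (auto simp: ipoly_functions_def)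
  thus ?thesis by (intro ipoly_functionsI[of _ _ "p @ q"]) (simp add: ipoly_eval_append)
qed

lemma ipoly_functions_mult:
  assumes "f \<in> ipoly_functions n" "g \<in> ipoly_functions n"
  shows "(\<lambda>x. f x * g x) \<in> ipoly_functions n"
proof -
  obtain p q where pq: "f = ipoly_eval n p" "g = ipoly_eval n q"
    using assms by (auto simp: ipoly_functions_def)
  define m where "m = (\<lambda>(c, e) (d, e'). (c * d :: int, \<lambda>i::nat. e i + e' i :: nat))"
  have mono: "ipoly_eval n (map (m t) q) x = ipoly_eval n [t] x * ipoly_eval n q x" for t q x
    by (induction q)
       (auto simp: ipoly_eval_def m_def case_prod_beta power_add prod.distrib algebra_simps)
  have "ipoly_eval n p x * ipoly_eval n q x = ipoly_eval n (concat (map (\<lambda>t. map (m t) q) p)) x" for x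
  proof (induction p)
    case Nil
    thus ?case by (simp add: ipoly_eval_def)
  next
    case (Cons t p)
    have "ipoly_eval n (t # p) x = ipoly_eval n [t] x + ipoly_eval n p x"
      using ipoly_eval_append[of n "[t]" p x] by simp
    thus ?case using Cons mono[of t q x] by (simp add: ipoly_eval_append distrib_right)
  qed
  thus ?thesis unfolding pq by (rule ipoly_functionsI)
qed

lemma ipoly_functions_power: "f \<in> ipoly_functions n \<Longrightarrow> (\<lambda>x. f x ^ k) \<in> ipoly_functions n"
  using ipoly_functions_of_int[of 1 n] by (induction k) (auto intro: ipoly_functions_mult)

text \<open>The ring Q[X, 1/x_j] as functions: \<open>c\<close> and \<open>D\<close> record the
  denominators that Newton's identities create. Values where x_j = 0 are left free.\<close>

definition ipoly_localization :: "nat \<Rightarrow> nat \<Rightarrow> ((nat \<Rightarrow> complex) \<Rightarrow> complex) set" where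
  "ipoly_localization n j = {f. \<exists>c D. \<exists>p\<in>ipoly_functions n. c > 0 \<and>
     (\<forall>x. x j \<noteq> 0 \<longrightarrow> of_nat c * x j ^ D * f x = p x)}"

lemma ipoly_localizationI:
  assumes "p \<in> ipoly_functions n" "c > 0" "\<And>x. x j \<noteq> 0 \<Longrightarrow> of_nat c * x j ^ D * f x = p x"
  shows "f \<in> ipoly_localization n j"
  unfolding ipoly_localization_def using assms by blast

lemma ipoly_functions_localization: "f \<in> ipoly_functions n \<Longrightarrow> f \<in> ipoly_localization n j"
  by (rule ipoly_localizationI[of f n 1 j 0 f]) auto

lemma function_ring_ipoly_localization:
  assumes j: "j < n"
  shows "function_ring (ipoly_localization n j) {x. x j \<noteq> 0} (\<lambda>x. x j)"
proof
  have var: "(\<lambda>x. x j) \<in> ipoly_functions n" using j by (rule ipoly_functions_var)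
  have nat: "(\<lambda>_. of_nat c) \<in> ipoly_functions n" for c
    using ipoly_functions_of_int[of "int c" n] by simp
  show "(\<lambda>_. of_int m) \<in> ipoly_localization n j" for m
    by (intro ipoly_functions_localization ipoly_functions_of_int)
  show "(\<lambda>x. x j) \<in> ipoly_localization n j"
    by (intro ipoly_functions_localization var)
  fix f g assume "f \<in> ipoly_localization n j" "g \<in> ipoly_localization n j"
  then obtain c D p c' D' p' where p: "p \<in> ipoly_functions n" "c > 0"
      "\<And>x. x j \<noteq> 0 \<Longrightarrow> of_nat c * x j ^ D * f x = p x"
    and p': "p' \<in> ipoly_functions n" "c' > 0"
      "\<And>x. x j \<noteq> 0 \<Longrightarrow> of_nat c' * x j ^ D' * g x = p' x"
    unfolding ipoly_localization_def by blast
  have "(\<lambda>x. of_nat c' * x j ^ D' * p x + of_nat c * x j ^ D * p' x) \<in> ipoly_functions n"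
    by (intro ipoly_functions_add ipoly_functions_mult ipoly_functions_power nat var p p')
  thus "(\<lambda>y. f y + g y) \<in> ipoly_localization n j"
    by (rule ipoly_localizationI[of _ _ "c * c'" _ "D + D'"])
       (use p(2) p'(2) in \<open>auto simp: p(3)[symmetric] p'(3)[symmetric] power_add algebra_simps\<close>)
  have "(\<lambda>x. p x * p' x) \<in> ipoly_functions n"
    by (intro ipoly_functions_mult p p')
  thus "(\<lambda>y. f y * g y) \<in> ipoly_localization n j"
    by (rule ipoly_localizationI[of _ _ "c * c'" _ "D + D'"])
       (use p(2) p'(2) in \<open>auto simp: p(3)[symmetric] p'(3)[symmetric] power_add algebra_simps\<close>)
next
  fix f g assume f: "f \<in> ipoly_localization n j" and "\<And>y. y \<in> {x. x j \<noteq> 0} \<Longrightarrow> g y = f y"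
  thus "g \<in> ipoly_localization n j"
    unfolding ipoly_localization_def by simp
next
  fix m f assume "(\<lambda>y. of_nat (Suc m) * f y) \<in> ipoly_localization n j"
  then obtain c D p where p: "p \<in> ipoly_functions n" "c > 0"
      "\<And>x. x j \<noteq> 0 \<Longrightarrow> of_nat c * x j ^ D * (of_nat (Suc m) * f x) = p x"
    unfolding ipoly_localization_def by blast
  show "f \<in> ipoly_localization n j"
  proof (rule ipoly_localizationI[OF p(1)])
    show "of_nat (c * Suc m) * x j ^ D * f x = p x" if "x j \<noteq> 0" for x
      using p(3)[of x] that by (simp add: algebra_simps)
  qed (use p in auto)
next
  fix f assume "(\<lambda>y. y j * f y) \<in> ipoly_localization n j"
  then obtain c D p where p: "p \<in> ipoly_functions n" "c > 0"
      "\<And>x. x j \<noteq> 0 \<Longrightarrow> of_nat c * x j ^ D * (x j * f x) = p x"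
    unfolding ipoly_localization_def by blast
  show "f \<in> ipoly_localization n j"
  proof (rule ipoly_localizationI[OF p(1,2)])
    show "of_nat c * x j ^ Suc D * f x = p x" if "x j \<noteq> 0" for x
      using p(3)[of x] that by (simp add: mult_ac)
  qed
qed auto

section \<open>From localized polynomials back to integer polynomials and ARPs\<close>

lemma comparable_on_root:
  assumes "comparable_on D (\<lambda>y. f y ^ p) (\<lambda>y. g y ^ p)" "p > 0"
    "\<And>y. y \<in> D \<Longrightarrow> 0 \<le> f y" "\<And>y. y \<in> D \<Longrightarrow> 0 \<le> g y"
  shows "comparable_on D f g"
proof -
  obtain C where C: "C > 0" "\<And>y. y \<in> D \<Longrightarrow> f y ^ p \<le> C * g y ^ p"
    "\<And>y. y \<in> D \<Longrightarrow> g y ^ p \<le> C * f y ^ p"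
    using assms(1) by (elim comparable_onE) blast
  \<comment> \<open>This replaces a p-th root of C: B >= 1 gives C <= B <= B^p.\<close>
  define B where "B = max 1 C"
  have B: "C \<le> B ^ p" "B \<ge> 0"
  proof -
    have "B ^ 1 \<le> B ^ p" using assms(2) by (intro power_increasing) (auto simp: B_def)
    thus "C \<le> B ^ p" by (simp add: B_def)
  qed (simp add: B_def)
  have *: "a \<le> B * b" if "a ^ p \<le> C * b ^ p" "0 \<le> a" "0 \<le> b" for a b :: real
  proof -
    have "a ^ p \<le> B ^ p * b ^ p"
      using that B by (meson mult_right_mono order_trans zero_le_power)
    hence "a ^ p \<le> (B * b) ^ p" by (simp add: power_mult_distrib)
    thus ?thesis using that B assms(2) by (simp add: power_mono_iff)
  qed
  show ?thesis
    by (rule comparable_onI2[of B B]) (use * B C assms in auto)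
qed

lemma comparable_on_power_sum_list:
  assumes "m > 0" "\<And>x y. x \<in> set xs \<Longrightarrow> y \<in> D \<Longrightarrow> 0 \<le> h x y"
  shows "comparable_on D (\<lambda>y. (\<Sum>x\<leftarrow>xs. h x y) ^ m) (\<lambda>y. \<Sum>x\<leftarrow>xs. h x y ^ m)"
  using comparable_on_power_sum[of "{0..<length xs}" m D "\<lambda>i. h (xs ! i)"] assms
  by (simp add: sum_list_sum_nth)

text \<open>Clearing denominators multiplies p by c x_j^E, whose modulus on \<open>D\<close> lies
  between 2^(-E) and c 2^E.\<close>

lemma ex_ipolys_comparable:
  assumes ps: "set ps \<subseteq> ipoly_localization n j"
    and D: "\<And>x. x \<in> D \<Longrightarrow> 1 / 2 \<le> cmod (x j) \<and> cmod (x j) \<le> 2"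
  shows "\<exists>Ps. comparable_on D (\<lambda>y. \<Sum>p\<leftarrow>ps. cmod (p y)) (\<lambda>y. \<Sum>P\<leftarrow>Ps. cmod (ipoly_eval n P y))"
  using ps
proof (induction ps)
  case Nil
  thus ?case by (intro exI[of _ "[]"]) (auto intro: comparable_on_refl)
next
  case (Cons p ps)
  then obtain Ps where Ps: "comparable_on D (\<lambda>y. \<Sum>p\<leftarrow>ps. cmod (p y)) (\<lambda>y. \<Sum>P\<leftarrow>Ps. cmod (ipoly_eval n P y))"
    by auto
  obtain c E P where P: "c > 0" "\<And>x. x j \<noteq> 0 \<Longrightarrow> of_nat c * x j ^ E * p x = ipoly_eval n P x"
    using Cons.prems unfolding ipoly_localization_def ipoly_functions_def by auto
  have eq: "cmod (ipoly_eval n P x) = real c * cmod (x j) ^ E * cmod (p x)" if "x \<in> D" for x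
  proof -
    have "x j \<noteq> 0" using D[OF that] by auto
    hence "ipoly_eval n P x = of_nat c * x j ^ E * p x" using P(2)[of x] by simp
    thus ?thesis by (simp add: norm_mult norm_power)
  qed
  have "comparable_on D (\<lambda>y. cmod (p y)) (\<lambda>y. cmod (ipoly_eval n P y))"
  proof (rule comparable_onI2[of "2 ^ E" "real c * 2 ^ E"])
    fix x assume x: "x \<in> D"
    have "(1 / 2) ^ E \<le> cmod (x j) ^ E" "cmod (x j) ^ E \<le> 2 ^ E"
      using D[OF x] by (auto intro!: power_mono)
    moreover have "1 \<le> real c" using P(1) by simp
    ultimately show "cmod (ipoly_eval n P x) \<le> real c * 2 ^ E * cmod (p x)"
      unfolding eq[OF x] by (intro mult_right_mono mult_left_mono) auto
    have "1 * cmod (p x) \<le> (real c * (2 * cmod (x j)) ^ E) * cmod (p x)"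
    proof (rule mult_right_mono)
      have "1 \<le> (2 * cmod (x j)) ^ E" using D[OF x] by (intro one_le_power) auto
      thus "1 \<le> real c * (2 * cmod (x j)) ^ E"
        using \<open>1 \<le> real c\<close> mult_mono[of 1 "real c" 1] by simp
    qed simp
    thus "cmod (p x) \<le> 2 ^ E * cmod (ipoly_eval n P x)"
      unfolding eq[OF x] by (simp add: power_mult_distrib mult_ac)
  qed auto
  from comparable_on_add[OF this Ps] show ?case
    by (intro exI[of _ "P # Ps"]) simp
qed

text \<open>Squaring turns sums of norms into sums of squared norms up to constants, so h^(2m) is
  comparable to A/B; the exponents 1/m of \<open>T\<close>, halved in the definition of an ARP, undo
  this. Positivity of h at a point of \<open>D\<close> exhibits a numerator polynomial that is
  nonzero there.\<close>

lemma arp_like_imp_ARP: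
  assumes h: "h \<in> arp_like (ipoly_localization n j) D" "D \<noteq> {}" "\<And>x. x \<in> D \<Longrightarrow> 0 < h x"
    and D: "\<And>x. x \<in> D \<Longrightarrow> 1 / 2 \<le> cmod (x j) \<and> cmod (x j) \<le> 2"
  shows "\<exists>T. is_ARP n T \<and> D \<subseteq> arp_strict_domain n T \<and> comparable_on D h (arp_val n T)"
  using h(1)
proof (elim arp_likeE)
  fix m k l
  assume *: "m > 0" "k \<in> norm_sums (ipoly_localization n j) D" "l \<in> norm_sums (ipoly_localization n j) D"
    "\<And>y. y \<in> D \<Longrightarrow> 0 < l y" "comparable_on D (\<lambda>y. h y ^ m) (\<lambda>y. k y / l y)"
  have ex: "\<exists>Ps. comparable_on D (\<lambda>y. f y ^ 2) (\<lambda>y. \<Sum>P\<leftarrow>Ps. cmod (ipoly_eval n P y) ^ 2)"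
    if f: "f \<in> norm_sums (ipoly_localization n j) D" for f
  proof -
    obtain ps where ps: "set ps \<subseteq> ipoly_localization n j" "comparable_on D f (\<lambda>y. \<Sum>p\<leftarrow>ps. cmod (p y))"
      using f by (auto simp: norm_sums_def)
    obtain Ps where "comparable_on D (\<lambda>y. \<Sum>p\<leftarrow>ps. cmod (p y)) (\<lambda>y. \<Sum>P\<leftarrow>Ps. cmod (ipoly_eval n P y))"
      using ex_ipolys_comparable[of ps n j D] ps(1) D by blast
    from comparable_on_power[OF comparable_on_trans[OF ps(2) this], of 2] show ?thesis
      by (intro exI[of _ Ps], elim comparable_on_trans) (rule comparable_on_power_sum_list, auto)
  qed
  obtain Ps where Ps: "comparable_on D (\<lambda>y. k y ^ 2) (\<lambda>y. \<Sum>P\<leftarrow>Ps. cmod (ipoly_eval n P y) ^ 2)"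
    using ex[OF *(2)] by blast
  obtain Qs where Qs: "comparable_on D (\<lambda>y. l y ^ 2) (\<lambda>y. \<Sum>P\<leftarrow>Qs. cmod (ipoly_eval n P y) ^ 2)"
    using ex[OF *(3)] by blast
  define A where "A = (\<lambda>y. \<Sum>P\<leftarrow>Ps. cmod (ipoly_eval n P y) ^ 2)"
  define B where "B = (\<lambda>y. \<Sum>P\<leftarrow>Qs. cmod (ipoly_eval n P y) ^ 2)"
  define T where "T = \<lparr>arp_num = Ps, arp_den = Qs, arp_num_exp = 1 / real m, arp_den_exp = 1 / real m\<rparr>"
  have k_pos: "0 < k y" if y: "y \<in> D" for y
    using comparable_on_pos[OF *(5) y] h(3)[OF y] *(4)[OF y] by (simp add: zero_less_divide_iff)
  have A: "0 < A y" if y: "y \<in> D" for y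
    using comparable_on_pos[OF Ps y] k_pos[OF y] by (simp add: A_def)
  have B: "0 < B y" if y: "y \<in> D" for y
    using comparable_on_pos[OF Qs y] *(4)[OF y] by (simp add: B_def)
  have KL: "arp_K n T y = A y powr (1 / (2 * real m))" "arp_L n T y = B y powr (1 / (2 * real m))" for y
    using *(1) by (simp_all add: arp_K_def arp_L_def T_def A_def B_def rpow_def mult.commute)
  have "comparable_on D (\<lambda>y. (h y ^ m) ^ 2) (\<lambda>y. (k y / l y) ^ 2)"
    by (rule comparable_on_power[OF *(5)])
  moreover have "comparable_on D (\<lambda>y. (k y / l y) ^ 2) (\<lambda>y. A y / B y)"
    unfolding power_divide A_def B_def by (intro comparable_on_divide Ps Qs zero_less_power *(4))
  ultimately have "comparable_on D (\<lambda>y. (h y ^ m) ^ 2) (\<lambda>y. A y / B y)"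
    by (rule comparable_on_trans)
  hence "comparable_on D (\<lambda>y. h y ^ (2 * m)) (\<lambda>y. arp_val n T y ^ (2 * m))"
  proof (rule comparable_on_cong)
    fix y assume y: "y \<in> D"
    show "(h y ^ m) ^ 2 = h y ^ (2 * m)" by (simp add: mult.commute flip: power_mult)
    have root: "(a powr (1 / (2 * real m))) ^ (2 * m) = a" if "a > 0" for a :: real
    proof -
      have "(a powr (1 / (2 * real m))) ^ (2 * m) = (a powr (1 / (2 * real m))) powr real (2 * m)"
        using that by (intro powr_realpow[symmetric]) simp
      thus ?thesis using that *(1) by (simp add: powr_powr)
    qed
    show "A y / B y = arp_val n T y ^ (2 * m)"
      unfolding arp_val_def KL power_divide root[OF A[OF y]] root[OF B[OF y]] ..
  qed
  hence 1: "comparable_on D h (arp_val n T)"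
    by (rule comparable_on_root) (use h(3) *(1) in \<open>auto simp: arp_val_def KL intro: less_imp_le\<close>)
  obtain y where y: "y \<in> D" using h(2) by blast
  have "\<exists>P\<in>set Ps. ipoly_eval n P y \<noteq> 0"
  proof (rule ccontr)
    assume "\<not> ?thesis"
    hence "A y = (\<Sum>P\<leftarrow>Ps. 0)"
      unfolding A_def by (intro arg_cong[where f = sum_list] map_cong) auto
    thus False using A[OF y] by simp
  qed
  hence 2: "is_ARP n T"
    by (auto simp: is_ARP_def T_def)
  have 3: "D \<subseteq> arp_strict_domain n T"
  proof
    fix x assume "x \<in> D"
    thus "x \<in> arp_strict_domain n T" using A[of x] B[of x] by (simp add: arp_strict_domain_def KL)
  qed
  show ?thesis using 1 2 3 by blast
qed

text \<open>A polynomial determines the multiset of its roots, which links an abstract enumeration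
  to a concrete set of roots.\<close>

lemma sum_roots_eq:
  fixes u :: "nat \<Rightarrow> complex" and h :: "complex \<Rightarrow> real"
  assumes eq: "smult a (\<Prod>i<n. [:- u i, 1:]) = smult a (\<Prod>w\<in>W. [:- w, 1:])" and "a \<noteq> 0" "finite W"
  shows "(\<Sum>i<n. h (u i)) = (\<Sum>w\<in>W. h w)"
proof -
  have *: "proots (smult a (\<Prod>i\<in>I. [:- v i, 1:])) = image_mset v (mset_set I)"
    if "finite I" for I :: "'i set" and v :: "'i \<Rightarrow> complex"
    using that
  proof (induction I rule: finite_induct)
    case empty
    thus ?case using \<open>a \<noteq> 0\<close> by simp
  next
    case (insert i I)
    have "(\<Prod>i\<in>I. [:- v i, 1:]) \<noteq> 0" using insert(1) by (auto simp: prod_zero_iff)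
    hence "proots ([:- v i, 1:] * (\<Prod>i\<in>I. [:- v i, 1:])) = {#v i#} + proots (\<Prod>i\<in>I. [:- v i, 1:])"
      by (subst proots_mult) auto
    moreover have "(\<Prod>i\<in>insert i I. [:- v i, 1:]) = [:- v i, 1:] * (\<Prod>i\<in>I. [:- v i, 1:])"
      using insert by (simp only: prod.insert not_False_eq_True)
    ultimately show ?case using insert \<open>a \<noteq> 0\<close> by simp
  qed
  have "image_mset u (mset_set {..<n}) = proots (smult a (\<Prod>i<n. [:- u i, 1:]))"
    by (rule *[symmetric]) simp
  also have "\<dots> = image_mset (\<lambda>w. w) (mset_set W)"
    unfolding eq by (rule *[OF \<open>finite W\<close>])
  finally have "image_mset h (image_mset u (mset_set {..<n})) = image_mset h (mset_set W)"
    by simp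
  hence "sum_mset (image_mset (\<lambda>i. h (u i)) (mset_set {..<n})) = sum_mset (image_mset h (mset_set W))"
    by (simp add: multiset.map_comp o_def)
  thus ?thesis by (simp add: sum_unfold_sum_mset)
qed

section \<open>Taylor coefficients as polynomials in the base point\<close>

lemma coeff_coeff_poly: "coeff (coeff_poly D b) k = (if k \<le> D then b k else 0)"
  by (auto simp: coeff_poly_def coeff_sum)

lemma degree_coeff_poly_le: "degree (coeff_poly D b) \<le> D"
  by (rule degree_le) (simp add: coeff_coeff_poly)

text \<open>The binomial expansion exhibits an integer polynomial in x and the coefficients, which
  places Taylor coefficients in the extended ring.\<close>

lemma taylor_coeff_coeff_poly:
  "taylor_coeff (coeff_poly D b) x j = (\<Sum>k\<le>D. b k * (of_nat (k choose j) * x ^ (k - j)))"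
proof -
  have "pcompose (monom c k) [:x, 1:] = smult c ([:x, 1:] ^ k)" for c k
    by (rule poly_eq_poly_eq_iff[THEN iffD1]) (simp add: fun_eq_iff poly_pcompose poly_monom)
  hence "taylor_coeff (coeff_poly D b) x j = (\<Sum>k\<le>D. b k * coeff ([:x, 1:] ^ k) j)"
    by (simp add: taylor_coeff_def coeff_poly_def pcompose_sum coeff_sum)
  moreover have "coeff ([:x, 1:] ^ k) j = of_nat (k choose j) * x ^ (k - j)" for k
  proof (cases "j \<le> k")
    case True
    thus ?thesis by (simp add: coeff_linear_poly_power)
  next
    case False
    hence "degree ([:x, 1:] ^ k) < j" by (simp add: degree_linear_power)
    thus ?thesis using False by (simp add: coeff_eq_0)
  qed
  ultimately show ?thesis by simp
qed

lemma (in function_ring) taylor_coeff_in_poly_ext: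
  assumes "\<And>k. k \<le> D \<Longrightarrow> (\<lambda>y. b y k) \<in> S"
  shows "(\<lambda>z. taylor_coeff (coeff_poly D (b (fst z))) (snd z) j) \<in> poly_ext Om S"
proof -
  interpret P: function_ring "poly_ext Om S" "Om \<times> UNIV" "\<lambda>z. al (fst z)"
    by (rule function_ring_poly_ext)
  show ?thesis
    unfolding taylor_coeff_coeff_poly using assms
    by (intro P.sum_in P.mult_in P.of_nat_in P.power_in snd_in_poly_ext base_in_poly_ext[where f = "\<lambda>y. b y _"]) auto
qed

section \<open>The sum over the roots as an ARP\<close>

lemma pcompose_shift_prod:
  fixes a :: complex
  shows "pcompose (smult a (\<Prod>z\<in>Z. [:- z, 1:])) [:x, 1:] = smult a (\<Prod>z\<in>Z. [:- (z - x), 1:])"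
  by (rule poly_eq_poly_eq_iff[THEN iffD1]) (simp add: fun_eq_iff poly_pcompose poly_prod algebra_simps)

text \<open>After the shift the roots are z - x, so the two bounds for products of linear factors
  apply; r + |z - x| and the maximum of the two differ by at most a factor 2. The gauge is thus
  replaced by norms of ring elements.\<close>

lemma taylor_sum_root_gauge:
  fixes a x :: complex
  assumes Z: "finite Z" and a: "1 / 2 \<le> cmod a" "cmod a \<le> 2" and r: "r > 0"
  defines "N \<equiv> card Z"
  defines "s \<equiv> \<Sum>k\<le>N. cmod (taylor_coeff (smult a (\<Prod>z\<in>Z. [:- z, 1:])) x k) * r ^ k"
  shows "s \<le> 2 * 2 ^ N * root_gauge Z x r"
    and "root_gauge Z x r \<le> 2 * ((2 * real N + 3) ^ N * (real N + 1) ^ N) * s"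
proof -
  define p where "p = (\<Prod>z\<in>Z. [:- (z - x), 1:])"
  define t where "t = (\<Sum>k\<le>N. cmod (coeff p k) * r ^ k)"
  have t0: "t \<ge> 0" unfolding t_def using r by (intro sum_nonneg) auto
  have s: "s = cmod a * t"
    by (simp add: s_def t_def taylor_coeff_def pcompose_shift_prod p_def norm_mult sum_distrib_left mult_ac)
  have "t \<le> (\<Prod>z\<in>Z. cmod (- (z - x)) + cmod 1 * r)"
    unfolding t_def p_def N_def using Z r by (intro coeff_sum_prod_linear_le) auto
  also have "\<dots> \<le> (\<Prod>z\<in>Z. 2 * max r (cmod (x - z)))"
    using r by (intro prod_mono) (auto simp: norm_minus_commute)
  also have "\<dots> = 2 ^ N * root_gauge Z x r"
    by (simp add: prod.distrib N_def root_gauge_def)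
  finally have "t \<le> 2 ^ N * root_gauge Z x r" .
  hence "cmod a * t \<le> 2 * (2 ^ N * root_gauge Z x r)"
    using a t0 by (intro mult_mono) auto
  thus "s \<le> 2 * 2 ^ N * root_gauge Z x r" by (simp add: s)
  have "root_gauge Z x r \<le> (\<Prod>z\<in>Z. r + cmod (z - x))"
    unfolding root_gauge_def using r by (intro prod_mono) (auto simp: norm_minus_commute le_max_iff_disj)
  also have "\<dots> \<le> ((2 * real N + 3) ^ N * (real N + 1) ^ N) * t"
    using prod_linear_le_coeff_sum[OF Z, of r "\<lambda>z. z - x"] r by (simp add: t_def p_def N_def)
  also have "\<dots> \<le> ((2 * real N + 3) ^ N * (real N + 1) ^ N) * (2 * s)"
  proof (rule mult_left_mono)
    have "1 * t \<le> (2 * cmod a) * t" using a t0 by (intro mult_right_mono) auto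
    thus "t \<le> 2 * s" by (simp add: s)
  qed auto
  finally show "root_gauge Z x r \<le> 2 * ((2 * real N + 3) ^ N * (real N + 1) ^ N) * s"
    by (simp add: mult_ac)
qed

lemma powr_ratio_mono:
  fixes u v :: real
  assumes "0 < u" "0 < v" "u \<le> C * v" "\<delta> \<ge> 0" "C > 0" "r \<ge> 0"
  shows "r / v powr \<delta> \<le> C powr \<delta> * (r / u powr \<delta>)"
proof -
  have "u powr \<delta> \<le> (C * v) powr \<delta>" using assms by (intro powr_mono2) auto
  also have "\<dots> = C powr \<delta> * v powr \<delta>" using assms by (simp add: powr_mult)
  finally have "r * u powr \<delta> \<le> r * (C powr \<delta> * v powr \<delta>)" using assms by (intro mult_left_mono) auto
  thus ?thesis using assms by (simp add: field_simps)
qed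

lemma rsquarefree_coeff_poly_roots:
  assumes "rsquarefree (coeff_poly N b)" "b N \<noteq> 0"
  defines "Z \<equiv> {z. poly (coeff_poly N b) z = 0}"
  shows "finite Z" "card Z = N" "coeff_poly N b = smult (b N) (\<Prod>z\<in>Z. [:- z, 1:])"
    "degree (coeff_poly N b) = N"
proof -
  have nz: "coeff_poly N b \<noteq> 0" using assms(1) by (simp add: rsquarefree_def)
  show fin: "finite Z" unfolding Z_def using nz by (rule poly_roots_finite)
  show deg: "degree (coeff_poly N b) = N"
    using assms(2) by (intro antisym degree_coeff_poly_le le_degree) (simp add: coeff_coeff_poly)
  show eq: "coeff_poly N b = smult (b N) (\<Prod>z\<in>Z. [:- z, 1:])"
    using complex_poly_decompose_rsquarefree[OF assms(1)] by (simp add: deg coeff_coeff_poly Z_def)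
  have "N = degree (smult (b N) (\<Prod>z\<in>Z. [:- z, 1:]))"
    using deg eq by simp
  also have "\<dots> = (\<Sum>z\<in>Z. degree [:- z, 1:])"
    using assms(2) by (subst degree_smult_eq, simp, subst degree_prod_sum_eq) auto
  finally show "card Z = N" by simp
qed

context
  fixes \<epsilon> \<delta> :: real and M N :: nat and D :: "(nat \<Rightarrow> complex) set"
  assumes eps: "\<epsilon> \<in> \<rat>" "\<epsilon> \<ge> 0" and del: "\<delta> \<in> \<rat>" "\<delta> \<ge> 0" and N: "N \<ge> 1"
    and D: "\<And>y. y \<in> D \<Longrightarrow> rsquarefree (coeff_poly N (\<lambda>k. y (M + 1 + k))) \<and>
       1 / 2 \<le> cmod (y (M + 1 + N)) \<and> cmod (y (M + 1 + N)) \<le> 2"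
begin

abbreviation (input) "PP y \<equiv> coeff_poly M y"
abbreviation (input) "QQ y \<equiv> coeff_poly N (\<lambda>k. y (M + 1 + k))"
abbreviation (input) "ZZ y \<equiv> {z. poly (coeff_poly N (\<lambda>k. y (M + 1 + k))) z = 0}"
abbreviation (input) "lc (y :: nat \<Rightarrow> complex) \<equiv> y (M + 1 + N)"

lemma root_facts:
  assumes "y \<in> D"
  shows "finite (ZZ y)" "card (ZZ y) = N" "QQ y = smult (lc y) (\<Prod>z\<in>ZZ y. [:- z, 1:])" "lc y \<noteq> 0"
proof -
  show lc: "lc y \<noteq> 0" using D[OF assms] by auto
  show "finite (ZZ y)" "card (ZZ y) = N" "QQ y = smult (lc y) (\<Prod>z\<in>ZZ y. [:- z, 1:])"
    using rsquarefree_coeff_poly_roots[of N "\<lambda>k. y (M + 1 + k)"] D[OF assms] lc by auto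
qed

text \<open>A copy of \<open>scale_weight\<close> at radius |w| with the gauge replaced by the
  Taylor sum, so that only norms of polynomials in y, x, w occur; w stands for a difference of two
  roots.\<close>

definition local_weight :: "nat \<Rightarrow> ((nat \<Rightarrow> complex) \<times> complex) \<times> complex \<Rightarrow> real" where
  "local_weight k = (\<lambda>((y, x), w). rpow (cmod w) (real k * \<epsilon> + 2) /
     rpow (\<Sum>j\<le>N. cmod (taylor_coeff (QQ y) x j * w ^ j)) \<delta>)"

lemma local_weight_comparable:
  "\<exists>C\<ge>1. \<forall>y\<in>D. \<forall>x. \<forall>w. w \<noteq> 0 \<longrightarrow>
     local_weight k ((y, x), w) \<le> C * scale_weight (real k * \<epsilon> + 2) \<delta> (ZZ y) x (cmod w) \<and>
     scale_weight (real k * \<epsilon> + 2) \<delta> (ZZ y) x (cmod w) \<le> C * local_weight k ((y, x), w)"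
proof -
  define C where "C = 2 * 2 ^ N + 2 * ((2 * real N + 3) ^ N * (real N + 1) ^ N)"
  have C2: "0 \<le> 2 * ((2 * real N + 3) ^ N * (real N + 1) ^ N)" by simp
  have C1: "1 \<le> (2::real) ^ N" by simp
  have C: "C \<ge> 1" using C1 C2 unfolding C_def by linarith
  show ?thesis
  proof (intro exI[of _ "C powr \<delta>"] conjI ballI allI impI)
    show "1 \<le> C powr \<delta>" using C del by (intro ge_one_powr_ge_zero) auto
    fix y x and w :: complex
    assume y: "y \<in> D" and w: "w \<noteq> 0"
    define g where "g = root_gauge (ZZ y) x (cmod w)"
    define s where "s = (\<Sum>j\<le>N. cmod (taylor_coeff (QQ y) x j) * cmod w ^ j)"
    have w': "cmod w > 0" using w by simp
    have g: "g > 0" using w' by (simp add: g_def root_gauge_pos)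
    have *: "s \<le> 2 * 2 ^ N * g" "g \<le> 2 * ((2 * real N + 3) ^ N * (real N + 1) ^ N) * s"
      using taylor_sum_root_gauge[OF root_facts(1)[OF y], of "lc y" "cmod w" x] D[OF y] w'
      unfolding root_facts(2)[OF y] root_facts(3)[OF y, symmetric] s_def g_def by auto
    have s0: "s \<ge> 0" unfolding s_def by (intro sum_nonneg) auto
    have "s \<noteq> 0" using *(2) g by auto
    hence s: "s > 0" using s0 by simp
    have sg: "s \<le> C * g" using *(1) g C2 unfolding C_def by (simp add: distrib_right add_increasing2)
    have gs: "g \<le> C * s" using *(2) s C1 unfolding C_def by (simp add: distrib_right add_increasing)
    have lw: "local_weight k ((y, x), w) = cmod w powr (real k * \<epsilon> + 2) / s powr \<delta>"
      using w' s by (simp add: local_weight_def rpow_eq_powr s_def norm_mult norm_power)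
    have sw: "scale_weight (real k * \<epsilon> + 2) \<delta> (ZZ y) x (cmod w) = cmod w powr (real k * \<epsilon> + 2) / g powr \<delta>"
      by (simp add: scale_weight_def g_def)
    show "local_weight k ((y, x), w) \<le> C powr \<delta> * scale_weight (real k * \<epsilon> + 2) \<delta> (ZZ y) x (cmod w)"
      unfolding lw sw using g s gs del C by (intro powr_ratio_mono) auto
    show "scale_weight (real k * \<epsilon> + 2) \<delta> (ZZ y) x (cmod w) \<le> C powr \<delta> * local_weight k ((y, x), w)"
      unfolding lw sw using g s sg del C by (intro powr_ratio_mono) auto
  qed
qed

text \<open>With \<open>local_weight\<close> in place of \<open>scale_weight\<close>, every
  ingredient is \<open>arp_like\<close> over \<open>?S2\<close>. One use of
  \<open>arp_like_sum_roots\<close> removes the difference of roots and lands over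
  \<open>?S1\<close>, a second removes x and lands over \<open>?S0\<close>.\<close>

theorem root_sum_arp_like:
  "(\<lambda>y. root_sum \<epsilon> \<delta> M (PP y) (ZZ y)) \<in> arp_like (ipoly_localization (M + N + 2) (M + 1 + N)) D"
proof -
  let ?S0 = "ipoly_localization (M + N + 2) (M + 1 + N)"
  let ?Om0 = "{y. lc y \<noteq> 0}"
  let ?S1 = "poly_ext ?Om0 ?S0"
  let ?Om1 = "?Om0 \<times> (UNIV :: complex set)"
  let ?S2 = "poly_ext ?Om1 ?S1"
  interpret R0: function_ring ?S0 ?Om0 "\<lambda>y. lc y"
    by (rule function_ring_ipoly_localization) simp
  interpret R1: function_ring ?S1 ?Om1 "\<lambda>z. lc (fst z)"
    by (rule R0.function_ring_poly_ext)
  interpret R2: function_ring ?S2 "?Om1 \<times> UNIV" "\<lambda>z. lc (fst (fst z))"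
    by (rule R1.function_ring_poly_ext)
  have var_in: "(\<lambda>y. y i) \<in> ?S0" if "i < M + N + 2" for i
    using that by (intro ipoly_functions_localization ipoly_functions_var)
  have taylor_P: "(\<lambda>z. taylor_coeff (PP (fst z)) (snd z) k) \<in> ?S1" for k
    using R0.taylor_coeff_in_poly_ext[of M "\<lambda>y. y" k] var_in by auto
  have taylor_Q: "(\<lambda>z. taylor_coeff (QQ (fst z)) (snd z) k) \<in> ?S1" for k
    using R0.taylor_coeff_in_poly_ext[of N "\<lambda>y k. y (M + 1 + k)" k] var_in by auto
  have degQ: "degree (QQ y) = N" if "lc y \<noteq> 0" for y
    using that by (intro antisym degree_coeff_poly_le le_degree) (simp add: coeff_coeff_poly)
  have "\<forall>y\<in>?Om0. \<exists>u. QQ y = smult (lc y) (\<Prod>i<N. [:- u i, 1:])"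
  proof
    fix y assume y: "y \<in> ?Om0"
    obtain u where "smult (lead_coeff (QQ y)) (\<Prod>i<degree (QQ y). [:- u i, 1:]) = QQ y"
      by (rule complex_poly_decompose')
    thus "\<exists>u. QQ y = smult (lc y) (\<Prod>i<N. [:- u i, 1:])"
      using degQ[of y] y by (intro exI[of _ u]) (simp add: coeff_coeff_poly)
  qed
  then obtain xi0 where xi0: "\<And>y. y \<in> ?Om0 \<Longrightarrow> QQ y = smult (lc y) (\<Prod>i<N. [:- xi0 y i, 1:])"
    by metis
  interpret T0: split_polynomial ?S0 ?Om0 "\<lambda>y. lc y" "\<lambda>y. QQ y" xi0 N
  proof unfold_locales
    show "(\<lambda>y. coeff (QQ y) k) \<in> ?S0" for k
      using var_in[of "M + 1 + k"] R0.zero_in by (cases "k \<le> N") (auto simp: coeff_coeff_poly)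
  qed (rule xi0)
  \<comment> \<open>\<open>poly_shift 1\<close> drops the constant coefficient Q(x) and divides by
    the variable. It makes sense for every x, so the coefficients stay in \<open>?S1\<close>; for a
    root x it is Q(x + t)/t.\<close>
  define A1 where "A1 = (\<lambda>(y, x). poly_shift 1 (pcompose (QQ y) [:x, 1:]))"
  have A1_coeff: "coeff (A1 z) k = taylor_coeff (QQ (fst z)) (snd z) (Suc k)" for z k
    by (simp add: A1_def case_prod_beta coeff_poly_shift taylor_coeff_def)
  have "\<forall>z\<in>?Om1. \<exists>u. A1 z = smult (lc (fst z)) (\<Prod>i<N - 1. [:- u i, 1:])"
  proof
    fix z assume z: "z \<in> ?Om1"
    hence lc: "lc (fst z) \<noteq> 0" by auto
    define p where "p = pcompose (QQ (fst z)) [:snd z, 1:]"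
    have degQz: "degree (QQ (fst z)) = N" using lc by (rule degQ[of "fst z"])
    have degp: "degree p = N" using degQz by (simp add: p_def degree_pcompose_shift)
    have "lead_coeff p = lead_coeff (QQ (fst z))"
      unfolding p_def by (subst lead_coeff_comp) simp_all
    hence lcp: "coeff p N = lc (fst z)" using degp degQz by (simp add: coeff_coeff_poly)
    have c: "coeff (A1 z) k = coeff p (Suc k)" for k
      by (simp add: A1_coeff taylor_coeff_def p_def)
    have top: "coeff (A1 z) (N - 1) = lc (fst z)" using N lcp by (simp add: c)
    have deg: "degree (A1 z) = N - 1"
    proof (rule antisym)
      show "degree (A1 z) \<le> N - 1"
        by (rule degree_le) (auto simp: c intro!: coeff_eq_0 simp: degp)
      show "N - 1 \<le> degree (A1 z)" using top lc by (intro le_degree) auto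
    qed
    obtain u where "smult (lead_coeff (A1 z)) (\<Prod>i<degree (A1 z). [:- u i, 1:]) = A1 z"
      by (rule complex_poly_decompose')
    thus "\<exists>u. A1 z = smult (lc (fst z)) (\<Prod>i<N - 1. [:- u i, 1:])"
      using deg top by (intro exI[of _ u]) simp
  qed
  then obtain xi1 where xi1: "\<And>z. z \<in> ?Om1 \<Longrightarrow> A1 z = smult (lc (fst z)) (\<Prod>i<N - 1. [:- xi1 z i, 1:])"
    by metis
  interpret T1: split_polynomial ?S1 ?Om1 "\<lambda>z. lc (fst z)" A1 xi1 "N - 1"
    by unfold_locales (use xi1 taylor_Q in \<open>auto simp: A1_coeff\<close>)
  \<comment> \<open>Comparisons are made only at genuine roots x (\<open>D1\<close>) and, one level
    up, at nonzero w (\<open>D2\<close>), where the denominator of \<open>local_weight\<close> is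
    positive.\<close>
  define D1 where "D1 = {z. fst z \<in> D \<and> snd z \<in> ZZ (fst z)}"
  define D2 where "D2 = {v :: ((nat \<Rightarrow> complex) \<times> complex) \<times> complex. fst (fst v) \<in> D \<and> snd v \<noteq> 0}"
  have A1_split: "A1 (y, x) = smult (lc y) (\<Prod>w\<in>(\<lambda>z. z - x) ` (ZZ y - {x}). [:- w, 1:])"
    if y: "y \<in> D" and x: "x \<in> ZZ y" for x y
  proof -
    have "pcompose (QQ y) [:x, 1:] = smult (lc y) (\<Prod>z\<in>ZZ y. [:- (z - x), 1:])"
      by (subst root_facts(3)[OF y]) (rule pcompose_shift_prod)
    also have "(\<Prod>z\<in>ZZ y. [:- (z - x), 1:]) = [:0, 1:] * (\<Prod>z\<in>ZZ y - {x}. [:- (z - x), 1:])"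
      using root_facts(1)[OF y] x by (subst prod.remove[of _ x]) auto
    also have "(\<Prod>z\<in>ZZ y - {x}. [:- (z - x), 1:]) = (\<Prod>w\<in>(\<lambda>z. z - x) ` (ZZ y - {x}). [:- w, 1:])"
      by (subst prod.reindex) (auto simp: inj_on_def)
    finally have "pcompose (QQ y) [:x, 1:] =
        pCons 0 (smult (lc y) (\<Prod>w\<in>(\<lambda>z. z - x) ` (ZZ y - {x}). [:- w, 1:]))"
      by simp
    thus ?thesis
      by (simp add: A1_def poly_eq_iff coeff_poly_shift)
  qed
  have sum_xi1: "(\<Sum>i<N - 1. h (xi1 (y, x) i)) = (\<Sum>w\<in>ZZ y - {x}. h (w - x))"
    if y: "y \<in> D" and x: "x \<in> ZZ y" for x y and h :: "complex \<Rightarrow> real"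
  proof -
    have "(\<Sum>i<N - 1. h (xi1 (y, x) i)) = (\<Sum>w\<in>(\<lambda>z. z - x) ` (ZZ y - {x}). h w)"
      by (rule sum_roots_eq[of "lc y"])
         (use A1_split[OF y x] xi1[of "(y, x)"] root_facts[OF y] in auto)
    also have "\<dots> = (\<Sum>w\<in>ZZ y - {x}. h (w - x))"
      by (subst sum.reindex) (auto simp: inj_on_def)
    finally show ?thesis .
  qed
  have sum_xi0: "(\<Sum>i<N. h (xi0 y i)) = (\<Sum>x\<in>ZZ y. h x)" if y: "y \<in> D" for y and h :: "complex \<Rightarrow> real"
  proof (rule sum_roots_eq[of "lc y"])
    show "smult (lc y) (\<Prod>i<N. [:- xi0 y i, 1:]) = smult (lc y) (\<Prod>z\<in>ZZ y. [:- z, 1:])"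
      using xi0[of y] root_facts(4)[OF y] by (intro trans[OF _ root_facts(3)[OF y]]) auto
  qed (use root_facts(1,4)[OF y] in auto)
  have xi0_root: "xi0 y i \<in> ZZ y" if "y \<in> D" "i < N" for y i
  proof -
    have "poly (smult (lc y) (\<Prod>i<N. [:- xi0 y i, 1:])) (xi0 y i) = 0"
      using that(2) by (auto simp: poly_prod prod_zero_iff)
    thus ?thesis using xi0[of y] root_facts(4)[OF that(1)] by simp
  qed
  \<comment> \<open>The roots of \<open>Q\<close> are simple, so dividing by t removes the only zero
    at t = 0 and the remaining roots are nonzero differences.\<close>
  have xi1_D2: "(z, xi1 z i) \<in> D2" if z: "z \<in> D1" and i: "i < N - 1" for z i
  proof -
    obtain y x where yx: "z = (y, x)" "y \<in> D" "x \<in> ZZ y" using z by (cases z) (auto simp: D1_def)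
    have "poly (A1 z) (xi1 z i) = 0"
      using xi1[of z] i root_facts(4)[OF yx(2)] by (auto simp: yx(1) poly_prod prod_zero_iff)
    hence "\<exists>w\<in>(\<lambda>z. z - x) ` (ZZ y - {x}). xi1 z i - w = 0"
      using A1_split[OF yx(2,3)] root_facts(1,4)[OF yx(2)] unfolding yx(1)
      by (simp add: poly_prod prod_zero_iff)
    thus ?thesis using yx by (auto simp: D2_def)
  qed
  have w_in: "snd \<in> ?S2" by (rule R1.snd_in_poly_ext)
  have lw_in: "local_weight k \<in> arp_like ?S2 D2" for k
  proof -
    have "real k * \<epsilon> + 2 \<in> \<rat>" using eps by simp
    hence num: "(\<lambda>v. rpow (cmod (snd v)) (real k * \<epsilon> + 2)) \<in> arp_like ?S2 D2"
      using eps by (intro R2.arp_like_rpow R2.arp_like_norm w_in) auto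
    have den: "(\<lambda>v. rpow (\<Sum>j\<le>N. cmod (taylor_coeff (QQ (fst (fst v))) (snd (fst v)) j * snd v ^ j)) \<delta>)
        \<in> arp_like ?S2 D2"
      using del R1.base_in_poly_ext[OF taylor_Q]
      by (intro R2.arp_like_rpow R2.arp_like_sum R2.arp_like_norm R2.mult_in R2.power_in w_in) auto
    have pos: "0 < rpow (\<Sum>j\<le>N. cmod (taylor_coeff (QQ (fst (fst v))) (snd (fst v)) j * snd v ^ j)) \<delta>"
      if v: "v \<in> D2" for v
    proof (rule rpow_pos)
      obtain y x w where yxw: "v = ((y, x), w)" "y \<in> D" "w \<noteq> 0"
        using v by (cases v) (auto simp: D2_def)
      have "0 < root_gauge (ZZ y) x (cmod w)" using yxw by (simp add: root_gauge_pos)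
      also have "\<dots> \<le> 2 * ((2 * real N + 3) ^ N * (real N + 1) ^ N) *
          (\<Sum>j\<le>N. cmod (taylor_coeff (QQ y) x j) * cmod w ^ j)"
        using taylor_sum_root_gauge(2)[OF root_facts(1)[OF yxw(2)], of "lc y" "cmod w" x] D[OF yxw(2)] yxw
        unfolding root_facts(2)[OF yxw(2)] root_facts(3)[OF yxw(2), symmetric] by auto
      finally have "0 < (\<Sum>j\<le>N. cmod (taylor_coeff (QQ y) x j) * cmod w ^ j)"
        by (rule zero_less_mult_pos) (simp add: add_nonneg_pos)
      thus "0 < (\<Sum>j\<le>N. cmod (taylor_coeff (QQ (fst (fst v))) (snd (fst v)) j * snd v ^ j))"
        by (simp add: yxw norm_mult norm_power)
    qed
    have "local_weight k = (\<lambda>v. rpow (cmod (snd v)) (real k * \<epsilon> + 2) /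
        rpow (\<Sum>j\<le>N. cmod (taylor_coeff (QQ (fst (fst v))) (snd (fst v)) j * snd v ^ j)) \<delta>)"
      by (simp add: local_weight_def fun_eq_iff)
    thus ?thesis using R2.arp_like_divide[OF num den pos] by simp
  qed
  define h1 where "h1 = (\<lambda>z. \<Sum>k\<le>M. rpow (cmod (taylor_coeff (PP (fst z)) (snd z) k)) \<epsilon> *
      (1 + (\<Sum>i<N - 1. local_weight k (z, xi1 z i))))"
  have h1_in: "h1 \<in> arp_like ?S1 D1"
    unfolding h1_def using eps xi1_D2
    by (intro R1.arp_like_sum R1.arp_like_mult R1.arp_like_add R1.arp_like_one R1.arp_like_rpow
        R1.arp_like_norm taylor_P T1.arp_like_sum_roots[OF lw_in]) auto
  have h0_in: "(\<lambda>y. \<Sum>i<N. h1 (y, xi0 y i)) \<in> arp_like ?S0 D"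
    using xi0_root by (intro T0.arp_like_sum_roots[OF h1_in]) (auto simp: D1_def)
  have "\<exists>C. \<forall>k. 1 \<le> C k \<and> (\<forall>y\<in>D. \<forall>x w. w \<noteq> 0 \<longrightarrow>
     local_weight k ((y, x), w) \<le> C k * scale_weight (real k * \<epsilon> + 2) \<delta> (ZZ y) x (cmod w) \<and>
     scale_weight (real k * \<epsilon> + 2) \<delta> (ZZ y) x (cmod w) \<le> C k * local_weight k ((y, x), w))"
    using local_weight_comparable by (intro choice allI) blast
  then obtain C where C: "\<And>k. 1 \<le> C k"
    "\<And>k y x w. y \<in> D \<Longrightarrow> w \<noteq> 0 \<Longrightarrow>
       local_weight k ((y, x), w) \<le> C k * scale_weight (real k * \<epsilon> + 2) \<delta> (ZZ y) x (cmod w)"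
    "\<And>k y x w. y \<in> D \<Longrightarrow> w \<noteq> 0 \<Longrightarrow>
       scale_weight (real k * \<epsilon> + 2) \<delta> (ZZ y) x (cmod w) \<le> C k * local_weight k ((y, x), w)"
    by blast
  \<comment> \<open>A single constant for all k <= M; being at least 1, it also absorbs the summand
    1 in \<open>mono\<close>.\<close>
  define B where "B = (\<Sum>k\<le>M. C k)"
  have CB: "C k \<le> B" if "k \<le> M" for k
    unfolding B_def using that C(1) order_trans[OF zero_le_one C(1)] by (intro member_le_sum) auto
  have B: "B \<ge> 1" using CB[of 0] C(1)[of 0] by simp
  define b where "b = (\<lambda>y x k. rpow (cmod (taylor_coeff (PP y) x k)) \<epsilon>)"
  define G where "G = (\<lambda>y x k w. scale_weight (real k * \<epsilon> + 2) \<delta> (ZZ y) x (cmod (x - w)))"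
  define L where "L = (\<lambda>y x k w. local_weight k ((y, x), w - x))"
  have h0: "(\<Sum>i<N. h1 (y, xi0 y i)) = (\<Sum>x\<in>ZZ y. \<Sum>k\<le>M. b y x k * (1 + (\<Sum>w\<in>ZZ y - {x}. L y x k w)))"
    if y: "y \<in> D" for y
  proof -
    have "(\<Sum>i<N. h1 (y, xi0 y i)) = (\<Sum>x\<in>ZZ y. h1 (y, x))" by (rule sum_xi0[OF y])
    also have "\<dots> = (\<Sum>x\<in>ZZ y. \<Sum>k\<le>M. b y x k * (1 + (\<Sum>w\<in>ZZ y - {x}. L y x k w)))"
    proof (intro sum.cong refl)
      fix x assume x: "x \<in> ZZ y"
      show "h1 (y, x) = (\<Sum>k\<le>M. b y x k * (1 + (\<Sum>w\<in>ZZ y - {x}. L y x k w)))"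
        using sum_xi1[OF y x, of "\<lambda>w. local_weight _ ((y, x), w)"]
        by (simp add: h1_def b_def L_def)
    qed
    finally show ?thesis .
  qed
  have L_nonneg: "0 \<le> L y x k w" for y x k w by (simp add: L_def local_weight_def)
  have b_nonneg: "0 \<le> b y x k" for y x k by (simp add: b_def)
  have LG: "L y x k w \<le> B * G y x k w" and GL: "G y x k w \<le> B * L y x k w"
    if "y \<in> D" "k \<le> M" "w \<in> ZZ y - {x}" for y x k w
  proof -
    have w: "w - x \<noteq> 0" using that by auto
    have "L y x k w \<le> C k * G y x k w"
      using C(2)[OF that(1) w, of k x] by (simp add: L_def G_def norm_minus_commute)
    also have "\<dots> \<le> B * G y x k w"
      using CB[OF that(2)] by (intro mult_right_mono) (auto simp: G_def scale_weight_nonneg)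
    finally show "L y x k w \<le> B * G y x k w" .
    have "G y x k w \<le> C k * L y x k w"
      using C(3)[OF that(1) w, of k x] by (simp add: L_def G_def norm_minus_commute)
    also have "\<dots> \<le> B * L y x k w"
      using CB[OF that(2)] L_nonneg by (intro mult_right_mono) auto
    finally show "G y x k w \<le> B * L y x k w" .
  qed
  have mono: "(\<Sum>x\<in>ZZ y. \<Sum>k\<le>M. b y x k * (1 + (\<Sum>w\<in>ZZ y - {x}. F x k w)))
      \<le> B * (\<Sum>x\<in>ZZ y. \<Sum>k\<le>M. b y x k * (1 + (\<Sum>w\<in>ZZ y - {x}. F' x k w)))"
    if F: "\<And>x k w. k \<le> M \<Longrightarrow> w \<in> ZZ y - {x} \<Longrightarrow> F x k w \<le> B * F' x k w" for y and F F' :: "complex \<Rightarrow> nat \<Rightarrow> complex \<Rightarrow> real"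
    unfolding sum_distrib_left
  proof (intro sum_mono)
    fix x k assume k: "k \<in> {..M}"
    have "(\<Sum>w\<in>ZZ y - {x}. F x k w) \<le> B * (\<Sum>w\<in>ZZ y - {x}. F' x k w)"
      unfolding sum_distrib_left using F k by (intro sum_mono) auto
    hence "b y x k * (1 + (\<Sum>w\<in>ZZ y - {x}. F x k w)) \<le> b y x k * (B * (1 + (\<Sum>w\<in>ZZ y - {x}. F' x k w)))"
      using B b_nonneg by (intro mult_left_mono) (auto simp: distrib_left)
    thus "b y x k * (1 + (\<Sum>w\<in>ZZ y - {x}. F x k w)) \<le> B * (b y x k * (1 + (\<Sum>w\<in>ZZ y - {x}. F' x k w)))"
      by (simp add: mult_ac)
  qed
  have rs: "root_sum \<epsilon> \<delta> M (PP y) (ZZ y) = (\<Sum>x\<in>ZZ y. \<Sum>k\<le>M. b y x k * (1 + (\<Sum>w\<in>ZZ y - {x}. G y x k w)))" for y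
    by (simp add: root_sum_def b_def G_def)
  have "comparable_on D (\<lambda>y. root_sum \<epsilon> \<delta> M (PP y) (ZZ y)) (\<lambda>y. \<Sum>i<N. h1 (y, xi0 y i))"
  proof (rule comparable_onI2[of B B])
    fix y assume y: "y \<in> D"
    show "0 \<le> root_sum \<epsilon> \<delta> M (PP y) (ZZ y)"
      unfolding rs by (intro sum_nonneg mult_nonneg_nonneg add_nonneg_nonneg) (auto simp: b_def G_def scale_weight_nonneg)
    show "0 \<le> (\<Sum>i<N. h1 (y, xi0 y i))"
      unfolding h0[OF y] by (intro sum_nonneg mult_nonneg_nonneg add_nonneg_nonneg) (auto simp: b_nonneg L_nonneg)
    show "root_sum \<epsilon> \<delta> M (PP y) (ZZ y) \<le> B * (\<Sum>i<N. h1 (y, xi0 y i))"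
      unfolding h0[OF y] rs using GL[OF y] by (intro mono) auto
    show "(\<Sum>i<N. h1 (y, xi0 y i)) \<le> B * root_sum \<epsilon> \<delta> M (PP y) (ZZ y)"
      unfolding h0[OF y] rs using LG[OF y] by (intro mono) auto
  qed (use B in auto)
  thus ?thesis by (rule R0.arp_like_comparable[OF h0_in])
qed

end

section \<open>The theorem\<close>

text \<open>With c_k the deviations from Z^N, a root satisfies z^N = - \<Sum> c_k z^k. If |z| >= 1,
  the right side is smaller than |z|^N; hence |z| < 1, and then |z|^N is at most the sum of the
  |c_k|.\<close>

lemma small_perturbation_root_bound:
  fixes b :: "nat \<Rightarrow> complex"
  assumes small: "(\<Sum>k\<le>N. cmod (b k - (if k = N then 1 else 0))) < (1 / 4) ^ N"
    and z: "poly (coeff_poly N b) z = 0" and N: "N \<ge> 1"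
  shows "cmod z < 1 / 4"
proof -
  define c where "c = (\<lambda>k. b k - (if k = N then 1 else 0))"
  define s where "s = (\<Sum>k\<le>N. cmod (c k))"
  have s: "s < (1 / 4) ^ N" using small by (simp add: s_def c_def)
  have s0: "s \<ge> 0" by (simp add: s_def sum_nonneg)
  have "0 = (\<Sum>k\<le>N. b k * z ^ k)"
    using z by (simp add: coeff_poly_def poly_sum poly_monom)
  also have "\<dots> = (\<Sum>k\<le>N. c k * z ^ k + (if k = N then z ^ N else 0))"
    by (intro sum.cong) (auto simp: c_def algebra_simps)
  also have "\<dots> = (\<Sum>k\<le>N. c k * z ^ k) + z ^ N"
    by (simp add: sum.distrib)
  finally have "z ^ N = - (\<Sum>k\<le>N. c k * z ^ k)"
    by (simp add: eq_neg_iff_add_eq_0 add.commute)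
  hence le: "cmod z ^ N \<le> (\<Sum>k\<le>N. cmod (c k) * cmod z ^ k)"
    using norm_sum[of "\<lambda>k. c k * z ^ k" "{..N}"] by (simp add: norm_mult norm_power flip: norm_power)
  show ?thesis
  proof (cases "cmod z \<ge> 1")
    case True
    note le
    also have "(\<Sum>k\<le>N. cmod (c k) * cmod z ^ k) \<le> (\<Sum>k\<le>N. cmod (c k) * cmod z ^ N)"
      using True by (intro sum_mono mult_left_mono power_increasing) auto
    also have "\<dots> = s * cmod z ^ N" by (simp add: s_def sum_distrib_right)
    also have "\<dots> < 1 * cmod z ^ N"
    proof (rule mult_strict_right_mono)
      have "(1 / 4 :: real) ^ N \<le> 1" by (rule power_le_one) auto
      thus "s < 1" using s by linarith
      show "0 < cmod z ^ N" using True by (intro zero_less_power) linarith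
    qed
    finally show ?thesis by simp
  next
    case False
    note le
    also have "(\<Sum>k\<le>N. cmod (c k) * cmod z ^ k) \<le> (\<Sum>k\<le>N. cmod (c k) * 1)"
      using False by (intro sum_mono mult_left_mono power_le_one) auto
    also have "\<dots> < (1 / 4) ^ N" using s by (simp add: s_def)
    finally show ?thesis by (rule power_less_imp_less_base) simp
  qed
qed

text \<open>A nonzero polynomial has a nonzero Taylor coefficient at every point, and the summand 1
  keeps its contribution positive.\<close>

lemma root_sum_pos:
  assumes Z: "finite Z" "x \<in> Z" and P: "degree P \<le> M" "P \<noteq> 0"
  shows "0 < root_sum \<epsilon> \<delta> M P Z"
proof -
  define t where "t = (\<lambda>x k. rpow (cmod (taylor_coeff P x k)) \<epsilon> *
     (1 + (\<Sum>w\<in>Z - {x}. scale_weight (real k * \<epsilon> + 2) \<delta> Z x (cmod (x - w)))))"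
  have t: "t x k \<ge> 0" for x k
    unfolding t_def
    by (intro mult_nonneg_nonneg add_nonneg_nonneg sum_nonneg scale_weight_nonneg) auto
  obtain k where k: "k \<le> M" "taylor_coeff P x k \<noteq> 0"
  proof (rule ccontr)
    assume "\<not> thesis"
    hence "poly P (x + w) = 0" for w
      unfolding poly_taylor[OF P(1)] using that by (intro sum.neutral) auto
    hence "poly P w = 0" for w by (metis add_diff_cancel_left' diff_add_cancel)
    thus False using P(2) poly_all_0_iff_0 by blast
  qed
  have "0 < t x k"
    unfolding t_def using k(2)
    by (intro mult_pos_pos rpow_pos add_pos_nonneg sum_nonneg scale_weight_nonneg) auto
  also have "\<dots> \<le> (\<Sum>k\<le>M. t x k)" using k(1) t by (intro member_le_sum) auto
  also have "\<dots> \<le> (\<Sum>x\<in>Z. \<Sum>k\<le>M. t x k)"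
    using Z t by (intro member_le_sum[of x Z "\<lambda>x. \<Sum>k\<le>M. t x k"]) (auto intro!: sum_nonneg)
  finally show ?thesis by (simp add: root_sum_def t_def)
qed

theorem theorem5:
  fixes \<epsilon> \<delta> :: real and M N :: nat
  assumes "\<epsilon> \<in> \<rat>" "\<epsilon> \<ge> 0" "\<delta> \<in> \<rat>" "\<delta> \<ge> 0" "\<delta> < 2" "N \<ge> 1"
    and "\<forall>\<nu>\<le>M. \<forall>k<N. real \<nu> * \<epsilon> - real (N - k) * \<delta> + 2 \<noteq> 0"
  shows "\<exists>T s1 c1 c2. is_ARP (M + N + 2) T \<and> 0 < s1 \<and> s1 < 1 \<and> 0 < c1 \<and> 0 < c2 \<and>
     (\<forall>b1 b2 :: nat \<Rightarrow> complex.
        (\<exists>\<mu>\<le>M. b1 \<mu> \<noteq> 0) \<and>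
        (\<Sum>\<nu>\<le>N. cmod (b2 \<nu> - (if \<nu> = N then 1 else 0))) < s1 \<and>
        rsquarefree (coeff_poly N b2) \<longrightarrow>
          join_coeffs M b1 b2 \<in> arp_strict_domain (M + N + 2) T \<and>
          (let I = (\<integral>\<^sup>+ z. indicator (ball 0 1) z *
                     ennreal (rpow (cmod (poly (coeff_poly M b1) z)) \<epsilon> /
                              rpow (cmod (poly (coeff_poly N b2) z)) \<delta>) \<partial>lborel)
           in ennreal (c1 * arp_val (M + N + 2) T (join_coeffs M b1 b2)) \<le> I \<and>
              I \<le> ennreal (c2 * arp_val (M + N + 2) T (join_coeffs M b1 b2))))"
proof -
  define n where "n = M + N + 2"
  define j where "j = M + 1 + N"
  define s1 :: real where "s1 = (1 / 4) ^ N"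
  define Q where "Q = (\<lambda>y :: nat \<Rightarrow> complex. coeff_poly N (\<lambda>k. y (M + 1 + k)))"
  define Z where "Z = (\<lambda>y. {z. poly (Q y) z = 0})"
  define H where "H = (\<lambda>y. root_sum \<epsilon> \<delta> M (coeff_poly M y) (Z y))"
  define D where "D = {y :: nat \<Rightarrow> complex. (\<exists>\<mu>\<le>M. y \<mu> \<noteq> 0) \<and>
    (\<Sum>\<nu>\<le>N. cmod (y (M + 1 + \<nu>) - (if \<nu> = N then 1 else 0))) < s1 \<and> rsquarefree (Q y)}"
  have s1: "0 < s1" "s1 \<le> 1 / 4"
    using power_decreasing[of 1 N "1 / 4 :: real"] assms(6) by (auto simp: s1_def)
  have lc: "1 / 2 \<le> cmod (y j) \<and> cmod (y j) \<le> 2" if y: "y \<in> D" for y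
  proof -
    have "cmod (y (M + 1 + N) - (if N = N then 1 else 0)) \<le>
        (\<Sum>\<nu>\<le>N. cmod (y (M + 1 + \<nu>) - (if \<nu> = N then 1 else 0)))"
      by (intro member_le_sum[of N "{..N}" "\<lambda>\<nu>. cmod (y (M + 1 + \<nu>) - (if \<nu> = N then 1 else 0))"]) auto
    hence "cmod (y j - 1) < 1 / 4" using y s1 by (auto simp: D_def j_def)
    thus ?thesis
      using norm_triangle_ineq2[of "y j" 1] norm_triangle_ineq2[of 1 "y j"] by (simp add: norm_minus_commute)
  qed
  have small: "small_roots \<epsilon> \<delta> M (coeff_poly M y) (Q y) (Z y) (y j)" "card (Z y) = N"
    "finite (Z y)" "Z y \<noteq> {}" if y: "y \<in> D" for y
  proof -
    have "y j \<noteq> 0" using lc[OF y] by auto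
    hence *: "finite (Z y)" "card (Z y) = N" "Q y = smult (y j) (\<Prod>z\<in>Z y. [:- z, 1:])"
      using rsquarefree_coeff_poly_roots[of N "\<lambda>k. y (M + 1 + k)"] y
      by (simp_all add: D_def Z_def Q_def j_def)
    show "finite (Z y)" "card (Z y) = N" by fact+
    show ne: "Z y \<noteq> {}" using *(2) assms(6) by auto
    have "cmod z < 1 / 4" if "z \<in> Z y" for z
      using small_perturbation_root_bound[where N = N and b = "\<lambda>k. y (M + 1 + k)" and z = z] that y assms(6)
      by (simp add: D_def Z_def Q_def s1_def)
    thus "small_roots \<epsilon> \<delta> M (coeff_poly M y) (Q y) (Z y) (y j)"
      using assms(2,4,5) * ne lc[OF y] degree_coeff_poly_le by unfold_locales auto
  qed
  define J where "J = {..M} \<times> {1..N}"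
  \<comment> \<open>A minimum over finitely many exponents, positive by non-resonance; it is the
    decay rate of all kernels.\<close>
  define \<eta> where "\<eta> = Min ((\<lambda>(k, i). \<bar>real k * \<epsilon> + 2 - real i * \<delta>\<bar>) ` J)"
  have J: "finite J" "J \<noteq> {}" using assms(6) by (auto simp: J_def)
  have "\<eta> \<in> (\<lambda>(k, i). \<bar>real k * \<epsilon> + 2 - real i * \<delta>\<bar>) ` J"
    unfolding \<eta>_def using J by (intro Min_in) auto
  then obtain k i where ki: "k \<le> M" "1 \<le> i" "i \<le> N" "\<eta> = \<bar>real k * \<epsilon> + 2 - real i * \<delta>\<bar>"
    by (auto simp: J_def)
  \<comment> \<open>The number i of enclosed roots is N - k in the hypothesis, which is therefore
    instantiated at k = N - i.\<close>
  have "N - i < N" using ki by simp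
  hence "real k * \<epsilon> - real (N - (N - i)) * \<delta> + 2 \<noteq> 0" using assms(7) ki(1) by blast
  hence eta_pos: "\<eta> > 0" using ki by auto
  have eta_le: "\<eta> \<le> \<bar>real k * \<epsilon> + 2 - real i * \<delta>\<bar>" if "k \<le> M" "i \<in> {1..N}" for k i
    unfolding \<eta>_def using J that by (intro Min_le) (auto simp: J_def)
  have "\<exists>C>0. \<forall>P Q Z a. small_roots \<epsilon> \<delta> M P Q Z a \<and> card Z = N \<longrightarrow>
      weighted_integral \<epsilon> \<delta> P Q \<le> ennreal (C * root_sum \<epsilon> \<delta> M P Z) \<and>
      ennreal (root_sum \<epsilon> \<delta> M P Z / C) \<le> weighted_integral \<epsilon> \<delta> P Q"
    by (rule weighted_integral_comparable[OF eta_pos]) (use eta_le assms(6) in auto)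
  then obtain C where C: "C > 0" "\<And>P Q Z a. small_roots \<epsilon> \<delta> M P Q Z a \<Longrightarrow> card Z = N \<Longrightarrow>
      weighted_integral \<epsilon> \<delta> P Q \<le> ennreal (C * root_sum \<epsilon> \<delta> M P Z) \<and>
      ennreal (root_sum \<epsilon> \<delta> M P Z / C) \<le> weighted_integral \<epsilon> \<delta> P Q"
    by blast
  have "\<exists>T. is_ARP n T \<and> D \<subseteq> arp_strict_domain n T \<and> comparable_on D H (arp_val n T)"
  proof (cases "D = {}")
    \<comment> \<open>\<open>arp_like_imp_ARP\<close> needs a point of \<open>D\<close>; if there is
      none, the constant ARP 1 satisfies the claim vacuously.\<close>
    case True
    have "is_ARP n \<lparr>arp_num = [[(1, \<lambda>_. 0)]], arp_den = [], arp_num_exp = 0, arp_den_exp = 0\<rparr>"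
      by (simp add: is_ARP_def ipoly_eval_def)
    thus ?thesis using True by (auto simp: comparable_on_def intro: exI[of _ "1::real"])
  next
    case False
    show ?thesis
    proof (rule arp_like_imp_ARP[OF _ False _ lc])
      show "H \<in> arp_like (ipoly_localization n j) D"
        unfolding H_def Z_def Q_def n_def j_def
        using lc assms by (intro root_sum_arp_like) (auto simp: D_def Q_def j_def)
      fix y assume y: "y \<in> D"
      then obtain \<mu> where "\<mu> \<le> M" "y \<mu> \<noteq> 0" by (auto simp: D_def)
      hence "coeff (coeff_poly M y) \<mu> \<noteq> 0" by (simp add: coeff_coeff_poly)
      hence "coeff_poly M y \<noteq> 0" by auto
      thus "0 < H y"
        unfolding H_def using small(3,4)[OF y] degree_coeff_poly_le root_sum_pos by blast
    qed
  qed
  then obtain T where T: "is_ARP n T" "D \<subseteq> arp_strict_domain n T" "comparable_on D H (arp_val n T)"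
    by blast
  obtain C' where C': "C' > 0" "\<And>y. y \<in> D \<Longrightarrow> H y \<le> C' * arp_val n T y"
    "\<And>y. y \<in> D \<Longrightarrow> arp_val n T y \<le> C' * H y"
    using T(3) by (elim comparable_onE) blast
  show ?thesis
  \<comment> \<open>\<open>C\<close> compares the integral with \<open>H\<close>, and C' compares
    \<open>H\<close> with the value of \<open>T\<close>.\<close>
  proof (rule exI[of _ T], rule exI[of _ s1], rule exI[of _ "1 / (C * C')"], rule exI[of _ "C * C'"],
      intro conjI allI impI)
    fix b1 b2 :: "nat \<Rightarrow> complex"
    assume b: "(\<exists>\<mu>\<le>M. b1 \<mu> \<noteq> 0) \<and> (\<Sum>\<nu>\<le>N. cmod (b2 \<nu> - (if \<nu> = N then 1 else 0))) < s1 \<and>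
        rsquarefree (coeff_poly N b2)"
    define y where "y = join_coeffs M b1 b2"
    have y1: "y \<mu> = b1 \<mu>" if "\<mu> \<le> M" for \<mu> using that by (simp add: y_def join_coeffs_def)
    have y2: "y (M + 1 + \<nu>) = b2 \<nu>" for \<nu> by (simp add: y_def join_coeffs_def)
    have P: "coeff_poly M y = coeff_poly M b1" unfolding coeff_poly_def using y1 by (intro sum.cong) auto
    have Q: "Q y = coeff_poly N b2" by (simp only: Q_def y2)
    have y: "y \<in> D" unfolding D_def Q mem_Collect_eq y2 using b y1 by auto
    show "join_coeffs M b1 b2 \<in> arp_strict_domain (M + N + 2) T"
      using T(2) y unfolding y_def n_def by blast
    have I: "weighted_integral \<epsilon> \<delta> (coeff_poly M b1) (coeff_poly N b2) \<le> ennreal (C * H y)"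
      "ennreal (H y / C) \<le> weighted_integral \<epsilon> \<delta> (coeff_poly M b1) (coeff_poly N b2)"
      using C(2)[OF small(1,2)[OF y]] unfolding H_def P Q by auto
    have "1 / (C * C') * arp_val n T y \<le> H y / C"
      using C'(1,3) C(1) y by (simp add: field_simps)
    hence 1: "ennreal (1 / (C * C') * arp_val n T y) \<le> weighted_integral \<epsilon> \<delta> (coeff_poly M b1) (coeff_poly N b2)"
      using I(2) by (meson ennreal_leI order_trans)
    have "C * H y \<le> C * C' * arp_val n T y"
      using C'(2)[OF y] C(1) by (simp add: mult.assoc)
    hence 2: "weighted_integral \<epsilon> \<delta> (coeff_poly M b1) (coeff_poly N b2) \<le> ennreal (C * C' * arp_val n T y)"
      using I(1) by (meson ennreal_leI order_trans)
    show "let I = (\<integral>\<^sup>+ z. indicator (ball 0 1) z *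
                     ennreal (rpow (cmod (poly (coeff_poly M b1) z)) \<epsilon> /
                              rpow (cmod (poly (coeff_poly N b2) z)) \<delta>) \<partial>lborel)
           in ennreal (1 / (C * C') * arp_val (M + N + 2) T (join_coeffs M b1 b2)) \<le> I \<and>
              I \<le> ennreal (C * C' * arp_val (M + N + 2) T (join_coeffs M b1 b2))"
      using 1 2 unfolding weighted_integral_def y_def n_def Let_def by blast
  qed (use T(1) s1 C(1) C'(1) in \<open>auto simp: n_def\<close>)
qed

end
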